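(* There exist universal constants $C, c, C', c' > 0$ (independent of $d, N, k, \sigma, V, W, \varepsilon$) such that the following holds. Let $\sigma>0$, and let $V, W:\mathbb{R}^d\to\mathbb{R}$, with $W$ even, be $\beta_V$-smooth and $\beta_W$-smooth respectively. Let $\pi$ be a probability density on $\mathbb{R}^d$ satisfying $$\pi(x)\propto \exp\Bigl(-\frac{2}{\sigma^2}V(x)-\frac{2}{\sigma^2}\int W(x-y)\,\pi(y)\,dy\Bigr),$$ and suppose that $\pi$ satisfies a log-Sobolev inequality with constant $C_{\mathsf{LSI}}(\pi)$ and that $$\frac{\sigma^4}{8\beta_W^2\,C_{\mathsf{LSI}}(\pi)^2}\ge 3.$$ Let $N\ge 100$, let $\mu^{1:N}$ be the probability measure on $(\mathbb{R}^d)^N$ with density $$\mu^{1:N}(x^{1:N})\propto \exp\Bigl(-\frac{2}{\sigma^2}\sum_{i=1}^N V(x^i)-\frac{1}{\sigma^2(N-1)}\sum_{i=1}^N\sum_{j\ne i}W(x^i-x^j)\Bigr),$$ and let $\mu^{1:k}$ be the marginal of its first $k$ particles. Then for every $k\in\{1,\dots,N\}$, $$\mathsf{KL}(\mu^{1:k}\,\|\,\pi^{\otimes k})\le C\,\frac{dk^2}{N^2}\,(\log N)^{c}.$$ Consequently, for every $\varepsilon>0$, $\mathsf{KL}(\mu^{1:k}\,\|\,\pi^{\otimes k})<\varepsilon^2$ whenever $$N\ge \max\Bigl\{100,\; C'\,\frac{k\sqrt d}{\varepsilon}\,\Bigl(\log\bigl(2+\tfrac{k\sqrt d}{\varepsi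lon}\bigr)\Bigr)^{c'}\Bigr\}.$$
   Context: A differentiable function $U:\mathbb{R}^d\to\mathbb{R}$ is $\beta$-smooth if $\|\nabla U(x)-\nabla U(y)\|\le \beta\|x-y\|$ for all $x,y$. $\mathcal P_{2,\mathrm{ac}}(\mathbb{R}^d)$ denotes the probability measures on $\mathbb{R}^d$ with a Lebesgue density and finite second moment; measures are identified with their densities. $\mathsf{KL}(\mu\|\nu)=\mathbb{E}_\mu[\log\frac{\mu}{\nu}]$ and $\mathsf{FI}(\mu\|\nu)=\mathbb{E}_\mu[\|\nabla\log\frac{\mu}{\nu}\|^2]$, with value $\infty$ if $\mu\not\ll\nu$. A measure $\pi$ satisfies a log-Sobolev inequality with constant $C_{\mathsf{LSI}}(\pi)$ if $\mathsf{KL}(\mu\|\pi)\le \frac{C_{\mathsf{LSI}}(\pi)}{2}\mathsf{FI}(\mu\|\pi)$ for all $\mu\in\mathcal P_{2,\mathrm{ac}}(\mathbb{R}^d)$. It is a standing assumption that the densities $\pi$ and $\mu^{1:N}$ are well defined (normalizable) with finite second moment. *)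

theory Defs
  imports "HOL-Probability.Probability"
begin

text \<open>
  The constants of the theorem do not depend on the dimension, so the dimension has to be quantified
  below them and cannot be a type. Hence the points of \<open>d\<close>-dimensional Euclidean space are the
  extensional functions on \<open>{..<d}\<close>, which is the carrier of the product measure of \<open>d\<close> copies of
  \<open>lborel\<close>. On this carrier the product topology of \<open>nat \<Rightarrow> real\<close> is the Euclidean one.
  A configuration of \<open>N\<close> particles is an extensional function on \<open>{..<N}\<close> with values in
  that carrier; particles are numbered from \<open>0\<close>.
\<close>

abbreviation Rn :: "nat \<Rightarrow> (nat \<Rightarrow> real) set" where
  "Rn d \<equiv> PiE {..<d} (\<lambda>_. UNIV)"

definition leb :: "nat \<Rightarrow> (nat \<Rightarrow> real) measure" where
  "leb d = PiM {..<d} (\<lambda>_. lborel)"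

definition vnorm :: "nat \<Rightarrow> (nat \<Rightarrow> real) \<Rightarrow> real" where
  "vnorm d x = L2_set x {..<d}"

definition vdiff :: "nat \<Rightarrow> (nat \<Rightarrow> real) \<Rightarrow> (nat \<Rightarrow> real) \<Rightarrow> nat \<Rightarrow> real" where
  "vdiff d x y = (\<lambda>i\<in>{..<d}. x i - y i)"

definition vneg :: "nat \<Rightarrow> (nat \<Rightarrow> real) \<Rightarrow> nat \<Rightarrow> real" where
  "vneg d x = (\<lambda>i\<in>{..<d}. - x i)"

text \<open>Frechet differentiability at \<open>x\<close> with gradient \<open>g\<close>.\<close>

definition has_gradient ::
  "nat \<Rightarrow> ((nat \<Rightarrow> real) \<Rightarrow> real) \<Rightarrow> (nat \<Rightarrow> real) \<Rightarrow> (nat \<Rightarrow> real) \<Rightarrow> bool" where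
  "has_gradient d U g x \<longleftrightarrow>
     ((\<lambda>y. (U y - U x - (\<Sum>i<d. g i * (y i - x i))) / vnorm d (vdiff d y x)) \<longlongrightarrow> 0)
       (at x within Rn d)"

definition smooth :: "nat \<Rightarrow> real \<Rightarrow> ((nat \<Rightarrow> real) \<Rightarrow> real) \<Rightarrow> bool" where
  "smooth d \<beta> U \<longleftrightarrow>
     (\<exists>G. (\<forall>x\<in>Rn d. has_gradient d U (G x) x) \<and>
          (\<forall>x\<in>Rn d. \<forall>y\<in>Rn d. vnorm d (vdiff d (G x) (G y)) \<le> \<beta> * vnorm d (vdiff d x y)))"

definition even_fun :: "nat \<Rightarrow> ((nat \<Rightarrow> real) \<Rightarrow> real) \<Rightarrow> bool" where
  "even_fun d W \<longleftrightarrow> (\<forall>x\<in>Rn d. W (vneg d x) = W x)"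

definition P2ac :: "nat \<Rightarrow> (nat \<Rightarrow> real) measure set" where
  "P2ac d = {\<mu>. prob_space \<mu> \<and>
     (\<exists>f\<in>borel_measurable (leb d). \<mu> = density (leb d) f) \<and>
     (\<integral>\<^sup>+x. ennreal ((vnorm d x)\<^sup>2) \<partial>\<mu>) < \<infinity>}"

text \<open>
  Relative entropy with values in the extended reals. The library's \<open>KL_divergence\<close> takes the
  reference measure first and is a Bochner integral, hence 0 for a non-integrable integrand. For
  probability measures with \<open>\<mu>\<close> absolutely continuous with respect to \<open>\<nu>\<close> the negative part of
  \<open>ln (d\<mu>/d\<nu>)\<close> is always \<open>\<mu>\<close>-integrable, so non-integrability means that the value is infinite.
\<close>

definition KL :: "'a measure \<Rightarrow> 'a measure \<Rightarrow> ereal" where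
  "KL \<mu> \<nu> =
     (if absolutely_continuous \<nu> \<mu> \<and> integrable \<mu> (entropy_density (exp 1) \<nu> \<mu>)
      then ereal (KL_divergence (exp 1) \<nu> \<mu>) else \<infinity>)"

definition locally_integrable :: "nat \<Rightarrow> ((nat \<Rightarrow> real) \<Rightarrow> real) \<Rightarrow> bool" where
  "locally_integrable d f \<longleftrightarrow> (\<forall>R. set_integrable (leb d) {x\<in>Rn d. vnorm d x \<le> R} f)"

text \<open>
  \<open>\<phi>\<close> is continuously differentiable with gradient \<open>D\<close> and has bounded support. For
  locally integrable functions, testing against these \<open>\<phi>\<close> and testing against the smooth ones
  give the same weak gradients.
\<close>

definition test_fun ::
  "nat \<Rightarrow> ((nat \<Rightarrow> real) \<Rightarrow> real) \<Rightarrow> ((nat \<Rightarrow> real) \<Rightarrow> nat \<Rightarrow> real) \<Rightarrow> bool" where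
  "test_fun d \<phi> D \<longleftrightarrow>
     (\<forall>x\<in>Rn d. has_gradient d \<phi> (D x) x) \<and>
     (\<forall>i<d. continuous_on (Rn d) (\<lambda>x. D x i)) \<and>
     (\<exists>R. \<forall>x\<in>Rn d. vnorm d x > R \<longrightarrow> \<phi> x = 0)"

definition weak_gradient ::
  "nat \<Rightarrow> ((nat \<Rightarrow> real) \<Rightarrow> real) \<Rightarrow> ((nat \<Rightarrow> real) \<Rightarrow> nat \<Rightarrow> real) \<Rightarrow> bool" where
  "weak_gradient d f g \<longleftrightarrow>
     locally_integrable d f \<and>
     (\<forall>i<d. (\<lambda>x. g x i) \<in> borel_measurable (leb d) \<and> locally_integrable d (\<lambda>x. g x i)) \<and>
     (\<forall>\<phi> D. test_fun d \<phi> D \<longrightarrow>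
        (\<forall>i<d. (\<integral>x. f x * D x i \<partial>leb d) = - (\<integral>x. g x i * \<phi> x \<partial>leb d)))"

text \<open>
  Relative Fisher information, with \<open>f = d\<mu>/d\<nu>\<close> and \<open>\<nabla> log f = \<nabla>f / f\<close>, which makes sense
  \<open>\<mu>\<close>-almost everywhere even if \<open>f\<close> vanishes somewhere. The gradient is the weak one.
  If \<open>\<nu>\<close> has an almost everywhere positive Lebesgue density, as in all uses
  below, then \<open>f\<close> and \<open>g\<close> are unique almost everywhere and the infimum ranges over at most one value.
  The range is empty, and the infimum is infinite, if \<open>\<mu>\<close> is not absolutely continuous with respect
  to \<open>\<nu>\<close> or \<open>f\<close> is not weakly differentiable.
\<close>

definition FI :: "nat \<Rightarrow> (nat \<Rightarrow> real) measure \<Rightarrow> (nat \<Rightarrow> real) measure \<Rightarrow> ennreal" where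
  "FI d \<mu> \<nu> = Inf {\<integral>\<^sup>+x. ennreal ((vnorm d (\<lambda>i. g x i / f x))\<^sup>2) \<partial>\<mu> | f g.
     f \<in> borel_measurable (leb d) \<and> (\<forall>x\<in>Rn d. 0 \<le> f x) \<and>
     \<mu> = density \<nu> (\<lambda>x. ennreal (f x)) \<and> weak_gradient d f g}"

definition LSI :: "nat \<Rightarrow> (nat \<Rightarrow> real) measure \<Rightarrow> real \<Rightarrow> bool" where
  "LSI d \<pi> C \<longleftrightarrow> C > 0 \<and> (\<forall>\<mu>\<in>P2ac d. KL \<mu> \<pi> \<le> ereal (C / 2) * enn2ereal (FI d \<mu> \<pi>))"

definition prob_density_prop_to :: "'a measure \<Rightarrow> ('a \<Rightarrow> real) \<Rightarrow> ('a \<Rightarrow> real) \<Rightarrow> bool" where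
  "prob_density_prop_to M p h \<longleftrightarrow>
     p \<in> borel_measurable M \<and> prob_space (density M (\<lambda>x. ennreal (p x))) \<and>
     (\<exists>c>0. \<forall>x\<in>space M. p x = c * h x)"

definition configs :: "nat \<Rightarrow> nat \<Rightarrow> (nat \<Rightarrow> nat \<Rightarrow> real) measure" where
  "configs d N = PiM {..<N} (\<lambda>_. leb d)"

definition mean_field_stationary ::
  "nat \<Rightarrow> real \<Rightarrow> ((nat \<Rightarrow> real) \<Rightarrow> real) \<Rightarrow> ((nat \<Rightarrow> real) \<Rightarrow> real) \<Rightarrow> ((nat \<Rightarrow> real) \<Rightarrow> real) \<Rightarrow> bool"
  where
  "mean_field_stationary d \<sigma> V W p \<longleftrightarrow>
     prob_density_prop_to (leb d) p
       (\<lambda>x. exp (- (2 / \<sigma>\<^sup>2) * V x - (2 / \<sigma>\<^sup>2) * (\<integral>y. W (vdiff d x y) * p y \<partial>leb d))) \<and>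
     (\<integral>\<^sup>+x. ennreal ((vnorm d x)\<^sup>2) \<partial>density (leb d) (\<lambda>x. ennreal (p x))) < \<infinity>"

definition particle_stationary ::
  "nat \<Rightarrow> nat \<Rightarrow> real \<Rightarrow> ((nat \<Rightarrow> real) \<Rightarrow> real) \<Rightarrow> ((nat \<Rightarrow> real) \<Rightarrow> real) \<Rightarrow>
   ((nat \<Rightarrow> nat \<Rightarrow> real) \<Rightarrow> real) \<Rightarrow> bool" where
  "particle_stationary d N \<sigma> V W q \<longleftrightarrow>
     prob_density_prop_to (configs d N) q
       (\<lambda>x. exp (- (2 / \<sigma>\<^sup>2) * (\<Sum>i<N. V (x i))
                 - 1 / (\<sigma>\<^sup>2 * (real N - 1)) * (\<Sum>i<N. \<Sum>j\<in>{..<N} - {i}. W (vdiff d (x i) (x j))))) \<and>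
     (\<integral>\<^sup>+x. ennreal (\<Sum>i<N. (vnorm d (x i))\<^sup>2) \<partial>density (configs d N) (\<lambda>x. ennreal (q x))) < \<infinity>"

definition marginal ::
  "nat \<Rightarrow> nat \<Rightarrow> (nat \<Rightarrow> nat \<Rightarrow> real) measure \<Rightarrow> (nat \<Rightarrow> nat \<Rightarrow> real) measure" where
  "marginal d k \<mu> = distr \<mu> (configs d k) (\<lambda>x. restrict x {..<k})"

definition tensor_power :: "nat \<Rightarrow> (nat \<Rightarrow> real) measure \<Rightarrow> (nat \<Rightarrow> nat \<Rightarrow> real) measure" where
  "tensor_power k \<pi> = PiM {..<k} (\<lambda>_. \<pi>)"

end

theory Submission
  imports Defs
begin

text \<open>
  The idea is to compare the particles with independent copies of \<open>\<pi>\<close> one at a time. By the chain rule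
  (\<open>entropy_chain_rule\<close>, \<open>KL_marginal\<close>) the relative entropy of the first \<open>k\<close> particles is
  \<open>D 0 + \<dots> + D (k - 1)\<close>, where \<open>D j\<close> is the expected relative entropy, with respect to \<open>\<pi>\<close>, of the
  conditional law of particle \<open>j\<close> given the earlier ones. Each conditional law lives on a single
  copy of the space, so the log-Sobolev inequality of \<open>\<pi>\<close> applies to it directly.

  The potentials enter only through the density of the particles with respect to the product of the
  \<open>\<pi>\<close>. Its logarithmic gradient in particle \<open>j\<close> is \<open>- \<kappa>\<close> times the sum over \<open>i \<noteq> j\<close> of the deviations
  \<open>dev (x j) (x i)\<close> of \<open>\<nabla>W(x j - x i)\<close> from its mean over \<open>\<pi>\<close>, with \<open>\<kappa> = 2 / (\<sigma>\<^sup>2 (N - 1))\<close>. After the later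
  particles are averaged out, what remains is the sum over the earlier particles plus \<open>N - 1 - j\<close>
  equal conditional means of the interaction with the next particle. The Herbst argument makes the
  deviations subgaussian under \<open>\<pi>\<close> (\<open>subgaussian\<close>), and a transport inequality (\<open>transport_bound\<close>)
  bounds the mean square of such a conditional mean by \<open>D (j + 1)\<close>. Altogether (\<open>D_recursion\<close>)
  \<open>D j \<le> C \<kappa>\<^sup>2 A j + D (j + 1) / 3\<close>,
  with \<open>A j\<close> the mean square of the sum of the deviations over the earlier particles. The factor \<open>1/3\<close> is the
  assumption on the interaction strength; hence the recursion can be summed from \<open>j = N\<close> downwards, and
  \<open>D j\<close> is comparable to \<open>C \<kappa>\<^sup>2 A j\<close>.

  It remains to see that \<open>A j\<close> is of order \<open>j\<close> and not of order \<open>j\<^sup>2\<close>. By exchangeability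
  \<open>A j = j Mq + j (j - 1) Pc\<close>, with \<open>Mq\<close> the mean square of one deviation and \<open>Pc\<close> the covariance of two.
  The crude bound \<open>Pc \<le> Mq\<close> already gives that \<open>D 1\<close> and \<open>D 2\<close> are at most of order \<open>C \<kappa>\<^sup>2 Mq\<close>. The covariance contains a
  conditional mean of the above kind, so \<open>D 2\<close> being small improves its bound to \<open>Pc \<le> 4 Mq / (N - 1)\<close> (\<open>Pc_le\<close>).
  And \<open>Mq\<close> is the second moment of a \<open>d\<close>-dimensional subgaussian vector under a law whose entropy is
  \<open>D 1\<close>, hence of order \<open>d\<close> (\<open>gaussian_linearisation\<close>, \<open>square_bound\<close>, \<open>Mq_le\<close>). So \<open>D j\<close> is of order \<open>d j / N\<^sup>2\<close>,
  and the sum over \<open>j < k\<close> is at most \<open>8 d k\<^sup>2 / N\<^sup>2\<close>.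
\<close>

section \<open>Calculus on the space of extensional functions\<close>

lemma vnorm_nonneg [simp]: "0 \<le> vnorm d x"
  by (simp add: vnorm_def)

lemma vnorm_sq: "(vnorm d x)\<^sup>2 = (\<Sum>i<d. (x i)\<^sup>2)"
  by (simp add: vnorm_def L2_set_def sum_nonneg)

lemma vnorm_cong: "(\<And>i. i < d \<Longrightarrow> x i = y i) \<Longrightarrow> vnorm d x = vnorm d y"
  by (simp add: vnorm_def L2_set_def)

lemma vnorm_scale: "vnorm d (\<lambda>i. c * x i) = \<bar>c\<bar> * vnorm d x"
  by (simp add: vnorm_def L2_set_def power_mult_distrib sum_distrib_left[symmetric] real_sqrt_mult)

lemma vnorm_triangle: "vnorm d (\<lambda>i. x i + y i) \<le> vnorm d x + vnorm d y"
  unfolding vnorm_def by (rule L2_set_triangle_ineq)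

lemma abs_coord_le_vnorm: "i < d \<Longrightarrow> \<bar>x i\<bar> \<le> vnorm d x"
  using member_le_L2_set[of "{..<d}" i "\<lambda>i. \<bar>x i\<bar>"] by (simp add: vnorm_def L2_set_def)

lemma abs_inner_le_vnorm: "\<bar>\<Sum>i<d. x i * y i\<bar> \<le> vnorm d x * vnorm d y"
proof -
  have "\<bar>\<Sum>i<d. x i * y i\<bar> \<le> (\<Sum>i<d. \<bar>x i\<bar> * \<bar>y i\<bar>)"
    by (rule order_trans[OF sum_abs]) (simp add: abs_mult)
  also have "\<dots> \<le> vnorm d x * vnorm d y"
    unfolding vnorm_def by (rule L2_set_mult_ineq)
  finally show ?thesis .
qed

lemma vdiff_in_Rn [simp]: "vdiff d x y \<in> Rn d"
  by (simp add: vdiff_def)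

lemma vdiff_apply: "i < d \<Longrightarrow> vdiff d x y i = x i - y i"
  by (simp add: vdiff_def)

lemma vnorm_vdiff: "vnorm d (vdiff d x y) = vnorm d (\<lambda>i. x i - y i)"
  by (rule vnorm_cong) (simp add: vdiff_apply)

definition line :: "nat \<Rightarrow> (nat \<Rightarrow> real) \<Rightarrow> (nat \<Rightarrow> real) \<Rightarrow> real \<Rightarrow> nat \<Rightarrow> real" where
  "line d x v t = (\<lambda>i\<in>{..<d}. x i + t * v i)"

lemma line_in_Rn [simp]: "line d x v t \<in> Rn d"
  by (simp add: line_def)

lemma line_0 [simp]: "x \<in> Rn d \<Longrightarrow> line d x v 0 = x"
  by (simp add: line_def PiE_iff extensional_restrict)

lemma vnorm_line: "vnorm d (vdiff d (line d x v s) (line d x v t)) = \<bar>s - t\<bar> * vnorm d v"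
proof -
  have "vnorm d (vdiff d (line d x v s) (line d x v t)) = vnorm d (\<lambda>i. (s - t) * v i)"
    by (rule vnorm_cong) (simp add: vdiff_apply line_def algebra_simps)
  then show ?thesis by (simp add: vnorm_scale)
qed

lemma continuous_line: "continuous_on UNIV (line d x v)"
proof (rule continuous_on_coordinatewise_then_product)
  fix i
  show "continuous_on UNIV (\<lambda>t. line d x v t i)"
    by (cases "i < d") (auto simp: line_def intro!: continuous_intros)
qed

text \<open>
  The restriction of a Frechet gradient to straight lines: it gives access to the mean value theorem and
  the fundamental theorem of calculus in one variable.
\<close>

lemma has_gradient_line:
  assumes "has_gradient d U (G (line d x v t)) (line d x v t)"
  shows "((\<lambda>s. U (line d x v s)) has_real_derivative (\<Sum>i<d. G (line d x v t) i * v i)) (at t)"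
proof (cases "vnorm d v = 0")
  case True
  then have v: "v i = 0" if "i < d" for i
    using abs_coord_le_vnorm[OF that, of v] by simp
  then have "line d x v s = line d x v t" for s
    by (auto simp: line_def)
  then have "(\<lambda>s. U (line d x v s)) = (\<lambda>s. U (line d x v t))" by metis
  moreover have "(\<Sum>i<d. G (line d x v t) i * v i) = 0" using v by simp
  ultimately show ?thesis by simp
next
  case False
  define y where "y = line d x v t"
  define n where "n = vnorm d v"
  define D where "D = (\<Sum>i<d. G y i * v i)"
  have n: "n > 0" using False unfolding n_def by (metis order_le_less vnorm_nonneg)
  have ne: "line d x v s \<noteq> y" if "s \<noteq> t" for s
  proof
    assume "line d x v s = y"
    then have "vnorm d (vdiff d (line d x v s) (line d x v t)) = vnorm d (vdiff d y y)"
      by (simp add: y_def)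
    also have "\<dots> = 0" unfolding vnorm_vdiff by (simp add: vnorm_def L2_set_def)
    finally show False using that n by (simp add: vnorm_line n_def)
  qed
  have fl: "filterlim (line d x v) (at y within Rn d) (at t)"
    unfolding filterlim_at
  proof
    show "\<forall>\<^sub>F s in at t. line d x v s \<in> Rn d \<and> line d x v s \<noteq> y"
      using ne by (auto simp: eventually_at_filter)
    show "(line d x v \<longlongrightarrow> y) (at t)"
      using continuous_line[of d x v] by (auto simp: continuous_on_def y_def)
  qed
  have "((\<lambda>s. (U (line d x v s) - U y - (\<Sum>i<d. G y i * (line d x v s i - y i))) /
          vnorm d (vdiff d (line d x v s) y)) \<longlongrightarrow> 0) (at t)"
    using assms[unfolded has_gradient_def, folded y_def] fl by (rule filterlim_compose)
  moreover have "(\<Sum>i<d. G y i * (line d x v s i - y i)) = (s - t) * D" for s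
    unfolding D_def sum_distrib_left
    by (rule sum.cong) (auto simp: y_def line_def algebra_simps)
  ultimately have "((\<lambda>s. (U (line d x v s) - U y - (s - t) * D) / (\<bar>s - t\<bar> * n)) \<longlongrightarrow> 0) (at t)"
    by (simp add: y_def vnorm_line n_def)
  then have "((\<lambda>s. n * \<bar>(U (line d x v s) - U y - (s - t) * D) / (\<bar>s - t\<bar> * n)\<bar>) \<longlongrightarrow> 0) (at t)"
    by (intro tendsto_mult_right_zero tendsto_rabs_zero)
  then have "((\<lambda>s. \<bar>(U (line d x v s) - U y) / (s - t) - D\<bar>) \<longlongrightarrow> 0) (at t)"
  proof (rule Lim_transform_eventually)
    show "\<forall>\<^sub>F s in at t. n * \<bar>(U (line d x v s) - U y - (s - t) * D) / (\<bar>s - t\<bar> * n)\<bar>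
       = \<bar>(U (line d x v s) - U y) / (s - t) - D\<bar>"
      unfolding eventually_at_filter
    proof (rule always_eventually, intro allI impI)
      fix s assume "s \<noteq> t"
      then have "(U (line d x v s) - U y) / (s - t) - D = (U (line d x v s) - U y - (s - t) * D) / (s - t)"
        by (simp add: diff_divide_distrib)
      then show "n * \<bar>(U (line d x v s) - U y - (s - t) * D) / (\<bar>s - t\<bar> * n)\<bar>
       = \<bar>(U (line d x v s) - U y) / (s - t) - D\<bar>"
        using n by (simp add: abs_divide abs_mult)
    qed
  qed
  then have "((\<lambda>s. (U (line d x v s) - U y) / (s - t)) \<longlongrightarrow> D) (at t)"
    by (simp add: tendsto_rabs_zero_iff LIM_zero_iff)
  then show ?thesis
    by (simp add: has_field_derivative_iff D_def y_def)
qed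

lemma line_coord:
  assumes "x \<in> Rn d" "i < d"
  shows "line d x (\<lambda>j. if j = i then 1 else 0) s = x(i := x i + s)"
proof
  fix j
  show "line d x (\<lambda>j. if j = i then 1 else 0) s j = (x(i := x i + s)) j"
    using assms by (simp add: line_def PiE_iff extensional_def)
qed

lemma has_gradient_coord:
  assumes U: "\<And>x. x \<in> Rn d \<Longrightarrow> has_gradient d U (G x) x" and x: "x \<in> Rn d" and i: "i < d"
  shows "((\<lambda>t. U (x(i := t))) has_real_derivative G (x(i := t)) i) (at t)"
proof -
  let ?e = "\<lambda>j. if j = i then 1 else (0::real)"
  have c: "line d x ?e (s - x i) = x(i := s)" for s
    using line_coord[OF x i, of "s - x i"] by simp
  have "((\<lambda>s. U (line d x ?e s)) has_real_derivative (\<Sum>j<d. G (line d x ?e (t - x i)) j * ?e j))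
      (at (t + - x i))"
    using has_gradient_line[where x=x and v="?e" and t="t - x i" and G=G, OF U[OF line_in_Rn]] by simp
  then have "((\<lambda>s. U (line d x ?e (s + - x i))) has_real_derivative
      (\<Sum>j<d. G (line d x ?e (t - x i)) j * ?e j)) (at t)"
    by (rule DERIV_shift[THEN iffD1])
  moreover have "(\<Sum>j<d. G (line d x ?e (t - x i)) j * ?e j) = G (x(i := t)) i"
    using i by (simp add: c if_distrib[where f="\<lambda>a. _ * a"] sum.delta cong: if_cong)
  ultimately show ?thesis by (simp add: c)
qed

lemma tendsto_coord: "((\<lambda>y::nat \<Rightarrow> real. y i) \<longlongrightarrow> x i) (at x within S)"
proof -
  have "continuous_on UNIV (\<lambda>y::nat \<Rightarrow> real. y i)"
    by (rule continuous_on_product_then_coordinatewise[OF continuous_on_id])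
  then have "((\<lambda>y. y i) \<longlongrightarrow> x i) (at x within UNIV)"
    unfolding continuous_on_def by blast
  then show ?thesis by (rule tendsto_within_subset) simp
qed

lemma tendsto_vnorm_vdiff: "((\<lambda>y. vnorm d (vdiff d y x)) \<longlongrightarrow> 0) (at x within S)"
proof -
  have "((\<lambda>y. sqrt (\<Sum>i<d. (y i - x i)\<^sup>2)) \<longlongrightarrow> sqrt (\<Sum>i<d. (x i - x i)\<^sup>2)) (at x within S)"
    by (intro tendsto_intros tendsto_coord)
  then show ?thesis unfolding vnorm_vdiff by (simp add: vnorm_def L2_set_def)
qed

lemma has_gradient_continuous:
  assumes U: "\<And>x. x \<in> Rn d \<Longrightarrow> has_gradient d U (G x) x"
  shows "continuous_on (Rn d) U"
  unfolding continuous_on_def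
proof
  fix x assume x: "x \<in> Rn d"
  define n where "n y = vnorm d (vdiff d y x)" for y
  define l where "l y = (\<Sum>i<d. G x i * (y i - x i))" for y
  define q where "q y = (U y - U x - l y) / n y" for y
  have q0: "(q \<longlongrightarrow> 0) (at x within Rn d)"
    using U[OF x] unfolding has_gradient_def q_def n_def l_def .
  have n0: "(n \<longlongrightarrow> 0) (at x within Rn d)"
    unfolding n_def by (rule tendsto_vnorm_vdiff)
  have "(l \<longlongrightarrow> l x) (at x within Rn d)"
    unfolding l_def by (intro tendsto_sum tendsto_mult tendsto_diff tendsto_const tendsto_coord)
  then have l0: "(l \<longlongrightarrow> 0) (at x within Rn d)" by (simp add: l_def)
  have "((\<lambda>y. q y * n y + l y + U x) \<longlongrightarrow> 0 * 0 + 0 + U x) (at x within Rn d)"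
    by (rule tendsto_add[OF tendsto_add[OF tendsto_mult[OF q0 n0] l0] tendsto_const])
  then have lim: "((\<lambda>y. q y * n y + l y + U x) \<longlongrightarrow> U x) (at x within Rn d)" by simp
  have "q y * n y + l y + U x = U y" if y: "y \<in> Rn d" "y \<noteq> x" for y
  proof -
    have "n y \<noteq> 0"
    proof
      assume "n y = 0"
      then have "y i = x i" if "i < d" for i
        using abs_coord_le_vnorm[OF that, of "\<lambda>i. y i - x i"] by (simp add: n_def vnorm_vdiff)
      then have "y = x" using x y(1) by (intro PiE_ext[of y "{..<d}" _ x]) auto
      then show False using y by simp
    qed
    then show ?thesis by (simp add: q_def)
  qed
  then have "\<forall>\<^sub>F y in at x within Rn d. q y * n y + l y + U x = U y"
    unfolding eventually_at_filter by (intro always_eventually) blast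
  then show "(U \<longlongrightarrow> U x) (at x within Rn d)"
    by (rule Lim_transform_eventually[OF lim])
qed

lemma lipschitz_coord_continuous:
  assumes "\<And>x y. x \<in> Rn d \<Longrightarrow> y \<in> Rn d \<Longrightarrow> vnorm d (vdiff d (G x) (G y)) \<le> L * vnorm d (vdiff d x y)"
    and i: "i < d"
  shows "continuous_on (Rn d) (\<lambda>x. G x i)"
  unfolding continuous_on_def
proof
  fix x assume x: "x \<in> Rn d"
  have "((\<lambda>y. G y i - G x i) \<longlongrightarrow> 0) (at x within Rn d)"
  proof (rule Lim_null_comparison)
    show "\<forall>\<^sub>F y in at x within Rn d. norm (G y i - G x i) \<le> L * vnorm d (vdiff d y x)"
    proof -
      have "norm (G y i - G x i) \<le> L * vnorm d (vdiff d y x)" if "y \<in> Rn d" for y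
        using abs_coord_le_vnorm[OF i, of "vdiff d (G y) (G x)"] assms(1)[OF that x] i
        by (simp add: vdiff_apply)
      then show ?thesis by (auto simp: eventually_at_filter)
    qed
    show "((\<lambda>y. L * vnorm d (vdiff d y x)) \<longlongrightarrow> 0) (at x within Rn d)"
      using tendsto_mult_right_zero[OF tendsto_vnorm_vdiff] .
  qed
  then show "((\<lambda>y. G y i) \<longlongrightarrow> G x i) (at x within Rn d)"
    by (simp add: LIM_zero_iff)
qed

lemma space_leb: "space (leb d) = Rn d"
  by (simp add: leb_def space_PiM)

text \<open>
  Continuity refers to the topology of all functions on \<open>nat\<close>, measurability to the product over
  \<open>{..<d}\<close>; restriction to \<open>{..<d}\<close> is continuous, so \<open>U\<close> extends to all functions.
\<close>

lemma measurable_continuous_leb: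
  assumes "continuous_on (Rn d) (U :: _ \<Rightarrow> real)"
  shows "U \<in> borel_measurable (leb d)"
proof -
  have r: "continuous_on UNIV (\<lambda>x::nat \<Rightarrow> real. restrict x {..<d})"
  proof (rule continuous_on_coordinatewise_then_product)
    fix i
    show "continuous_on UNIV (\<lambda>x::nat \<Rightarrow> real. restrict x {..<d} i)"
    proof (cases "i < d")
      case True
      then have "(\<lambda>x::nat \<Rightarrow> real. restrict x {..<d} i) = (\<lambda>x. x i)" by simp
      then show ?thesis
        by (simp only:) (rule continuous_on_product_then_coordinatewise[OF continuous_on_id])
    next
      case False
      then have "(\<lambda>x::nat \<Rightarrow> real. restrict x {..<d} i) = (\<lambda>x. undefined)" by simp
      then show ?thesis by (simp only: continuous_on_const)
    qed
  qed
  have "continuous_on UNIV (\<lambda>x. U (restrict x {..<d}))"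
    by (rule continuous_on_compose2[OF assms r]) (simp add: image_subset_iff)
  then have 1: "(\<lambda>x. U (restrict x {..<d})) \<in> borel_measurable borel"
    by (rule borel_measurable_continuous_onI)
  have "(\<lambda>x. x) \<in> borel_measurable (leb d)"
  proof (rule measurable_coordinatewise_then_product)
    fix i
    show "(\<lambda>x. x i) \<in> borel_measurable (leb d)"
    proof (cases "i < d")
      case True
      then show ?thesis unfolding leb_def
        by (metis lessThan_iff measurable_component_singleton measurable_lborel1)
    next
      case False
      then have "x i = undefined" if "x \<in> space (leb d)" for x
        using that by (auto simp: space_leb PiE_def extensional_def)
      then show ?thesis by (subst measurable_cong[where g="\<lambda>_. undefined"]) auto
    qed
  qed
  from measurable_compose[OF this 1]
  have "(\<lambda>x. U (restrict x {..<d})) \<in> borel_measurable (leb d)" .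
  then show ?thesis
  proof (rule measurable_cong[THEN iffD1, rotated])
    fix x assume "x \<in> space (leb d)"
    then show "U (restrict x {..<d}) = U x"
      by (simp add: space_leb restrict_PiE PiE_restrict)
  qed
qed

lemma measurable_leb_coord: "i < d \<Longrightarrow> (\<lambda>x. x i) \<in> borel_measurable (leb d)"
  unfolding leb_def by (metis lessThan_iff measurable_component_singleton measurable_lborel1)

lemma measurable_into_leb:
  assumes "\<And>i. i < d \<Longrightarrow> (\<lambda>x. f x i) \<in> borel_measurable M" "\<And>x. x \<in> space M \<Longrightarrow> f x \<in> Rn d"
  shows "f \<in> measurable M (leb d)"
  unfolding leb_def using assms by (intro measurable_PiM_single') (auto simp: measurable_lborel1)

lemma measurable_vdiff [measurable]:
  assumes [measurable]: "f \<in> measurable M (leb d)" "g \<in> measurable M (leb d)"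
  shows "(\<lambda>x. vdiff d (f x) (g x)) \<in> measurable M (leb d)"
proof (rule measurable_into_leb)
  fix i assume i: "i < d"
  have [measurable]: "(\<lambda>x. f x i) \<in> borel_measurable M" "(\<lambda>x. g x i) \<in> borel_measurable M"
    by (rule measurable_compose[OF _ measurable_leb_coord[OF i]], measurable)+
  show "(\<lambda>x. vdiff d (f x) (g x) i) \<in> borel_measurable M"
    using i by (simp add: vdiff_apply)
qed simp

lemma measurable_line [measurable]:
  assumes [measurable]: "f \<in> measurable M (leb d)"
  shows "(\<lambda>x. line d (f x) v t) \<in> measurable M (leb d)"
proof (rule measurable_into_leb)
  fix i assume i: "i < d"
  have [measurable]: "(\<lambda>x. f x i) \<in> borel_measurable M"
    by (rule measurable_compose[OF _ measurable_leb_coord[OF i]], measurable)+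
  show "(\<lambda>x. line d (f x) v t i) \<in> borel_measurable M"
    using i by (simp add: line_def)
qed simp

lemma measurable_vnorm_fun:
  "(\<And>i. i < d \<Longrightarrow> (\<lambda>x. u x i) \<in> borel_measurable M) \<Longrightarrow> (\<lambda>x. vnorm d (u x)) \<in> borel_measurable M"
  unfolding vnorm_def L2_set_def
  by (intro borel_measurable_sqrt[THEN measurable_compose[rotated]] borel_measurable_sum
      borel_measurable_power) auto

lemma measurable_vnorm [measurable]: "vnorm d \<in> borel_measurable (leb d)"
  by (rule measurable_vnorm_fun[OF measurable_leb_coord])

lemma compact_box: "compact {x \<in> Rn d. \<forall>i<d. \<bar>x i\<bar> \<le> R}"
proof -
  define S where "S i = (if i < d then {-R..R} else {undefined})" for i
  have S: "z \<in> S i \<longleftrightarrow> (if i < d then \<bar>z\<bar> \<le> R else z = undefined)" for z i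
    by (auto simp: S_def abs_le_iff)
  have "{x \<in> Rn d. \<forall>i<d. \<bar>x i\<bar> \<le> R} = PiE UNIV S"
  proof (rule set_eqI)
    fix x :: "nat \<Rightarrow> real"
    show "x \<in> {x \<in> Rn d. \<forall>i<d. \<bar>x i\<bar> \<le> R} \<longleftrightarrow> x \<in> PiE UNIV S"
      unfolding PiE_iff S extensional_def mem_Collect_eq if_bool_eq_conj lessThan_iff by blast
  qed
  moreover have "compactin (product_topology (\<lambda>_. euclidean) UNIV) (PiE UNIV S)"
    by (subst compactin_PiE) (auto simp: S_def)
  ultimately show ?thesis unfolding euclidean_product_topology compactin_euclidean_iff by metis
qed

lemma continuous_bounded_on_ball:
  assumes "continuous_on (Rn d) (U :: _ \<Rightarrow> real)"
  obtains B where "\<And>x. x \<in> Rn d \<Longrightarrow> vnorm d x \<le> R \<Longrightarrow> \<bar>U x\<bar> \<le> B"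
proof -
  define K :: "(nat \<Rightarrow> real) set" where "K = {x \<in> Rn d. \<forall>i<d. \<bar>x i\<bar> \<le> R}"
  have "compact (U ` K)" unfolding K_def
    by (rule compact_continuous_image[OF continuous_on_subset[OF assms] compact_box]) blast
  then have "bounded (U ` K)" by (rule compact_imp_bounded)
  then obtain B where B: "\<And>y. y \<in> U ` K \<Longrightarrow> \<bar>y\<bar> \<le> B"
    unfolding bounded_real by blast
  show ?thesis
  proof (rule that)
    fix x assume x: "x \<in> Rn d" "vnorm d x \<le> R"
    then have "x \<in> K"
      unfolding K_def using abs_coord_le_vnorm[of _ d x] by (blast intro: order_trans)
    then show "\<bar>U x\<bar> \<le> B" using B by blast
  qed
qed


section \<open>Integration by parts and weak gradients of mixtures\<close>

text \<open>
  Fubini's theorem only sees lines parallel to the axes, so partial derivatives along these are the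
  notion of differentiability that integration by parts asks for.
\<close>

definition has_partials ::
  "nat \<Rightarrow> ((nat \<Rightarrow> real) \<Rightarrow> real) \<Rightarrow> ((nat \<Rightarrow> real) \<Rightarrow> nat \<Rightarrow> real) \<Rightarrow> bool" where
  "has_partials d U DU \<longleftrightarrow>
     (\<forall>x\<in>Rn d. \<forall>i<d. \<forall>t. ((\<lambda>s. U (x(i := s))) has_real_derivative DU (x(i := t)) i) (at t))"

lemma has_partialsD:
  "has_partials d U DU \<Longrightarrow> x \<in> Rn d \<Longrightarrow> i < d \<Longrightarrow>
     ((\<lambda>s. U (x(i := s))) has_real_derivative DU (x(i := t)) i) (at t)"
  by (simp add: has_partials_def)

lemma upd_in_Rn: "x \<in> Rn d \<Longrightarrow> i < d \<Longrightarrow> x(i := t) \<in> Rn d"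
  by (auto simp: PiE_iff extensional_def)

lemma has_gradient_has_partials:
  "(\<And>x. x \<in> Rn d \<Longrightarrow> has_gradient d U (G x) x) \<Longrightarrow> has_partials d U G"
  unfolding has_partials_def using has_gradient_coord by blast

lemma has_partials_divide:
  "has_partials d U DU \<Longrightarrow> has_partials d (\<lambda>x. U x / c) (\<lambda>x i. DU x i / c)"
  unfolding has_partials_def by (auto intro: DERIV_cdivide)

text \<open>
  The derivative may fail to be integrable; then its Bochner integral is 0 by convention, as claimed.
  This makes the lemma applicable on every line in the proof below, without discarding null sets.
\<close>

lemma integral_derivative_bounded_support:
  fixes f f' :: "real \<Rightarrow> real"
  assumes f: "\<And>t. (f has_real_derivative f' t) (at t)" and supp: "\<And>t. \<bar>t\<bar> > R \<Longrightarrow> f t = 0"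
  shows "(\<integral>t. f' t \<partial>lborel) = 0"
proof (cases "integrable lborel f'")
  case True
  define a where "a = \<bar>R\<bar> + 1"
  have out: "f' t = 0" if "\<bar>t\<bar> > a" for t
  proof -
    have "open {s::real. \<bar>s\<bar> > a}" by (intro open_Collect_less continuous_intros)
    moreover have "f s = 0" if "s \<in> {s. \<bar>s\<bar> > a}" for s using that by (intro supp) (simp add: a_def)
    ultimately have "((\<lambda>_. 0) has_real_derivative f' t) (at t)"
      using that by (intro has_field_derivative_transform_within_open[OF f]) auto
    then show ?thesis by (rule DERIV_unique[OF _ DERIV_const, symmetric, THEN sym])
  qed
  have "(\<integral>t. f' t \<partial>lborel) = (LINT t:{-a..a}|lborel. f' t)"
    unfolding set_lebesgue_integral_def
  proof (rule Bochner_Integration.integral_cong[OF refl])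
    fix t show "f' t = indicator {-a..a} t *\<^sub>R f' t"
      using out[of t] by (cases "\<bar>t\<bar> > a") (auto simp: indicator_def)
  qed
  also have "\<dots> = integral {-a..a} f'"
    by (rule set_borel_integral_eq_integral)
      (unfold set_integrable_def, rule integrable_mult_indicator[OF _ True], simp)
  also have "\<dots> = f a - f (-a)"
    by (intro integral_unique fundamental_theorem_of_calculus)
      (auto simp: a_def has_real_derivative_iff_has_vector_derivative[symmetric]
        intro: has_field_derivative_at_within f)
  also have "\<dots> = 0" by (simp add: supp a_def)
  finally show ?thesis .
qed (simp add: not_integrable_integral_eq)

lemma integral_partials_by_parts:
  assumes U: "has_partials d U DU" and \<phi>: "has_partials d \<phi> D"
    and supp: "\<And>x. x \<in> Rn d \<Longrightarrow> vnorm d x > R \<Longrightarrow> \<phi> x = 0" and i: "i < d"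
    and int1: "integrable (leb d) (\<lambda>x. U x * D x i)"
    and int2: "integrable (leb d) (\<lambda>x. DU x i * \<phi> x)"
  shows "(\<integral>x. U x * D x i \<partial>leb d) = - (\<integral>x. DU x i * \<phi> x \<partial>leb d)"
proof -
  interpret product_sigma_finite "\<lambda>_::nat. lborel::real measure" by standard
  define h where "h x = U x * D x i + DU x i * \<phi> x" for x
  define I where "I = {..<d} - {i}"
  have I: "insert i I = {..<d}" "finite I" "i \<notin> I" using i by (auto simp: I_def)
  have int: "integrable (leb d) h" unfolding h_def by (intro Bochner_Integration.integrable_add int1 int2)
  have "(\<integral>x. h x \<partial>leb d) = (\<integral>x. (\<integral>t. h (x(i := t)) \<partial>lborel) \<partial>PiM I (\<lambda>_. lborel))"
    using product_integral_insert[OF I(2,3), of h] int by (simp add: leb_def I(1))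
  also have "\<dots> = (\<integral>x. 0 \<partial>PiM I (\<lambda>_. lborel::real measure))"
  proof (rule Bochner_Integration.integral_cong[OF refl])
    fix x :: "nat \<Rightarrow> real" assume "x \<in> space (PiM I (\<lambda>_. lborel))"
    then have x: "x(i := t) \<in> Rn d" for t
      using i by (auto simp: space_PiM I_def PiE_iff extensional_def)
    show "(\<integral>t. h (x(i := t)) \<partial>lborel) = 0"
    proof (rule integral_derivative_bounded_support)
      fix t
      show "((\<lambda>s. U (x(i := s)) * \<phi> (x(i := s))) has_real_derivative h (x(i := t))) (at t)"
        using DERIV_mult[OF has_partialsD[OF U x[of 0] i, of t] has_partialsD[OF \<phi> x[of 0] i, of t]]
        by (simp add: h_def algebra_simps)
    next
      fix t assume "\<bar>t\<bar> > R"
      then have "vnorm d (x(i := t)) > R"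
        using abs_coord_le_vnorm[OF i, of "x(i := t)"] by simp
      then show "U (x(i := t)) * \<phi> (x(i := t)) = 0" using supp[OF x] by simp
    qed
  qed
  also have "\<dots> = 0" by simp
  also have "(\<integral>x. h x \<partial>leb d) = (\<integral>x. U x * D x i \<partial>leb d) + (\<integral>x. DU x i * \<phi> x \<partial>leb d)"
    unfolding h_def by (rule Bochner_Integration.integral_add[OF int1 int2])
  finally show ?thesis by simp
qed

lemma test_fun_bounds:
  assumes "test_fun d \<phi> D"
  obtains R K where "\<And>x. x \<in> Rn d \<Longrightarrow> vnorm d x > R \<Longrightarrow> \<phi> x = 0"
    "\<And>x i. x \<in> Rn d \<Longrightarrow> i < d \<Longrightarrow> vnorm d x > R \<Longrightarrow> D x i = 0"
    "\<And>x. x \<in> Rn d \<Longrightarrow> \<bar>\<phi> x\<bar> \<le> K" "\<And>x i. x \<in> Rn d \<Longrightarrow> i < d \<Longrightarrow> \<bar>D x i\<bar> \<le> K"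
proof -
  from assms obtain R where g: "\<And>x. x \<in> Rn d \<Longrightarrow> has_gradient d \<phi> (D x) x"
    and c: "\<And>i. i < d \<Longrightarrow> continuous_on (Rn d) (\<lambda>x. D x i)"
    and R: "\<And>x. x \<in> Rn d \<Longrightarrow> vnorm d x > R \<Longrightarrow> \<phi> x = 0"
    unfolding test_fun_def by blast
  have D0: "D x i = 0" if x: "x \<in> Rn d" and i: "i < d" and r: "vnorm d x > R" for x i
  proof -
    let ?S = "{s. R < vnorm d (x(i := s))}"
    have "continuous_on UNIV (\<lambda>s. vnorm d (x(i := s)))"
      unfolding vnorm_def L2_set_def
    proof (intro continuous_intros)
      fix j show "continuous_on UNIV (\<lambda>s. (x(i := s)) j)"
        by (cases "j = i") auto
    qed
    then have "open ?S" by (intro open_Collect_less) auto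
    moreover have "\<phi> (x(i := s)) = 0" if "s \<in> ?S" for s
      using that by (intro R upd_in_Rn[OF x i]) auto
    ultimately have "((\<lambda>_. 0) has_real_derivative D (x(i := x i)) i) (at (x i))"
      using r by (intro has_field_derivative_transform_within_open[OF has_gradient_coord[OF g x i]]) auto
    then have "D (x(i := x i)) i = 0" by (rule DERIV_unique[OF _ DERIV_const])
    then show ?thesis by simp
  qed
  obtain K0 where K0: "\<And>x. x \<in> Rn d \<Longrightarrow> vnorm d x \<le> R \<Longrightarrow> \<bar>\<phi> x\<bar> \<le> K0"
    using continuous_bounded_on_ball[OF has_gradient_continuous[OF g]] by metis
  have "\<exists>K. \<forall>x\<in>Rn d. vnorm d x \<le> R \<longrightarrow> \<bar>D x i\<bar> \<le> K" if "i < d" for i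
    using continuous_bounded_on_ball[OF c[OF that], of R] by metis
  then obtain K1 where K1: "\<And>x i. i < d \<Longrightarrow> x \<in> Rn d \<Longrightarrow> vnorm d x \<le> R \<Longrightarrow> \<bar>D x i\<bar> \<le> K1 i"
    by metis
  define K where "K = \<bar>K0\<bar> + (\<Sum>i<d. \<bar>K1 i\<bar>)"
  have K: "0 \<le> K" "K0 \<le> K" unfolding K_def
    by (simp_all add: sum_nonneg add_nonneg_nonneg add_increasing2)
  have K1': "K1 i \<le> K" if "i < d" for i
  proof -
    have "\<bar>K1 i\<bar> \<le> (\<Sum>i<d. \<bar>K1 i\<bar>)" using that by (intro member_le_sum) auto
    then show ?thesis by (simp add: K_def)
  qed
  show ?thesis
  proof (rule that[of R K])
    fix x i assume x: "x \<in> Rn d"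
    show "\<bar>\<phi> x\<bar> \<le> K"
      using K0[OF x] R[OF x] K by (cases "vnorm d x \<le> R") auto
    assume "i < d"
    then show "\<bar>D x i\<bar> \<le> K"
      using K1[OF _ x] D0[OF x] K1' K by (cases "vnorm d x \<le> R") force+
  qed (use R D0 in auto)
qed

lemma sigma_finite_leb: "sigma_finite_measure (leb d)"
proof -
  interpret product_sigma_finite "\<lambda>_::nat. lborel::real measure" by standard
  interpret finite_product_sigma_finite "\<lambda>_::nat. lborel::real measure" "{..<d}" by standard auto
  show ?thesis unfolding leb_def by (rule sigma_finite_measure_axioms)
qed

text \<open>
  Testing commutes with mixing by Fubini's theorem, so each component can be integrated by parts on its own.
  The price is joint local integrability of the components and of their gradients, which is weaker than
  what differentiation under the integral would ask for.
\<close>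

lemma weak_gradient_mixture:
  assumes Q: "sigma_finite_measure Q"
    and F[measurable]: "(\<lambda>(z, y). F z y) \<in> borel_measurable (leb d \<Otimes>\<^sub>M Q)"
    and S[measurable]: "\<And>i. i < d \<Longrightarrow> (\<lambda>(z, y). S z y i) \<in> borel_measurable (leb d \<Otimes>\<^sub>M Q)"
    and hp: "\<And>y. y \<in> space Q \<Longrightarrow> has_partials d (\<lambda>z. F z y) (\<lambda>z. S z y)"
    and iF: "\<And>R. integrable (leb d \<Otimes>\<^sub>M Q) (\<lambda>(z, y). indicator {z\<in>Rn d. vnorm d z \<le> R} z * F z y)"
    and iS: "\<And>R i. i < d \<Longrightarrow>
      integrable (leb d \<Otimes>\<^sub>M Q) (\<lambda>(z, y). indicator {z\<in>Rn d. vnorm d z \<le> R} z * S z y i)"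
  shows "weak_gradient d (\<lambda>z. \<integral>y. F z y \<partial>Q) (\<lambda>z i. \<integral>y. S z y i \<partial>Q)"
proof -
  interpret L: sigma_finite_measure "leb d" by (rule sigma_finite_leb)
  interpret Q: sigma_finite_measure Q by (rule Q)
  interpret P: pair_sigma_finite "leb d" Q ..
  have li: "locally_integrable d (\<lambda>z. \<integral>y. H z y \<partial>Q)"
    if "\<And>R. integrable (leb d \<Otimes>\<^sub>M Q) (\<lambda>(z, y). indicator {z\<in>Rn d. vnorm d z \<le> R} z * H z y)"
    for H :: "_ \<Rightarrow> _ \<Rightarrow> real"
    unfolding locally_integrable_def set_integrable_def
    using P.integrable_fst[OF that] by simp
  have dom: "integrable (leb d \<Otimes>\<^sub>M Q) (\<lambda>(z, y). H z y * \<psi> z)"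
    if H: "(\<lambda>(z, y). H z y) \<in> borel_measurable (leb d \<Otimes>\<^sub>M Q)"
      "\<And>R. integrable (leb d \<Otimes>\<^sub>M Q) (\<lambda>(z, y). indicator {z\<in>Rn d. vnorm d z \<le> R} z * H z y)"
      and \<psi>: "\<psi> \<in> borel_measurable (leb d)" "\<And>z. z \<in> Rn d \<Longrightarrow> \<bar>\<psi> z\<bar> \<le> K"
      "\<And>z. z \<in> Rn d \<Longrightarrow> vnorm d z > R \<Longrightarrow> \<psi> z = 0"
    for H :: "_ \<Rightarrow> _ \<Rightarrow> real" and \<psi> K R
  proof (rule Bochner_Integration.integrable_bound[OF integrable_mult_left[OF H(2)[of R], of K]])
    have [measurable]: "case_prod H \<in> borel_measurable (leb d \<Otimes>\<^sub>M Q)" using H(1) .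
    note \<psi>(1)[measurable]
    show "(\<lambda>(z, y). H z y * \<psi> z) \<in> borel_measurable (leb d \<Otimes>\<^sub>M Q)" by measurable
    show "AE x in leb d \<Otimes>\<^sub>M Q. norm (case x of (z, y) \<Rightarrow> H z y * \<psi> z)
      \<le> norm ((case x of (z, y) \<Rightarrow> indicator {z\<in>Rn d. vnorm d z \<le> R} z * H z y) * K)"
    proof (rule AE_I2)
      fix x assume "x \<in> space (leb d \<Otimes>\<^sub>M Q)"
      then obtain z y where x: "x = (z, y)" "z \<in> Rn d"
        by (auto simp: space_pair_measure space_leb)
      show "norm (case x of (z, y) \<Rightarrow> H z y * \<psi> z)
        \<le> norm ((case x of (z, y) \<Rightarrow> indicator {z\<in>Rn d. vnorm d z \<le> R} z * H z y) * K)"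
      proof (cases "vnorm d z \<le> R")
        case True
        have "\<bar>H z y\<bar> * \<bar>\<psi> z\<bar> \<le> \<bar>H z y\<bar> * \<bar>K\<bar>"
          using \<psi>(2)[OF x(2)] by (intro mult_left_mono) linarith+
        then show ?thesis using True x(2) unfolding x(1) by (simp add: abs_mult)
      next
        case False
        then show ?thesis using \<psi>(3)[OF x(2)] unfolding x(1) by simp
      qed
    qed
  qed
  show ?thesis
    unfolding weak_gradient_def
  proof (intro conjI allI impI li iF iS)
    fix i assume i: "i < d"
    show "(\<lambda>z. \<integral>y. S z y i \<partial>Q) \<in> borel_measurable (leb d)"
      using S[OF i] by (intro Q.borel_measurable_lebesgue_integral) simp
  next
    fix \<phi> D i assume t: "test_fun d \<phi> D" and i: "i < d"
    then have g: "\<And>x. x \<in> Rn d \<Longrightarrow> has_gradient d \<phi> (D x) x"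
      and c: "continuous_on (Rn d) (\<lambda>x. D x i)" unfolding test_fun_def by auto
    have [measurable]: "\<phi> \<in> borel_measurable (leb d)" "(\<lambda>x. D x i) \<in> borel_measurable (leb d)"
      using measurable_continuous_leb[OF has_gradient_continuous[OF g]]
        measurable_continuous_leb[OF c] by auto
    obtain R K where b: "\<And>x. x \<in> Rn d \<Longrightarrow> vnorm d x > R \<Longrightarrow> \<phi> x = 0"
      "\<And>x i. x \<in> Rn d \<Longrightarrow> i < d \<Longrightarrow> vnorm d x > R \<Longrightarrow> D x i = 0"
      "\<And>x. x \<in> Rn d \<Longrightarrow> \<bar>\<phi> x\<bar> \<le> K" "\<And>x i. x \<in> Rn d \<Longrightarrow> i < d \<Longrightarrow> \<bar>D x i\<bar> \<le> K"
      using t by (elim test_fun_bounds) blast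
    have 1: "integrable (leb d \<Otimes>\<^sub>M Q) (\<lambda>(z, y). F z y * D z i)"
      by (rule dom[OF F iF _ b(4)[OF _ i] b(2)[OF _ i]]) auto
    have 2: "integrable (leb d \<Otimes>\<^sub>M Q) (\<lambda>(z, y). S z y i * \<phi> z)"
      by (rule dom[OF S[OF i] iS[OF i] _ b(3) b(1)]) auto
    have "(\<integral>z. (\<integral>y. F z y \<partial>Q) * D z i \<partial>leb d) = (\<integral>z. \<integral>y. F z y * D z i \<partial>Q \<partial>leb d)" by simp
    also have "\<dots> = (\<integral>y. \<integral>z. F z y * D z i \<partial>leb d \<partial>Q)"
      by (rule P.Fubini_integral[OF 1, symmetric])
    also have "\<dots> = (\<integral>y. - (\<integral>z. S z y i * \<phi> z \<partial>leb d) \<partial>Q)"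
    proof (rule integral_cong_AE)
      show "AE y in Q. (\<integral>z. F z y * D z i \<partial>leb d) = - (\<integral>z. S z y i * \<phi> z \<partial>leb d)"
        using P.AE_integrable_snd[OF 1] P.AE_integrable_snd[OF 2] AE_space
      proof eventually_elim
        case (elim y)
        then show ?case
          by (intro integral_partials_by_parts[OF hp has_gradient_has_partials[OF g] b(1) i]) auto
      qed
      show "(\<lambda>y. \<integral>z. F z y * D z i \<partial>leb d) \<in> borel_measurable Q"
        using P.integrable_snd[OF 1] by auto
      show "(\<lambda>y. - (\<integral>z. S z y i * \<phi> z \<partial>leb d)) \<in> borel_measurable Q"
        using P.integrable_snd[OF 2] by auto
    qed
    also have "\<dots> = - (\<integral>y. \<integral>z. S z y i * \<phi> z \<partial>leb d \<partial>Q)" by simp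
    also have "\<dots> = - (\<integral>z. \<integral>y. S z y i * \<phi> z \<partial>Q \<partial>leb d)"
      by (simp add: P.Fubini_integral[OF 2])
    also have "\<dots> = - (\<integral>z. (\<integral>y. S z y i \<partial>Q) * \<phi> z \<partial>leb d)" by simp
    finally show "(\<integral>z. (\<integral>y. F z y \<partial>Q) * D z i \<partial>leb d) = - (\<integral>z. (\<integral>y. S z y i \<partial>Q) * \<phi> z \<partial>leb d)" .
  qed
qed


section \<open>Relative entropy and the log-Sobolev inequality for mixtures\<close>

text \<open>
  The integrand of the relative entropy of \<open>a\<close> with respect to \<open>b\<close>, in the form that is nonnegative
  pointwise; the two linear terms cancel when \<open>a\<close> and \<open>b\<close> have the same integral.
\<close>

definition ent :: "real \<Rightarrow> real \<Rightarrow> real" where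
  "ent a b = a * ln (a / b) - a + b"

text \<open>
  Young's inequality for the convex conjugate pair of \<open>ent\<close> and the exponential. Integrated, it is the
  Donsker-Varadhan bound.
\<close>

lemma ent_young:
  assumes "0 \<le> a" "0 < b"
  shows "a * f \<le> ent a b + b * (exp f - 1)"
proof (cases "a = 0")
  case False
  then have a: "a > 0" using assms by simp
  have "ln (b * exp f / a) \<le> b * exp f / a - 1"
    using a assms by (intro ln_le_minus_one) simp
  moreover have "ln (b * exp f / a) = - ln (a / b) + f"
    using a assms by (simp add: ln_div ln_mult)
  ultimately have "a * (- ln (a / b) + f) \<le> a * (b * exp f / a - 1)"
    using a by (intro mult_left_mono) auto
  then show ?thesis using a by (simp add: ent_def algebra_simps)
qed (use assms in \<open>simp add: ent_def algebra_simps\<close>)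

lemma ent_nonneg: "0 \<le> a \<Longrightarrow> 0 < b \<Longrightarrow> 0 \<le> ent a b"
  using ent_young[of a b 0] by simp

lemma measurable_ent [measurable]:
  assumes [measurable]: "f \<in> borel_measurable M" "g \<in> borel_measurable M"
  shows "(\<lambda>x. ent (f x) (g x)) \<in> borel_measurable M"
  unfolding ent_def by measurable

lemma KL_density_eq:
  fixes h :: "'a \<Rightarrow> real"
  assumes M: "sigma_finite_measure M" and h[measurable]: "h \<in> borel_measurable M"
    and nn: "\<And>x. x \<in> space M \<Longrightarrow> 0 \<le> h x"
  shows "KL (density M (\<lambda>x. ennreal (h x))) M =
    (if integrable M (\<lambda>x. h x * ln (h x)) then ereal (\<integral>x. h x * ln (h x) \<partial>M) else \<infinity>)"
proof -
  interpret sigma_finite_measure M by (rule M)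
  let ?N = "density M (\<lambda>x. ennreal (h x))"
  let ?e = "entropy_density (exp 1) M ?N"
  have nn': "AE x in M. 0 \<le> h x" using nn by (rule AE_I2)
  have l: "log (exp 1) y = ln y" for y :: real by (simp add: log_def)
  have ac: "absolutely_continuous M ?N"
    by (intro absolutely_continuousI_density) measurable
  have "density M (RN_deriv M ?N) = ?N"
    by (intro density_RN_deriv_density) auto
  then have eq: "AE x in M. RN_deriv M ?N x = h x"
    by (intro density_unique) auto
  have e: "AE x in M. h x * ?e x = h x * ln (h x)"
    using eq nn' by eventually_elim (auto simp: entropy_density_def l)
  have [measurable]: "?e \<in> borel_measurable M"
    by (simp add: measurable_entropy_density)
  have "integrable ?N ?e \<longleftrightarrow> integrable M (\<lambda>x. h x * ?e x)"
    by (subst integrable_density) (use nn' in auto)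
  also have "\<dots> \<longleftrightarrow> integrable M (\<lambda>x. h x * ln (h x))"
    using e by (intro integrable_cong_AE) auto
  finally have "integrable ?N ?e \<longleftrightarrow> integrable M (\<lambda>x. h x * ln (h x))" .
  moreover have "KL_divergence (exp 1) M ?N = (\<integral>x. h x * ln (h x) \<partial>M)"
    using KL_density[OF _ h nn', of "exp 1"] by (simp add: l)
  ultimately show ?thesis using ac by (simp add: KL_def)
qed

locale lsi_density =
  fixes d :: nat and p :: "(nat \<Rightarrow> real) \<Rightarrow> real" and C :: real and \<pi> :: "(nat \<Rightarrow> real) measure"
  assumes p_meas [measurable]: "p \<in> borel_measurable (leb d)"
    and \<pi>_def: "\<pi> = density (leb d) (\<lambda>x. ennreal (p x))"
    and prob: "prob_space \<pi>"
    and p_lower: "\<And>R. \<exists>c>0. \<forall>x\<in>Rn d. vnorm d x \<le> R \<longrightarrow> c \<le> p x"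
    and lsi: "LSI d \<pi> C"
    and moment: "(\<integral>\<^sup>+x. ennreal ((vnorm d x)\<^sup>2) \<partial>\<pi>) < \<infinity>"
begin

lemma C_pos: "C > 0"
  using lsi by (simp add: LSI_def)

lemma sets_\<pi> [measurable_cong, simp]: "sets \<pi> = sets (leb d)"
  by (simp add: \<pi>_def)

lemma space_\<pi> [simp]: "space \<pi> = Rn d"
  using sets_eq_imp_space_eq[OF sets_\<pi>] by (simp add: space_leb)

lemma p_pos: "x \<in> Rn d \<Longrightarrow> 0 < p x"
  using p_lower[of "vnorm d x"] by force

text \<open>Since the density is bounded below on balls, integrability survives the passage to Lebesgue measure.\<close>

lemma integrable_leb_ball:
  assumes Q: "sigma_finite_measure Q" and H: "integrable (\<pi> \<Otimes>\<^sub>M Q) (\<lambda>(z, y). H z y)"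
  shows "integrable (leb d \<Otimes>\<^sub>M Q) (\<lambda>(z, y). indicator {z\<in>Rn d. vnorm d z \<le> R} z * (H z y :: real))"
proof -
  interpret Q: sigma_finite_measure Q by (rule Q)
  have "sets (\<pi> \<Otimes>\<^sub>M Q) = sets (leb d \<Otimes>\<^sub>M Q)" by (intro sets_pair_measure_cong) auto
  then have Hm[measurable]: "case_prod H \<in> borel_measurable (leb d \<Otimes>\<^sub>M Q)"
    using borel_measurable_integrable[OF H] by (simp cong: measurable_cong_sets)
  have [measurable]: "{z\<in>Rn d. vnorm d z \<le> R} \<in> sets (leb d)"
    using measurable_vnorm[of d] unfolding space_leb[symmetric] by measurable
  obtain c where c: "c > 0" "\<And>x. x \<in> Rn d \<Longrightarrow> vnorm d x \<le> R \<Longrightarrow> c \<le> p x"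
    using p_lower[of R] by blast
  let ?B = "{z\<in>Rn d. vnorm d z \<le> R}"
  show ?thesis
    unfolding integrable_iff_bounded
  proof
    show "(\<lambda>(z, y). indicator ?B z * H z y) \<in> borel_measurable (leb d \<Otimes>\<^sub>M Q)" by measurable
    have "(\<integral>\<^sup>+x. ennreal (norm (case x of (z, y) \<Rightarrow> indicator ?B z * H z y)) \<partial>(leb d \<Otimes>\<^sub>M Q))
      = (\<integral>\<^sup>+z. \<integral>\<^sup>+y. ennreal (indicator ?B z * \<bar>H z y\<bar>) \<partial>Q \<partial>leb d)"
      by (subst Q.nn_integral_fst[symmetric]) (auto simp: abs_mult)
    also have "\<dots> \<le> (\<integral>\<^sup>+z. ennreal (1 / c) * (ennreal (p z) * (\<integral>\<^sup>+y. ennreal \<bar>H z y\<bar> \<partial>Q)) \<partial>leb d)"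
    proof (rule nn_integral_mono)
      fix z assume "z \<in> space (leb d)"
      then have z: "z \<in> Rn d" by (simp add: space_leb)
      have [measurable]: "(\<lambda>y. H z y) \<in> borel_measurable Q"
        using measurable_Pair2[OF Hm, of z] z by (simp add: space_leb)
      have le: "indicator ?B z * \<bar>H z y\<bar> \<le> 1 / c * p z * \<bar>H z y\<bar>" for y
      proof (rule mult_right_mono)
        show "indicator ?B z \<le> 1 / c * p z"
        proof (cases "vnorm d z \<le> R")
          case True
          then show ?thesis using c(1) c(2)[OF z True] by (simp add: field_simps z)
        next
          case False
          then show ?thesis using c(1) p_pos[OF z] by simp
        qed
      qed simp
      have "(\<integral>\<^sup>+y. ennreal (indicator ?B z * \<bar>H z y\<bar>) \<partial>Q) \<le> (\<integral>\<^sup>+y. ennreal (1 / c * p z) * ennreal \<bar>H z y\<bar> \<partial>Q)"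
      proof (rule nn_integral_mono)
        fix y
        have "ennreal (1 / c * p z) * ennreal \<bar>H z y\<bar> = ennreal (1 / c * p z * \<bar>H z y\<bar>)"
          using c(1) p_pos[OF z] by (intro ennreal_mult[symmetric]) auto
        then show "ennreal (indicator ?B z * \<bar>H z y\<bar>) \<le> ennreal (1 / c * p z) * ennreal \<bar>H z y\<bar>"
          using ennreal_leI[OF le[of y]] by (simp only:)
      qed
      also have "\<dots> = ennreal (1 / c * p z) * (\<integral>\<^sup>+y. ennreal \<bar>H z y\<bar> \<partial>Q)"
        by (rule nn_integral_cmult) measurable
      also have "\<dots> = ennreal (1 / c) * (ennreal (p z) * (\<integral>\<^sup>+y. ennreal \<bar>H z y\<bar> \<partial>Q))"
        using c(1) p_pos[OF z] by (subst ennreal_mult) (auto simp: mult.assoc)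
      finally show "(\<integral>\<^sup>+y. ennreal (indicator ?B z * \<bar>H z y\<bar>) \<partial>Q) \<le> \<dots>" .
    qed
    also have "\<dots> = ennreal (1 / c) * (\<integral>\<^sup>+z. ennreal (p z) * (\<integral>\<^sup>+y. ennreal \<bar>H z y\<bar> \<partial>Q) \<partial>leb d)"
      by (rule nn_integral_cmult) measurable
    also have "(\<integral>\<^sup>+z. ennreal (p z) * (\<integral>\<^sup>+y. ennreal \<bar>H z y\<bar> \<partial>Q) \<partial>leb d) = (\<integral>\<^sup>+z. (\<integral>\<^sup>+y. ennreal \<bar>H z y\<bar> \<partial>Q) \<partial>\<pi>)"
      unfolding \<pi>_def by (rule nn_integral_density[symmetric]) measurable
    also have "\<dots> = (\<integral>\<^sup>+x. ennreal (norm (case x of (z, y) \<Rightarrow> H z y)) \<partial>(\<pi> \<Otimes>\<^sub>M Q))"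
      by (subst Q.nn_integral_fst[symmetric]) (auto simp: abs_mult)
    also have "ennreal (1 / c) * \<dots> < \<infinity>"
      using H unfolding integrable_iff_bounded by (simp add: ennreal_mult_less_top)
    finally show "(\<integral>\<^sup>+x. ennreal (norm (case x of (z, y) \<Rightarrow> indicator ?B z * H z y)) \<partial>(leb d \<Otimes>\<^sub>M Q)) < \<infinity>" .
  qed
qed

text \<open>
  The form in which the log-Sobolev inequality is applied below: to \<open>f \<cdot> \<pi>\<close>, where \<open>f\<close> is a mixture, so that its
  weak gradient is known. Both sides are homogeneous in \<open>f\<close>, which allows any mass \<open>m\<close>.
\<close>

lemma lsi_mixture:
  fixes F :: "(nat \<Rightarrow> real) \<Rightarrow> 'b \<Rightarrow> real" and S :: "(nat \<Rightarrow> real) \<Rightarrow> 'b \<Rightarrow> nat \<Rightarrow> real"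
  assumes Q: "sigma_finite_measure Q"
    and F0: "\<And>z y. z \<in> Rn d \<Longrightarrow> y \<in> space Q \<Longrightarrow> 0 \<le> F z y"
    and hp: "\<And>y. y \<in> space Q \<Longrightarrow> has_partials d (\<lambda>z. F z y) (\<lambda>z. S z y)"
    and iF: "integrable (\<pi> \<Otimes>\<^sub>M Q) (\<lambda>(z, y). F z y)"
    and iS: "\<And>i. i < d \<Longrightarrow> integrable (\<pi> \<Otimes>\<^sub>M Q) (\<lambda>(z, y). S z y i)"
    and i2: "integrable (\<pi> \<Otimes>\<^sub>M Q) (\<lambda>(z, y). (vnorm d z)\<^sup>2 * F z y)"
    and f: "\<And>z. f z = (\<integral>y. F z y \<partial>Q)" and g: "\<And>z i. g z i = (\<integral>y. S z y i \<partial>Q)"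
    and m: "m = (\<integral>z. f z \<partial>\<pi>)" and m0: "m > 0"
  shows "(\<integral>\<^sup>+z. ennreal (ent (f z) m) \<partial>\<pi>)
    \<le> ennreal (C / 2) * (\<integral>\<^sup>+z. ennreal (f z * (vnorm d (\<lambda>i. g z i / f z))\<^sup>2) \<partial>\<pi>)"
proof -
  interpret pi: prob_space \<pi> by (rule prob)
  interpret Q: sigma_finite_measure Q by (rule Q)
  interpret P: pair_sigma_finite \<pi> Q ..
  have f0: "0 \<le> f z" if "z \<in> Rn d" for z
    unfolding f using F0[OF that] by (intro Bochner_Integration.integral_nonneg) auto
  have intf: "integrable \<pi> f"
    using P.integrable_fst[OF iF] by (simp add: f[abs_def])
  have intf2: "integrable \<pi> (\<lambda>z. (vnorm d z)\<^sup>2 * f z)"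
    using P.integrable_fst[OF i2] by (simp add: f)
  have fm[measurable]: "f \<in> borel_measurable \<pi>" using intf by auto
  have gm[measurable]: "(\<lambda>z. g z i) \<in> borel_measurable \<pi>" if "i < d" for i
    using P.integrable_fst[OF iS[OF that]] by (auto simp: g)
  have setsP: "sets (\<pi> \<Otimes>\<^sub>M Q) = sets (leb d \<Otimes>\<^sub>M Q)" by (intro sets_pair_measure_cong) auto
  define h where "h z = f z / m" for z
  define \<mu> where "\<mu> = density \<pi> (\<lambda>z. ennreal (h z))"
  define X where "X = (\<integral>\<^sup>+z. ennreal ((vnorm d (\<lambda>i. (g z i / m) / h z))\<^sup>2) \<partial>\<mu>)"
  have h0: "0 \<le> h z" if "z \<in> Rn d" for z using f0[OF that] m0 by (simp add: h_def)
  have hm[measurable]: "h \<in> borel_measurable \<pi>" unfolding h_def by measurable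
  have hml[measurable]: "h \<in> borel_measurable (leb d)" using hm by (simp cong: measurable_cong_sets)
  have inth: "integrable \<pi> h" unfolding h_def using intf by simp
  have h1: "(\<integral>z. h z \<partial>\<pi>) = 1" using m m0 by (simp add: h_def)
  have "weak_gradient d h (\<lambda>z i. g z i / m)"
  proof -
    have "weak_gradient d (\<lambda>z. \<integral>y. F z y / m \<partial>Q) (\<lambda>z i. \<integral>y. S z y i / m \<partial>Q)"
    proof (rule weak_gradient_mixture[OF Q])
      show "(\<lambda>(z, y). F z y / m) \<in> borel_measurable (leb d \<Otimes>\<^sub>M Q)"
        using borel_measurable_integrable[OF iF] setsP by (simp add: split_beta' cong: measurable_cong_sets)
      show "(\<lambda>(z, y). S z y i / m) \<in> borel_measurable (leb d \<Otimes>\<^sub>M Q)" if "i < d" for i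
        using borel_measurable_integrable[OF iS[OF that]] setsP
        by (simp add: split_beta' cong: measurable_cong_sets)
      show "has_partials d (\<lambda>z. F z y / m) (\<lambda>z i. S z y i / m)" if "y \<in> space Q" for y
        using hp[OF that] by (rule has_partials_divide)
      show "integrable (leb d \<Otimes>\<^sub>M Q) (\<lambda>(z, y). indicator {z\<in>Rn d. vnorm d z \<le> R} z * (F z y / m))" for R
        using integrable_divide[OF integrable_leb_ball[OF Q iF, of R], of m] by (simp add: split_beta')
      show "integrable (leb d \<Otimes>\<^sub>M Q) (\<lambda>(z, y). indicator {z\<in>Rn d. vnorm d z \<le> R} z * (S z y i / m))"
        if "i < d" for R i
        using integrable_divide[OF integrable_leb_ball[OF Q iS[OF that], of R], of m] by (simp add: split_beta')
    qed
    then show ?thesis by (simp add: h_def[abs_def] f g)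
  qed
  then have "FI d \<mu> \<pi> \<le> X"
    unfolding FI_def
  proof (intro Inf_lower CollectI)
    assume wg: "weak_gradient d h (\<lambda>z i. g z i / m)"
    show "\<exists>f' g'. X = (\<integral>\<^sup>+x. ennreal ((vnorm d (\<lambda>i. g' x i / f' x))\<^sup>2) \<partial>\<mu>) \<and>
        f' \<in> borel_measurable (leb d) \<and> (\<forall>x\<in>Rn d. 0 \<le> f' x) \<and>
        \<mu> = density \<pi> (\<lambda>x. ennreal (f' x)) \<and> weak_gradient d f' g'"
      by (rule exI[of _ h], rule exI[of _ "\<lambda>z i. g z i / m"])
        (intro conjI hml wg ballI h0, simp_all only: X_def \<mu>_def)
  qed
  moreover have "\<mu> \<in> P2ac d"
    unfolding P2ac_def
  proof (intro CollectI conjI)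
    show "prob_space \<mu>"
    proof (rule prob_spaceI)
      have "emeasure \<mu> (space \<mu>) = (\<integral>\<^sup>+z. ennreal (h z) \<partial>\<pi>)"
        unfolding \<mu>_def space_density
        by (subst emeasure_density) (auto intro!: nn_integral_cong simp del: space_\<pi> sets_\<pi>)
      also have "\<dots> = ennreal (\<integral>z. h z \<partial>\<pi>)"
        using h0 by (intro nn_integral_eq_integral inth AE_I2) auto
      finally show "emeasure \<mu> (space \<mu>) = 1" by (simp add: h1)
    qed
    show "\<exists>f\<in>borel_measurable (leb d). \<mu> = density (leb d) f"
      by (rule bexI[of _ "\<lambda>z. ennreal (p z) * ennreal (h z)"])
        (simp_all add: \<mu>_def \<pi>_def density_density_eq)
    have "(\<integral>\<^sup>+x. ennreal ((vnorm d x)\<^sup>2) \<partial>\<mu>) = (\<integral>\<^sup>+x. ennreal (h x) * ennreal ((vnorm d x)\<^sup>2) \<partial>\<pi>)"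
      unfolding \<mu>_def by (rule nn_integral_density) measurable
    also have "\<dots> = (\<integral>\<^sup>+x. ennreal ((vnorm d x)\<^sup>2 * f x / m) \<partial>\<pi>)"
      by (intro nn_integral_cong) (use h0 in \<open>simp add: ennreal_mult[symmetric] h_def mult.commute\<close>)
    also have "\<dots> = ennreal (\<integral>x. (vnorm d x)\<^sup>2 * f x / m \<partial>\<pi>)"
      using f0 m0 by (intro nn_integral_eq_integral integrable_divide intf2 AE_I2) auto
    finally show "(\<integral>\<^sup>+x. ennreal ((vnorm d x)\<^sup>2) \<partial>\<mu>) < \<infinity>" by simp
  qed
  ultimately have FI: "FI d \<mu> \<pi> \<le> X" and "\<mu> \<in> P2ac d" by auto
  then have "KL \<mu> \<pi> \<le> ereal (C / 2) * enn2ereal (FI d \<mu> \<pi>)"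
    using lsi unfolding LSI_def by blast
  also have "\<dots> \<le> ereal (C / 2) * enn2ereal X"
    using FI C_pos by (intro ereal_mult_left_mono) (auto simp: less_eq_ennreal.rep_eq)
  finally have KL: "KL \<mu> \<pi> \<le> ereal (C / 2) * enn2ereal X" .
  have mX: "(\<integral>\<^sup>+z. ennreal (f z * (vnorm d (\<lambda>i. g z i / f z))\<^sup>2) \<partial>\<pi>) = ennreal m * X"
  proof -
    have [measurable]: "(\<lambda>z. vnorm d (\<lambda>i. (g z i / m) / h z)) \<in> borel_measurable \<pi>"
      by (rule measurable_vnorm_fun) measurable
    have "X = (\<integral>\<^sup>+z. ennreal (h z) * ennreal ((vnorm d (\<lambda>i. (g z i / m) / h z))\<^sup>2) \<partial>\<pi>)"
      unfolding X_def \<mu>_def by (rule nn_integral_density) measurable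
    then have "ennreal m * X
      = (\<integral>\<^sup>+z. ennreal m * (ennreal (h z) * ennreal ((vnorm d (\<lambda>i. (g z i / m) / h z))\<^sup>2)) \<partial>\<pi>)"
      by (simp only:) (rule nn_integral_cmult[symmetric], measurable)
    also have "\<dots> = (\<integral>\<^sup>+z. ennreal (f z * (vnorm d (\<lambda>i. g z i / f z))\<^sup>2) \<partial>\<pi>)"
    proof (intro nn_integral_cong)
      fix z assume "z \<in> space \<pi>"
      then have z: "z \<in> Rn d" by simp
      have "(\<lambda>i. (g z i / m) / h z) = (\<lambda>i. g z i / f z)" using m0 by (simp add: h_def)
      moreover have "m * h z = f z"
        using m0 by (simp add: h_def)
      ultimately show "ennreal m * (ennreal (h z) * ennreal ((vnorm d (\<lambda>i. (g z i / m) / h z))\<^sup>2))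
         = ennreal (f z * (vnorm d (\<lambda>i. g z i / f z))\<^sup>2)"
        using h0[OF z] m0 by (simp add: ennreal_mult[symmetric] mult.assoc[symmetric])
    qed
    finally show ?thesis by simp
  qed
  show ?thesis
  proof (cases "X = \<infinity>")
    case True
    then show ?thesis using mX m0 C_pos by (simp add: ennreal_mult_top)
  next
    case False
    then obtain x where x: "X = ennreal x" "0 \<le> x" by (cases X) auto
    then have "KL \<mu> \<pi> \<le> ereal (C / 2 * x)" using KL by simp
    moreover have "KL \<mu> \<pi> = (if integrable \<pi> (\<lambda>z. h z * ln (h z)) then ereal (\<integral>z. h z * ln (h z) \<partial>\<pi>) else \<infinity>)"
      unfolding \<mu>_def using h0 by (intro KL_density_eq[OF pi.sigma_finite_measure_axioms hm]) simp
    ultimately have ih: "integrable \<pi> (\<lambda>z. h z * ln (h z))"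
      and le: "(\<integral>z. h z * ln (h z) \<partial>\<pi>) \<le> C / 2 * x"
      by (simp_all split: if_splits)
    have eq: "ent (f z) m = m * (h z * ln (h z)) - f z + m" for z
      using m0 by (simp add: ent_def h_def)
    have ie: "integrable \<pi> (\<lambda>z. ent (f z) m)"
      unfolding eq using ih intf by simp
    have "(\<integral>\<^sup>+z. ennreal (ent (f z) m) \<partial>\<pi>) = ennreal (\<integral>z. ent (f z) m \<partial>\<pi>)"
      using f0 m0 by (intro nn_integral_eq_integral ie AE_I2 ent_nonneg) auto
    also have "(\<integral>z. ent (f z) m \<partial>\<pi>) = m * (\<integral>z. h z * ln (h z) \<partial>\<pi>)"
      unfolding eq using ih intf m by (simp add: pi.prob_space[simplified])
    also have "ennreal \<dots> \<le> ennreal (m * (C / 2 * x))"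
      using le m0 by (intro ennreal_leI mult_left_mono) auto
    also have "\<dots> = ennreal (C / 2) * (ennreal m * X)"
      using x m0 C_pos by (simp add: ennreal_mult[symmetric] mult_ac)
    finally show ?thesis using mX by simp
  qed
qed

end


section \<open>Concentration of Lipschitz functions\<close>

lemma integrable_pair_fst:
  fixes f :: "'a \<Rightarrow> real"
  assumes Q: "prob_space Q" and f: "integrable M f"
  shows "integrable (M \<Otimes>\<^sub>M Q) (\<lambda>(x, y). f x)"
proof -
  interpret Q: prob_space Q by (rule Q)
  have [measurable]: "f \<in> borel_measurable M" using f by auto
  have "(\<integral>\<^sup>+x. ennreal (norm (case x of (x, y) \<Rightarrow> f x)) \<partial>(M \<Otimes>\<^sub>M Q)) = (\<integral>\<^sup>+x. \<integral>\<^sup>+y. ennreal (norm (f x)) \<partial>Q \<partial>M)"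
    by (subst Q.nn_integral_fst[symmetric]) auto
  also have "\<dots> < \<infinity>"
    using f by (simp add: integrable_iff_bounded Q.emeasure_space_1)
  finally show ?thesis unfolding integrable_iff_bounded by simp
qed

lemma has_partials_exp:
  assumes "has_partials d f Df"
  shows "has_partials d (\<lambda>z. exp (c * f z)) (\<lambda>z i. exp (c * f z) * (c * Df z i))"
  using assms unfolding has_partials_def by (auto intro!: derivative_eq_intros)

context lsi_density
begin

lemma integrable_bounded:
  fixes f :: "(nat \<Rightarrow> real) \<Rightarrow> real"
  assumes "f \<in> borel_measurable (leb d)" "\<And>z. z \<in> Rn d \<Longrightarrow> \<bar>f z\<bar> \<le> B"
  shows "integrable \<pi> f"
proof -
  interpret pi: prob_space \<pi> by (rule prob)
  have "f \<in> borel_measurable \<pi>" using assms(1) by (simp cong: measurable_cong_sets)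
  then show ?thesis using assms(2) by (intro pi.integrable_const_bound[of _ B] AE_I2) auto
qed

lemma integrable_moment: "integrable \<pi> (\<lambda>z. (vnorm d z)\<^sup>2)"
  using moment by (intro integrableI_bounded) (auto simp: cong: measurable_cong_sets)

text \<open>
  The logarithmic gradient of the tilt \<open>exp (t f)\<close> is \<open>t\<close> times that of \<open>f\<close>, hence bounded, and the log-Sobolev inequality
  bounds the entropy of the tilt.
\<close>

lemma entropy_of_tilt:
  assumes f[measurable]: "f \<in> borel_measurable (leb d)" and B: "\<And>z. z \<in> Rn d \<Longrightarrow> \<bar>f z\<bar> \<le> B"
    and Df: "\<And>i. i < d \<Longrightarrow> (\<lambda>z. Df z i) \<in> borel_measurable (leb d)" and hp: "has_partials d f Df"
    and l: "\<And>z. z \<in> Rn d \<Longrightarrow> vnorm d (Df z) \<le> l" and t: "0 < t"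
    and Z: "Z = (\<integral>z. exp (t * f z) \<partial>\<pi>)"
  shows "Z > 0" and "t * (\<integral>z. f z * exp (t * f z) \<partial>\<pi>) - Z * ln Z \<le> C / 2 * (t * l)\<^sup>2 * Z"
proof -
  interpret pi: prob_space \<pi> by (rule prob)
  have l0: "0 \<le> l"
  proof -
    have "vnorm d (Df (\<lambda>i\<in>{..<d}. 0)) \<le> l" by (rule l) simp
    then show ?thesis using vnorm_nonneg order_trans by blast
  qed
  have eB: "exp (t * f z) \<le> exp (t * B)" if "z \<in> Rn d" for z
    using B[OF that] t by (simp add: abs_le_iff)
  have intE: "integrable \<pi> (\<lambda>z. exp (t * f z))"
    using eB by (intro integrable_bounded[of _ "exp (t * B)"]) auto
  have intfE: "integrable \<pi> (\<lambda>z. f z * exp (t * f z))"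
  proof (rule integrable_bounded[of _ "B * exp (t * B)"])
    fix z assume z: "z \<in> Rn d"
    have "\<bar>f z\<bar> * exp (t * f z) \<le> B * exp (t * B)"
      using B[OF z] eB[OF z] by (intro mult_mono) auto
    then show "\<bar>f z * exp (t * f z)\<bar> \<le> B * exp (t * B)" by (simp add: abs_mult)
  qed measurable
  have Zl: "exp (- (t * B)) \<le> Z"
  proof -
    have "(\<integral>z. exp (- (t * B)) \<partial>\<pi>) \<le> Z"
      unfolding Z
    proof (intro integral_mono intE)
      fix z assume "z \<in> space \<pi>"
      then have "- B \<le> f z" using B[of z] by (auto simp: abs_le_iff)
      then have "t * (- B) \<le> t * f z" using t by (intro mult_left_mono) auto
      then show "exp (- (t * B)) \<le> exp (t * f z)" by simp
    qed auto
    then show ?thesis by (simp add: pi.prob_space[simplified])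
  qed
  show Z0: "Z > 0" using less_le_trans[OF exp_gt_zero Zl] .
  have main: "(\<integral>\<^sup>+z. ennreal (ent (exp (t * f z)) Z) \<partial>\<pi>) \<le> ennreal (C / 2) *
    (\<integral>\<^sup>+z. ennreal (exp (t * f z) * (vnorm d (\<lambda>i. (exp (t * f z) * (t * Df z i)) / exp (t * f z)))\<^sup>2) \<partial>\<pi>)"
  proof (rule lsi_mixture[where Q = \<pi> and F = "\<lambda>z y. exp (t * f z)" and S = "\<lambda>z y i. exp (t * f z) * (t * Df z i)"])
    show "sigma_finite_measure \<pi>" ..
    show "integrable (\<pi> \<Otimes>\<^sub>M \<pi>) (\<lambda>(z, y). exp (t * f z))"
      by (rule integrable_pair_fst[OF prob intE])
    show "integrable (\<pi> \<Otimes>\<^sub>M \<pi>) (\<lambda>(z, y). exp (t * f z) * (t * Df z i))" if i: "i < d" for i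
    proof (rule integrable_pair_fst[OF prob], rule integrable_bounded[of _ "exp (t * B) * (t * l)"])
      note Df[OF i, measurable]
      show "(\<lambda>z. exp (t * f z) * (t * Df z i)) \<in> borel_measurable (leb d)" by measurable
      fix z assume z: "z \<in> Rn d"
      have "\<bar>Df z i\<bar> \<le> l" using abs_coord_le_vnorm[OF i, of "Df z"] l[OF z] by linarith
      then have "exp (t * f z) * (t * \<bar>Df z i\<bar>) \<le> exp (t * B) * (t * l)"
        using eB[OF z] t l0 by (intro mult_mono mult_left_mono) auto
      then show "\<bar>exp (t * f z) * (t * Df z i)\<bar> \<le> exp (t * B) * (t * l)"
        using t by (simp add: abs_mult)
    qed
    show "integrable (\<pi> \<Otimes>\<^sub>M \<pi>) (\<lambda>(z, y). (vnorm d z)\<^sup>2 * exp (t * f z))"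
    proof (rule integrable_pair_fst[OF prob],
        rule Bochner_Integration.integrable_bound[OF integrable_mult_left[OF integrable_moment, of "exp (t * B)"]])
      show "AE z in \<pi>. norm ((vnorm d z)\<^sup>2 * exp (t * f z)) \<le> norm ((vnorm d z)\<^sup>2 * exp (t * B))"
      proof (rule AE_I2)
        fix z assume "z \<in> space \<pi>"
        then have "(vnorm d z)\<^sup>2 * exp (t * f z) \<le> (vnorm d z)\<^sup>2 * exp (t * B)"
          by (intro mult_left_mono eB) simp_all
        then show "norm ((vnorm d z)\<^sup>2 * exp (t * f z)) \<le> norm ((vnorm d z)\<^sup>2 * exp (t * B))"
          by (simp add: abs_mult)
      qed
    qed measurable
    show "has_partials d (\<lambda>z. exp (t * f z)) (\<lambda>z i. exp (t * f z) * (t * Df z i))"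
      by (rule has_partials_exp[OF hp])
    show "exp (t * f z) = (\<integral>y. exp (t * f z) \<partial>\<pi>)"
      "exp (t * f z) * (t * Df z i) = (\<integral>y. exp (t * f z) * (t * Df z i) \<partial>\<pi>)" for z i
      by (simp_all add: pi.prob_space[simplified])
  qed (fact Z Z0 | simp)+
  have entE: "ent (exp (t * f z)) Z = t * (f z * exp (t * f z)) - exp (t * f z) * ln Z - exp (t * f z) + Z" for z
    using Z0 by (simp add: ent_def ln_div algebra_simps)
  have int_ent: "integrable \<pi> (\<lambda>z. ent (exp (t * f z)) Z)"
    unfolding entE using intE intfE by simp
  have val: "(\<integral>z. ent (exp (t * f z)) Z \<partial>\<pi>) = t * (\<integral>z. f z * exp (t * f z) \<partial>\<pi>) - Z * ln Z"
    unfolding entE using intE intfE by (simp add: Z[symmetric] pi.prob_space[simplified])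
  have "ennreal (\<integral>z. ent (exp (t * f z)) Z \<partial>\<pi>) = (\<integral>\<^sup>+z. ennreal (ent (exp (t * f z)) Z) \<partial>\<pi>)"
    using Z0 by (intro nn_integral_eq_integral[symmetric] int_ent AE_I2 ent_nonneg) auto
  also have "\<dots> \<le> ennreal (C / 2) * (\<integral>\<^sup>+z. ennreal ((t * l)\<^sup>2 * exp (t * f z)) \<partial>\<pi>)"
  proof (rule order_trans[OF main], intro mult_left_mono nn_integral_mono)
    fix z assume "z \<in> space \<pi>"
    then have z: "z \<in> Rn d" by simp
    have "vnorm d (\<lambda>i. (exp (t * f z) * (t * Df z i)) / exp (t * f z)) = t * vnorm d (Df z)"
      using t by (simp add: vnorm_scale)
    also have "\<dots> \<le> t * l" using l[OF z] t by (intro mult_left_mono) auto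
    finally have "(vnorm d (\<lambda>i. (exp (t * f z) * (t * Df z i)) / exp (t * f z)))\<^sup>2 \<le> (t * l)\<^sup>2"
      by (intro power_mono) auto
    then have "exp (t * f z) * (vnorm d (\<lambda>i. (exp (t * f z) * (t * Df z i)) / exp (t * f z)))\<^sup>2
      \<le> exp (t * f z) * (t * l)\<^sup>2" by (intro mult_left_mono) auto
    then show "ennreal (exp (t * f z) * (vnorm d (\<lambda>i. (exp (t * f z) * (t * Df z i)) / exp (t * f z)))\<^sup>2)
      \<le> ennreal ((t * l)\<^sup>2 * exp (t * f z))" by (intro ennreal_leI) (simp add: mult.commute)
  qed simp
  also have "(\<integral>\<^sup>+z. ennreal ((t * l)\<^sup>2 * exp (t * f z)) \<partial>\<pi>) = ennreal ((t * l)\<^sup>2 * Z)"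
    using intE by (subst nn_integral_eq_integral) (auto simp: Z)
  also have "ennreal (C / 2) * \<dots> = ennreal (C / 2 * (t * l)\<^sup>2 * Z)"
    using C_pos Z0 by (subst ennreal_mult[symmetric]) (auto simp: mult.assoc)
  finally show "t * (\<integral>z. f z * exp (t * f z) \<partial>\<pi>) - Z * ln Z \<le> C / 2 * (t * l)\<^sup>2 * Z"
    using C_pos Z0 by (subst (asm) ennreal_le_iff) (auto simp: val intro!: mult_nonneg_nonneg)
qed

text \<open>
  Herbst's argument in discrete form. With \<open>Z t = \<integral> exp (t f)\<close>, the function \<open>G t = ln (Z t) / t\<close> tends
  to \<open>\<integral> f\<close> at 0, and its growth is controlled by the entropy of the tilts. Instead of its derivative, its values at
  \<open>t\<close> and \<open>\<theta> t\<close> are compared by Jensen's inequality, and the comparison is iterated along \<open>1, \<theta>, \<theta>\<^sup>2, \<dots>\<close>.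
  This loses a factor \<open>1 / \<theta>\<close> in the constant, which disappears as \<open>\<theta>\<close> tends to 1.
\<close>

lemma herbst:
  assumes f[measurable]: "f \<in> borel_measurable (leb d)" and B: "\<And>z. z \<in> Rn d \<Longrightarrow> \<bar>f z\<bar> \<le> B"
    and Df: "\<And>i. i < d \<Longrightarrow> (\<lambda>z. Df z i) \<in> borel_measurable (leb d)" and hp: "has_partials d f Df"
    and l: "\<And>z. z \<in> Rn d \<Longrightarrow> vnorm d (Df z) \<le> l"
  shows "(\<integral>z. exp (f z) \<partial>\<pi>) \<le> exp ((\<integral>z. f z \<partial>\<pi>) + C * l\<^sup>2 / 2)"
proof -
  interpret pi: prob_space \<pi> by (rule prob)
  define Z where "Z t = (\<integral>z. exp (t * f z) \<partial>\<pi>)" for t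
  define G where "G t = ln (Z t) / t" for t
  define c where "c = C * l\<^sup>2 / 2"
  define I where "I = (\<integral>z. f z \<partial>\<pi>)"
  have c0: "0 \<le> c" using C_pos by (simp add: c_def)
  have B0: "0 \<le> B" using B[of "\<lambda>i\<in>{..<d}. 0"] by force
  have Z0: "Z t > 0" and en: "t * (\<integral>z. f z * exp (t * f z) \<partial>\<pi>) - Z t * ln (Z t) \<le> c * t\<^sup>2 * Z t"
    if "t > 0" for t
    using entropy_of_tilt[OF f B Df hp l that Z_def] by (auto simp: c_def power_mult_distrib algebra_simps)
  have intf: "integrable \<pi> f" by (rule integrable_bounded[OF f B])
  have intE: "integrable \<pi> (\<lambda>z. exp (t * f z))" if "t > 0" for t
    using B that by (intro integrable_bounded[of _ "exp (t * B)"]) (auto simp: abs_le_iff)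
  have intfE: "integrable \<pi> (\<lambda>z. f z * exp (t * f z))" if "t > 0" for t
  proof (rule integrable_bounded[of _ "B * exp (t * B)"])
    fix z assume z: "z \<in> Rn d"
    have "\<bar>f z\<bar> * exp (t * f z) \<le> B * exp (t * B)"
      using B[OF z] B0 that by (intro mult_mono) (auto simp: abs_le_iff)
    then show "\<bar>f z * exp (t * f z)\<bar> \<le> B * exp (t * B)" by (simp add: abs_mult)
  qed measurable
  have step: "G t \<le> G (\<theta> * t) + (1 - \<theta>) / \<theta> * t * c" if t: "t > 0" and \<theta>: "0 < \<theta>" "\<theta> < 1" for t \<theta>
  proof -
    \<comment> \<open>\<open>M\<close> is the mean of \<open>t f\<close> under the tilt at \<open>t\<close>, and \<open>exp\<close> is replaced by its tangent at \<open>t0\<close>.\<close>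
    define M where "M = t * (\<integral>z. f z * exp (t * f z) \<partial>\<pi>) / Z t"
    define t0 where "t0 = (\<theta> - 1) * M"
    have "(\<integral>z. exp t0 * ((1 - t0) * exp (t * f z) + (\<theta> - 1) * t * (f z * exp (t * f z))) \<partial>\<pi>) \<le> Z (\<theta> * t)"
      unfolding Z_def
    proof (intro integral_mono integrable_mult_right Bochner_Integration.integrable_add intE intfE t)
      fix z
      have "1 + ((\<theta> - 1) * t * f z - t0) \<le> exp ((\<theta> - 1) * t * f z - t0)" by (rule exp_ge_add_one_self)
      then have "exp t0 * exp (t * f z) * (1 + ((\<theta> - 1) * t * f z - t0))
          \<le> exp t0 * exp (t * f z) * exp ((\<theta> - 1) * t * f z - t0)"
        by (intro mult_left_mono) auto
      also have "\<dots> = exp (\<theta> * t * f z)" by (simp add: exp_add[symmetric] algebra_simps)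
      finally show "exp t0 * ((1 - t0) * exp (t * f z) + (\<theta> - 1) * t * (f z * exp (t * f z))) \<le> exp (\<theta> * t * f z)"
        by (simp add: algebra_simps)
    qed (use t \<theta> in auto)
    also have "(\<integral>z. exp t0 * ((1 - t0) * exp (t * f z) + (\<theta> - 1) * t * (f z * exp (t * f z))) \<partial>\<pi>)
      = exp t0 * ((1 - t0) * Z t + (\<theta> - 1) * (t * (\<integral>z. f z * exp (t * f z) \<partial>\<pi>)))"
      using intE[OF t] intfE[OF t] by (simp add: Z_def mult.assoc)
    also have "t * (\<integral>z. f z * exp (t * f z) \<partial>\<pi>) = M * Z t" using Z0[OF t] by (simp add: M_def)
    also have "exp t0 * ((1 - t0) * Z t + (\<theta> - 1) * (M * Z t)) = exp t0 * Z t"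
      by (simp add: t0_def algebra_simps)
    finally have "ln (exp t0 * Z t) \<le> ln (Z (\<theta> * t))"
      using Z0[OF t] Z0[of "\<theta> * t"] t \<theta> by (subst ln_le_cancel_iff) auto
    then have 1: "t0 + ln (Z t) \<le> ln (Z (\<theta> * t))" using Z0[OF t] by (simp add: ln_mult)
    have "Z t * (M - ln (Z t)) \<le> Z t * (c * t\<^sup>2)"
      using en[OF t] Z0[OF t] by (simp add: M_def algebra_simps)
    then have "M - ln (Z t) \<le> c * t\<^sup>2" using Z0[OF t] by (simp only: mult_le_cancel_left_pos)
    then have "(1 - \<theta>) * (M - ln (Z t)) \<le> (1 - \<theta>) * (c * t\<^sup>2)" using \<theta> by (intro mult_left_mono) auto
    with 1 have "\<theta> * ln (Z t) \<le> ln (Z (\<theta> * t)) + (1 - \<theta>) * (c * t\<^sup>2)"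
      by (simp add: t0_def algebra_simps)
    then have "(\<theta> * ln (Z t)) / (\<theta> * t) \<le> (ln (Z (\<theta> * t)) + (1 - \<theta>) * (c * t\<^sup>2)) / (\<theta> * t)"
      using t \<theta> by (intro divide_right_mono) auto
    also have "\<dots> = G (\<theta> * t) + (1 - \<theta>) / \<theta> * t * c"
      using t \<theta> by (simp add: G_def add_divide_distrib power2_eq_square)
    finally show ?thesis using \<theta> by (simp add: G_def)
  qed
  have iter: "G 1 \<le> G (\<theta> ^ n) + (1 - \<theta> ^ n) / \<theta> * c" if \<theta>: "0 < \<theta>" "\<theta> < 1" for \<theta> n
  proof (induction n)
    case (Suc n)
    have "G (\<theta> ^ n) \<le> G (\<theta> ^ Suc n) + (1 - \<theta>) / \<theta> * \<theta> ^ n * c"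
      using step[of "\<theta> ^ n" \<theta>] \<theta> by simp
    with Suc have "G 1 \<le> G (\<theta> ^ Suc n) + ((1 - \<theta>) / \<theta> * \<theta> ^ n * c + (1 - \<theta> ^ n) / \<theta> * c)" by linarith
    also have "(1 - \<theta>) / \<theta> * \<theta> ^ n * c + (1 - \<theta> ^ n) / \<theta> * c = (1 - \<theta> ^ Suc n) / \<theta> * c"
      using \<theta> by (simp add: field_simps)
    finally show ?case .
  qed simp
  have small: "G t \<le> I + B * (exp (t * B) - 1)" if t: "t > 0" for t
  proof -
    have pt: "exp (t * f z) \<le> 1 + t * (f z + B * (exp (t * B) - 1))" if z: "z \<in> Rn d" for z
    proof -
      have a: "f z * (exp (t * f z) - 1) \<le> B * (exp (t * B) - 1)"
      proof (cases "f z \<ge> 0")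
        case True
        then show ?thesis using B[OF z] t B0 by (intro mult_mono) auto
      next
        case False
        have "t * B \<le> exp (t * B) - 1" using exp_ge_add_one_self[of "t * B"] by linarith
        moreover have "- f z * (1 - exp (t * f z)) \<le> B * (t * B)"
        proof (rule mult_mono)
          have "1 - exp (t * f z) \<le> - (t * f z)" using exp_ge_add_one_self[of "t * f z"] by linarith
          also have "\<dots> = t * (- f z)" by simp
          also have "\<dots> \<le> t * B" using B[OF z] t by (intro mult_left_mono) auto
          finally show "1 - exp (t * f z) \<le> t * B" .
          show "0 \<le> 1 - exp (t * f z)" using False t by (simp add: mult_nonneg_nonpos)
        qed (use B[OF z] B0 in auto)
        ultimately have "- f z * (1 - exp (t * f z)) \<le> B * (exp (t * B) - 1)"
          using B0 by (meson mult_left_mono order_trans)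
        then show ?thesis by (simp add: algebra_simps)
      qed
      have "1 + - (t * f z) \<le> exp (- (t * f z))" by (rule exp_ge_add_one_self)
      then have "exp (t * f z) * (1 - t * f z) \<le> exp (t * f z) * exp (- (t * f z))"
        by (intro mult_left_mono) auto
      then have "exp (t * f z) \<le> 1 + t * (f z + f z * (exp (t * f z) - 1))"
        by (simp add: exp_minus algebra_simps)
      also have "\<dots> \<le> 1 + t * (f z + B * (exp (t * B) - 1))"
        using a t by simp
      finally show ?thesis .
    qed
    have "Z t \<le> (\<integral>z. 1 + t * (f z + B * (exp (t * B) - 1)) \<partial>\<pi>)"
      unfolding Z_def using pt by (intro integral_mono intE t) (auto simp: intf)
    also have "\<dots> = 1 + t * (I + B * (exp (t * B) - 1))"
      using intf by (simp add: I_def pi.prob_space[simplified])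
    finally have "ln (Z t) \<le> t * (I + B * (exp (t * B) - 1))"
      using ln_le_minus_one[OF Z0[OF t]] by simp
    then show ?thesis using t by (simp add: G_def divide_le_eq mult.commute)
  qed
  have lim1: "G 1 \<le> I + c / \<theta>" if \<theta>: "0 < \<theta>" "\<theta> < 1" for \<theta>
  proof (rule LIMSEQ_le_const)
    have "(\<lambda>n. \<theta> ^ n) \<longlonglongrightarrow> 0" using \<theta> by (intro LIMSEQ_realpow_zero) auto
    then have "(\<lambda>n. I + B * (exp (\<theta> ^ n * B) - 1) + (1 - \<theta> ^ n) / \<theta> * c)
      \<longlonglongrightarrow> I + B * (exp (0 * B) - 1) + (1 - 0) / \<theta> * c"
      using \<theta> by (intro tendsto_intros) auto
    then show "(\<lambda>n. I + B * (exp (\<theta> ^ n * B) - 1) + (1 - \<theta> ^ n) / \<theta> * c) \<longlonglongrightarrow> I + c / \<theta>" by simp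
    have "G 1 \<le> I + B * (exp (\<theta> ^ n * B) - 1) + (1 - \<theta> ^ n) / \<theta> * c" for n
      using iter[OF \<theta>, of n] small[of "\<theta> ^ n"] \<theta> by simp
    then show "\<exists>N. \<forall>n\<ge>N. G 1 \<le> I + B * (exp (\<theta> ^ n * B) - 1) + (1 - \<theta> ^ n) / \<theta> * c" by blast
  qed
  have "G 1 \<le> I + c"
  proof (rule LIMSEQ_le_const)
    have "(\<lambda>n. I + c * (1 + inverse (real (Suc n)))) \<longlonglongrightarrow> I + c * (1 + 0)"
      by (intro tendsto_intros LIMSEQ_inverse_real_of_nat)
    then show "(\<lambda>n. I + c * (1 + inverse (real (Suc n)))) \<longlonglongrightarrow> I + c" by simp
    have "G 1 \<le> I + c * (1 + inverse (real (Suc n)))" for n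
    proof -
      let ?\<theta> = "1 / (1 + inverse (real (Suc n)))"
      have "0 < ?\<theta>" "?\<theta> < 1" by (auto simp: field_simps add_pos_pos)
      from lim1[OF this] show ?thesis by simp
    qed
    then show "\<exists>N. \<forall>n\<ge>N. G 1 \<le> I + c * (1 + inverse (real (Suc n)))" by blast
  qed
  then have "ln (Z 1) \<le> I + c" by (simp add: G_def)
  then have "Z 1 \<le> exp (I + c)" using Z0[of 1] by (metis exp_le_cancel_iff exp_ln zero_less_one)
  then show ?thesis by (simp add: Z_def I_def c_def)
qed

end


section \<open>Consequences of subgaussian exponential moments\<close>

text \<open>
  The square is linearised: \<open>exp (|b|\<^sup>2 / (4 K))\<close> is the mean of \<open>exp (u \<bullet> b)\<close> over a centred Gaussian vector \<open>u\<close> with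
  variance \<open>1 / (2 K)\<close> in each coordinate. Exchanging the two integrals leaves a Gaussian integral in \<open>u\<close>, which
  contributes a factor \<open>sqrt 2\<close> per coordinate. Bounding the coordinates of \<open>Bv\<close> separately would lose a factor
  of \<open>d\<close> in front of the entropy in \<open>square_bound\<close>.
\<close>

lemma gaussian_linearisation:
  fixes Bv :: "'a \<Rightarrow> nat \<Rightarrow> real"
  assumes M: "sigma_finite_measure M" and K: "K > 0"
    and Bm: "\<And>i. i < d \<Longrightarrow> (\<lambda>x. Bv x i) \<in> borel_measurable M"
    and sg: "\<And>u. (\<integral>\<^sup>+x. ennreal (exp (\<Sum>i<d. u i * Bv x i)) \<partial>M) \<le> ennreal (exp (K / 2 * (vnorm d u)\<^sup>2))"
  shows "(\<integral>\<^sup>+x. ennreal (exp ((vnorm d (Bv x))\<^sup>2 / (4 * K))) \<partial>M) \<le> ennreal (sqrt 2 ^ d)"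
proof -
  interpret M: sigma_finite_measure M by (rule M)
  define s where "s = 1 / sqrt (2 * K)"
  have s: "s > 0" "s\<^sup>2 = 1 / (2 * K)" using K by (auto simp: s_def power_divide)
  define N where "N = density lborel (\<lambda>x. ennreal (normal_density 0 s x))"
  have Np: "prob_space N" unfolding N_def using s(1) by (rule prob_space_normal_density)
  have [measurable_cong]: "sets N = sets borel" by (simp add: N_def)
  interpret PN: product_prob_space "\<lambda>_::nat. N" by (intro product_prob_spaceI Np)
  interpret PF: finite_product_prob_space "\<lambda>_::nat. N" "{..<d}" by standard auto
  define \<gamma> where "\<gamma> = PiM {..<d} (\<lambda>_. N)"
  interpret g: prob_space \<gamma> unfolding \<gamma>_def by (rule prob_space_PiM) (rule Np)
  interpret P: pair_sigma_finite M \<gamma> ..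
  have nd: "(\<integral>\<^sup>+x. ennreal (normal_density m r x) \<partial>lborel) = 1" if "r > 0" for m r
    using that by (subst nn_integral_eq_integral) auto
  have one: "(\<integral>\<^sup>+u. ennreal (exp (u * b)) \<partial>N) = ennreal (exp (b\<^sup>2 / (4 * K)))" for b
  proof -
    have id: "normal_density 0 s u * exp (u * b) = exp (b\<^sup>2 / (4 * K)) * normal_density (s\<^sup>2 * b) s u" for u
    proof -
      have "- (u - 0)\<^sup>2 / (2 * s\<^sup>2) + u * b = b\<^sup>2 / (4 * K) + - (u - s\<^sup>2 * b)\<^sup>2 / (2 * s\<^sup>2)"
        unfolding s(2) using K by (simp add: field_simps power2_eq_square)
      then have "exp (- (u - 0)\<^sup>2 / (2 * s\<^sup>2)) * exp (u * b) = exp (b\<^sup>2 / (4 * K)) * exp (- (u - s\<^sup>2 * b)\<^sup>2 / (2 * s\<^sup>2))"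
        by (simp only: exp_add[symmetric])
      then show ?thesis unfolding normal_density_def by (simp add: mult_ac)
    qed
    have "(\<integral>\<^sup>+u. ennreal (exp (u * b)) \<partial>N) = (\<integral>\<^sup>+u. ennreal (normal_density 0 s u) * ennreal (exp (u * b)) \<partial>lborel)"
      unfolding N_def by (rule nn_integral_density) measurable
    also have "\<dots> = (\<integral>\<^sup>+u. ennreal (exp (b\<^sup>2 / (4 * K))) * ennreal (normal_density (s\<^sup>2 * b) s u) \<partial>lborel)"
      by (intro nn_integral_cong) (simp only: ennreal_mult'[symmetric] ennreal_mult''[symmetric] normal_density_nonneg exp_ge_zero id)
    also have "\<dots> = ennreal (exp (b\<^sup>2 / (4 * K))) * 1"
      by (subst nn_integral_cmult) (auto simp: nd s)
    finally show ?thesis by simp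
  qed
  have two: "(\<integral>\<^sup>+u. ennreal (exp (K / 2 * u\<^sup>2)) \<partial>N) = ennreal (sqrt 2)"
  proof -
    define r where "r = sqrt 2 * s"
    have r: "r > 0" "r\<^sup>2 = 1 / K" using s K by (auto simp: r_def power_mult_distrib)
    have id: "normal_density 0 s u * exp (K / 2 * u\<^sup>2) = sqrt 2 * normal_density 0 r u" for u
    proof -
      have e: "- (u - 0)\<^sup>2 / (2 * s\<^sup>2) + K / 2 * u\<^sup>2 = - (u - 0)\<^sup>2 / (2 * r\<^sup>2)"
        unfolding s(2) r(2) using K by (simp add: field_simps)
      have c: "1 / sqrt (2 * pi * s\<^sup>2) = sqrt 2 * (1 / sqrt (2 * pi * r\<^sup>2))"
        unfolding s(2) r(2) using K by (simp add: real_sqrt_mult real_sqrt_divide field_simps)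
      have ee: "exp (- (u - 0)\<^sup>2 / (2 * s\<^sup>2)) * exp (K / 2 * u\<^sup>2) = exp (- (u - 0)\<^sup>2 / (2 * r\<^sup>2))"
        by (simp only: exp_add[symmetric] e)
      have "a = q * a' \<Longrightarrow> e1 * e2 = e3 \<Longrightarrow> a * e1 * e2 = q * (a' * e3)" for a a' e1 e2 e3 q :: real
        by (simp add: mult.assoc)
      from this[OF c ee] show ?thesis unfolding normal_density_def .
    qed
    have "(\<integral>\<^sup>+u. ennreal (exp (K / 2 * u\<^sup>2)) \<partial>N) = (\<integral>\<^sup>+u. ennreal (normal_density 0 s u) * ennreal (exp (K / 2 * u\<^sup>2)) \<partial>lborel)"
      unfolding N_def by (rule nn_integral_density) measurable
    also have "\<dots> = (\<integral>\<^sup>+u. ennreal (sqrt 2) * ennreal (normal_density 0 r u) \<partial>lborel)"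
      by (intro nn_integral_cong) (simp only: ennreal_mult'[symmetric] ennreal_mult''[symmetric] normal_density_nonneg exp_ge_zero id)
    also have "\<dots> = ennreal (sqrt 2) * 1"
      by (subst nn_integral_cmult) (auto simp: nd r)
    finally show ?thesis by simp
  qed
  have prod: "(\<integral>\<^sup>+u. ennreal (exp (\<Sum>i<d. h i (u i))) \<partial>\<gamma>) = (\<Prod>i<d. \<integral>\<^sup>+v. ennreal (exp (h i v)) \<partial>N)"
    if h: "\<And>i. h i \<in> borel_measurable borel" for h :: "nat \<Rightarrow> real \<Rightarrow> real"
  proof -
    note h[measurable]
    have "(\<integral>\<^sup>+u. ennreal (exp (\<Sum>i<d. h i (u i))) \<partial>\<gamma>) = (\<integral>\<^sup>+u. (\<Prod>i<d. ennreal (exp (h i (u i)))) \<partial>\<gamma>)"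
      by (simp add: exp_sum prod_ennreal)
    also have "\<dots> = (\<Prod>i<d. \<integral>\<^sup>+v. ennreal (exp (h i v)) \<partial>N)"
      unfolding \<gamma>_def by (rule PN.product_nn_integral_prod) auto
    finally show ?thesis .
  qed
  have coord: "(\<lambda>u. u i) \<in> borel_measurable \<gamma>" if "i < d" for i
  proof -
    have "measurable \<gamma> N = borel_measurable \<gamma>" by (rule measurable_cong_sets) (simp_all add: N_def)
    moreover
    have "(\<lambda>u. u i) \<in> measurable \<gamma> N"
      unfolding \<gamma>_def using that by (intro measurable_component_singleton) simp
    ultimately show ?thesis by (simp only:)
  qed
  have m: "(\<lambda>(x, u). ennreal (exp (\<Sum>i<d. u i * Bv x i))) \<in> borel_measurable (M \<Otimes>\<^sub>M \<gamma>)"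
  proof -
    have "(\<lambda>w. \<Sum>i<d. snd w i * Bv (fst w) i) \<in> borel_measurable (M \<Otimes>\<^sub>M \<gamma>)"
    proof (rule borel_measurable_sum)
      fix i assume "i \<in> {..<d}"
      then have i: "i < d" by simp
      show "(\<lambda>w. snd w i * Bv (fst w) i) \<in> borel_measurable (M \<Otimes>\<^sub>M \<gamma>)"
        by (rule borel_measurable_times[OF measurable_compose[OF measurable_snd coord[OF i]]
              measurable_compose[OF measurable_fst Bm[OF i]]])
    qed
    then show ?thesis by (simp add: split_beta')
  qed
  have "(\<integral>\<^sup>+x. ennreal (exp ((vnorm d (Bv x))\<^sup>2 / (4 * K))) \<partial>M)
    = (\<integral>\<^sup>+x. \<integral>\<^sup>+u. ennreal (exp (\<Sum>i<d. u i * Bv x i)) \<partial>\<gamma> \<partial>M)"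
  proof (rule nn_integral_cong)
    fix x
    have "(\<integral>\<^sup>+u. ennreal (exp (\<Sum>i<d. u i * Bv x i)) \<partial>\<gamma>) = (\<Prod>i<d. ennreal (exp ((Bv x i)\<^sup>2 / (4 * K))))"
      by (subst prod) (auto simp: one)
    also have "\<dots> = ennreal (exp (\<Sum>i<d. (Bv x i)\<^sup>2 / (4 * K)))"
      by (simp add: exp_sum prod_ennreal)
    also have "(\<Sum>i<d. (Bv x i)\<^sup>2 / (4 * K)) = (vnorm d (Bv x))\<^sup>2 / (4 * K)"
      by (simp add: vnorm_sq sum_divide_distrib)
    finally show "ennreal (exp ((vnorm d (Bv x))\<^sup>2 / (4 * K))) = (\<integral>\<^sup>+u. ennreal (exp (\<Sum>i<d. u i * Bv x i)) \<partial>\<gamma>)" ..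
  qed
  also have "\<dots> = (\<integral>\<^sup>+u. \<integral>\<^sup>+x. ennreal (exp (\<Sum>i<d. u i * Bv x i)) \<partial>M \<partial>\<gamma>)"
    using P.Fubini[OF m] by simp
  also have "\<dots> \<le> (\<integral>\<^sup>+u. ennreal (exp (\<Sum>i<d. K / 2 * (u i)\<^sup>2)) \<partial>\<gamma>)"
    using sg by (intro nn_integral_mono) (simp add: vnorm_sq sum_distrib_left)
  also have "\<dots> = (\<Prod>i<d. ennreal (sqrt 2))"
    by (subst prod, simp) (simp only: two)
  also have "\<dots> = ennreal (sqrt 2 ^ d)" by (simp add: ennreal_power)
  finally show ?thesis .
qed

text \<open>
  The transport inequality T1, restricted to the linear functionals of \<open>Bv\<close>: Young's inequality for the tilt
  \<open>A \<cdot> M\<close> of mass \<open>b\<close> bounds the mean of \<open>u \<bullet> Bv\<close> by the entropy plus a quadratic in \<open>u\<close>, which is then optimised.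
\<close>

lemma transport_bound:
  fixes Bv :: "'a \<Rightarrow> nat \<Rightarrow> real"
  assumes M: "prob_space M" and K: "K > 0" and b: "b > 0"
    and Bm: "\<And>i. i < d \<Longrightarrow> (\<lambda>x. Bv x i) \<in> borel_measurable M"
    and sg: "\<And>u. (\<integral>\<^sup>+x. ennreal (exp (\<Sum>i<d. u i * Bv x i)) \<partial>M) \<le> ennreal (exp (K / 2 * (vnorm d u)\<^sup>2))"
    and A0: "\<And>x. x \<in> space M \<Longrightarrow> 0 \<le> A x" and iA: "integrable M A" and mass: "(\<integral>x. A x \<partial>M) = b"
    and iB: "\<And>i. i < d \<Longrightarrow> integrable M (\<lambda>x. A x * Bv x i)"
  shows "ennreal ((vnorm d (\<lambda>i. \<integral>x. A x * Bv x i \<partial>M))\<^sup>2) \<le> ennreal (2 * K * b) * (\<integral>\<^sup>+x. ennreal (ent (A x) b) \<partial>M)"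
proof (cases "(\<integral>\<^sup>+x. ennreal (ent (A x) b) \<partial>M) = \<infinity>")
  case True
  then show ?thesis using K b by (simp add: ennreal_mult_top)
next
  case False
  interpret M: prob_space M by (rule M)
  have [measurable]: "A \<in> borel_measurable M" using iA by auto
  have iE: "integrable M (\<lambda>x. ent (A x) b)"
    using False A0 b by (intro integrableI_nonneg AE_I2 ent_nonneg) (auto simp: less_top)
  define E where "E = (\<integral>x. ent (A x) b \<partial>M)"
  have E0: "0 \<le> E" unfolding E_def using A0 b by (intro Bochner_Integration.integral_nonneg ent_nonneg)
  have EE: "(\<integral>\<^sup>+x. ennreal (ent (A x) b) \<partial>M) = ennreal E"
    unfolding E_def using A0 b by (intro nn_integral_eq_integral iE AE_I2 ent_nonneg)
  define v where "v i = (\<integral>x. A x * Bv x i \<partial>M)" for i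
  have lin: "(\<Sum>i<d. u i * v i) - b * (K / 2 * (vnorm d u)\<^sup>2) \<le> E" for u
  proof -
    define c where "c = K / 2 * (vnorm d u)\<^sup>2"
    define h where "h x = exp (\<Sum>i<d. u i * Bv x i)" for x
    have hm[measurable]: "h \<in> borel_measurable M"
    proof -
      have "(\<lambda>x. \<Sum>i<d. u i * Bv x i) \<in> borel_measurable M"
        using Bm by (intro borel_measurable_sum borel_measurable_times) auto
      then show ?thesis unfolding h_def by measurable
    qed
    have sg': "(\<integral>\<^sup>+x. ennreal (h x) \<partial>M) \<le> ennreal (exp c)" using sg[of u] by (simp add: h_def c_def)
    have ih: "integrable M h"
      using sg' by (intro integrableI_nonneg) (auto simp: h_def intro: le_less_trans)
    have "ennreal (\<integral>x. h x \<partial>M) \<le> ennreal (exp c)"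
      using sg' by (subst nn_integral_eq_integral[symmetric]) (auto simp: ih h_def)
    then have hc: "(\<integral>x. h x \<partial>M) \<le> exp c" by (simp add: ennreal_le_iff)
    have eq: "A x * ((\<Sum>i<d. u i * Bv x i) - c) = (\<Sum>i<d. u i * (A x * Bv x i)) - c * A x" for x
      by (simp add: right_diff_distrib sum_distrib_left mult_ac)
    have "(\<integral>x. A x * ((\<Sum>i<d. u i * Bv x i) - c) \<partial>M) \<le> (\<integral>x. ent (A x) b + b * (h x * exp (- c) - 1) \<partial>M)"
    proof (rule integral_mono)
      show "integrable M (\<lambda>x. A x * ((\<Sum>i<d. u i * Bv x i) - c))"
        unfolding eq using iB iA by (intro Bochner_Integration.integrable_diff Bochner_Integration.integrable_sum) auto
      show "integrable M (\<lambda>x. ent (A x) b + b * (h x * exp (- c) - 1))"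
        using iE ih by simp
      fix x assume "x \<in> space M"
      from ent_young[OF A0[OF this] b, of "(\<Sum>i<d. u i * Bv x i) - c"]
      show "A x * ((\<Sum>i<d. u i * Bv x i) - c) \<le> ent (A x) b + b * (h x * exp (- c) - 1)"
        by (simp add: h_def exp_diff exp_minus divide_inverse)
    qed
    also have "\<dots> = E + b * ((\<integral>x. h x \<partial>M) * exp (- c) - 1)"
      using iE ih by (simp add: E_def M.prob_space)
    also have "\<dots> \<le> E + b * (exp c * exp (- c) - 1)"
      using hc b by (intro add_left_mono mult_left_mono diff_right_mono mult_right_mono) auto
    also have "\<dots> = E" by (simp add: exp_minus)
    also have "(\<integral>x. A x * ((\<Sum>i<d. u i * Bv x i) - c) \<partial>M) = (\<Sum>i<d. u i * v i) - c * b"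
    proof -
      have i: "integrable M (\<lambda>x. u i * (A x * Bv x i))" if "i \<in> {..<d}" for i
        using iB that by auto
      have "(\<integral>x. (\<Sum>i<d. u i * (A x * Bv x i)) - c * A x \<partial>M)
        = (\<integral>x. (\<Sum>i<d. u i * (A x * Bv x i)) \<partial>M) - (\<integral>x. c * A x \<partial>M)"
        using i iA by (intro Bochner_Integration.integral_diff Bochner_Integration.integrable_sum) auto
      also have "(\<integral>x. (\<Sum>i<d. u i * (A x * Bv x i)) \<partial>M) = (\<Sum>i<d. \<integral>x. u i * (A x * Bv x i) \<partial>M)"
        by (rule Bochner_Integration.integral_sum[OF i])
      finally show ?thesis unfolding eq by (simp add: v_def mass)
    qed
    finally show ?thesis by (simp add: c_def mult_ac)
  qed
  \<comment> \<open>The optimal choice is \<open>u = v / (b K)\<close>.\<close>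
  have "(\<Sum>i<d. v i / (b * K) * v i) = (vnorm d v)\<^sup>2 / (b * K)"
    unfolding vnorm_sq sum_divide_distrib by (simp add: power2_eq_square)
  moreover have "vnorm d (\<lambda>i. v i / (b * K)) = vnorm d v / (b * K)"
    using vnorm_scale[of d "1 / (b * K)" v] K b by simp
  ultimately have "(vnorm d v)\<^sup>2 / (b * K) - b * (K / 2 * (vnorm d v / (b * K))\<^sup>2) \<le> E"
    using lin[of "\<lambda>i. v i / (b * K)"] by simp
  also have "(vnorm d v)\<^sup>2 / (b * K) - b * (K / 2 * (vnorm d v / (b * K))\<^sup>2) = (vnorm d v)\<^sup>2 / (2 * K * b)"
    using K b by (simp add: field_simps power2_eq_square)
  finally have "(vnorm d v)\<^sup>2 \<le> 2 * K * b * E"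
    using K b by (simp add: divide_le_eq mult.commute)
  then show ?thesis
    using K b E0 unfolding EE v_def[symmetric] by (simp add: ennreal_mult[symmetric] ennreal_leI)
qed

text \<open>
  Young's inequality with the exponent \<open>|Bv|\<^sup>2 / (4 K)\<close>, shifted so that its exponential has mean at most 1. The entropy
  appears with the constant \<open>4 K\<close>; only the second term carries the dimension.
\<close>

lemma square_bound:
  fixes Bv :: "'a \<Rightarrow> nat \<Rightarrow> real"
  assumes M: "prob_space M" and K: "K > 0" and b: "b > 0"
    and Bm: "\<And>i. i < d \<Longrightarrow> (\<lambda>x. Bv x i) \<in> borel_measurable M"
    and sq: "(\<integral>\<^sup>+x. ennreal (exp ((vnorm d (Bv x))\<^sup>2 / (4 * K))) \<partial>M) \<le> ennreal (sqrt 2 ^ d)"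
    and A0: "\<And>x. x \<in> space M \<Longrightarrow> 0 \<le> A x" and iA: "integrable M A" and mass: "(\<integral>x. A x \<partial>M) = b"
  shows "(\<integral>\<^sup>+x. ennreal (A x * (vnorm d (Bv x))\<^sup>2) \<partial>M)
    \<le> ennreal (4 * K) * ((\<integral>\<^sup>+x. ennreal (ent (A x) b) \<partial>M) + ennreal (b * (real d / 2)))"
proof (cases "(\<integral>\<^sup>+x. ennreal (ent (A x) b) \<partial>M) = \<infinity>")
  case True
  then show ?thesis using K b by (simp add: ennreal_mult_top)
next
  case False
  interpret M: prob_space M by (rule M)
  have [measurable]: "A \<in> borel_measurable M" using iA by auto
  have [measurable]: "(\<lambda>x. vnorm d (Bv x)) \<in> borel_measurable M"
    by (rule measurable_vnorm_fun[OF Bm])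
  have iE: "integrable M (\<lambda>x. ent (A x) b)"
    using False A0 b by (intro integrableI_nonneg AE_I2 ent_nonneg) (auto simp: less_top)
  define E where "E = (\<integral>x. ent (A x) b \<partial>M)"
  have E0: "0 \<le> E" unfolding E_def using A0 b by (intro Bochner_Integration.integral_nonneg ent_nonneg)
  have EE: "(\<integral>\<^sup>+x. ennreal (ent (A x) b) \<partial>M) = ennreal E"
    unfolding E_def using A0 b by (intro nn_integral_eq_integral iE AE_I2 ent_nonneg)
  define c where "c = real d / 2"
  define h where "h x = exp ((vnorm d (Bv x))\<^sup>2 / (4 * K))" for x
  have [measurable]: "h \<in> borel_measurable M" unfolding h_def by measurable
  \<comment> \<open>Since \<open>ln 2 \<le> 1\<close>, the exact exponent \<open>d / 2 * ln 2\<close> is at most \<open>c\<close>.\<close>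
  have "sqrt 2 ^ d \<le> exp (1 / 2) ^ d"
  proof (rule power_mono)
    have "2 \<le> exp (1::real)" using exp_ge_add_one_self[of 1] by simp
    then have "sqrt 2 \<le> sqrt (exp (1 / 2) * exp (1 / 2))" by (simp add: exp_add[symmetric])
    then show "sqrt 2 \<le> exp (1 / 2)" by simp
  qed simp
  also have "\<dots> = exp c" by (simp add: c_def exp_of_nat_mult[symmetric])
  finally have sq': "(\<integral>\<^sup>+x. ennreal (h x) \<partial>M) \<le> ennreal (exp c)"
    using sq by (auto simp: h_def intro: order_trans ennreal_leI)
  have ih: "integrable M h"
    using sq' by (intro integrableI_nonneg) (auto simp: h_def intro: le_less_trans)
  have "ennreal (\<integral>x. h x \<partial>M) \<le> ennreal (exp c)"
    using sq' by (subst nn_integral_eq_integral[symmetric]) (auto simp: ih h_def)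
  then have hc: "(\<integral>x. h x \<partial>M) \<le> exp c" by (simp add: ennreal_le_iff)
  define R where "R x = 4 * K * (ent (A x) b + b * (h x * exp (- c) - 1) + c * A x)" for x
  have iR: "integrable M R" unfolding R_def using iE ih iA by simp
  have le: "A x * (vnorm d (Bv x))\<^sup>2 \<le> R x" if "x \<in> space M" for x
  proof -
    define w where "w = (vnorm d (Bv x))\<^sup>2 / (4 * K)"
    have e: "exp (w - c) = h x * exp (- c)"
      by (simp only: h_def w_def diff_conv_add_uminus exp_add)
    have "A x * w - c * A x \<le> ent (A x) b + b * (h x * exp (- c) - 1)"
      using ent_young[OF A0[OF that] b, of "w - c"] unfolding e
      by (simp only: right_diff_distrib mult.commute[of "A x" c])
    then have "A x * w \<le> ent (A x) b + b * (h x * exp (- c) - 1) + c * A x" by linarith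
    then have "4 * K * (A x * w) \<le> R x"
      unfolding R_def using K by (intro mult_left_mono) simp_all
    then show ?thesis using K by (simp add: w_def)
  qed
  have R0: "0 \<le> R x" if "x \<in> space M" for x
    using order_trans[OF mult_nonneg_nonneg[OF A0[OF that] zero_le_power2] le[OF that]] .
  have "(\<integral>\<^sup>+x. ennreal (A x * (vnorm d (Bv x))\<^sup>2) \<partial>M) \<le> (\<integral>\<^sup>+x. ennreal (R x) \<partial>M)"
    using le by (intro nn_integral_mono ennreal_leI)
  also have "\<dots> = ennreal (\<integral>x. R x \<partial>M)"
    using R0 by (intro nn_integral_eq_integral iR AE_I2)
  also have "(\<integral>x. R x \<partial>M) = 4 * K * (E + b * ((\<integral>x. h x \<partial>M) * exp (- c) - 1) + c * b)"
    unfolding R_def using iE ih iA by (simp add: E_def M.prob_space mass)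
  also have "ennreal \<dots> \<le> ennreal (4 * K * (E + b * (exp c * exp (- c) - 1) + c * b))"
    using hc b K by (intro ennreal_leI add_left_mono add_right_mono mult_left_mono diff_right_mono mult_right_mono) auto
  also have "\<dots> = ennreal (4 * K) * (ennreal E + ennreal (b * c))"
    using K b E0 by (simp add: exp_minus c_def ennreal_mult ennreal_plus[symmetric] mult.commute del: ennreal_plus)
  finally show ?thesis by (simp add: EE c_def)
qed


section \<open>The interaction force is subgaussian\<close>

text \<open>A smooth truncation: bounded by \<open>k\<close>, with slope in \<open>[0, 1]\<close>, and tending to the identity.\<close>

definition trunc :: "real \<Rightarrow> real \<Rightarrow> real" where
  "trunc k s = s / sqrt (1 + (s / k)\<^sup>2)"

definition dtrunc :: "real \<Rightarrow> real \<Rightarrow> real" where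
  "dtrunc k s = 1 / ((1 + (s / k)\<^sup>2) * sqrt (1 + (s / k)\<^sup>2))"

lemma one_plus_sq_pos: "0 < 1 + (s :: real)\<^sup>2"
  by (rule add_pos_nonneg) simp_all

lemma DERIV_trunc:
  assumes "k > 0"
  shows "(trunc k has_real_derivative dtrunc k s) (at s)"
proof -
  define q where "q = 1 + (s / k)\<^sup>2"
  have q: "q > 0" unfolding q_def by (rule one_plus_sq_pos)
  have d1: "((\<lambda>s. 1 + (s / k)\<^sup>2) has_real_derivative 2 * (s / k) * (1 / k)) (at s)"
    using assms by (auto intro!: derivative_eq_intros)
  have d2: "((\<lambda>s. sqrt (1 + (s / k)\<^sup>2)) has_real_derivative inverse (sqrt q) / 2 * (2 * (s / k) * (1 / k))) (at s)"
    unfolding q_def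
    by (rule DERIV_chain2[where f=sqrt and g="\<lambda>s. 1 + (s / k)\<^sup>2" and x=s, OF DERIV_real_sqrt[OF q[unfolded q_def]] d1])
  have "((\<lambda>s. s / sqrt (1 + (s / k)\<^sup>2)) has_real_derivative
    (1 * sqrt q - s * (inverse (sqrt q) / 2 * (2 * (s / k) * (1 / k)))) / (sqrt q * sqrt q)) (at s)"
    using DERIV_divide[OF DERIV_ident d2] q unfolding q_def by simp
  also have "1 * sqrt q - s * (inverse (sqrt q) / 2 * (2 * (s / k) * (1 / k))) = (q - (s / k)\<^sup>2) / sqrt q"
    using q by (simp add: field_simps power2_eq_square)
  also have "q - (s / k)\<^sup>2 = 1" by (simp add: q_def)
  also have "1 / sqrt q / (sqrt q * sqrt q) = dtrunc k s"
    using q by (simp add: dtrunc_def q_def)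
  finally show ?thesis by (simp add: trunc_def[abs_def])
qed

lemma dtrunc_bounds: "0 \<le> dtrunc k s" "dtrunc k s \<le> 1"
proof -
  have "1 \<le> 1 + (s / k)\<^sup>2" "1 \<le> sqrt (1 + (s / k)\<^sup>2)" by auto
  then have "1 * 1 \<le> (1 + (s / k)\<^sup>2) * sqrt (1 + (s / k)\<^sup>2)" by (intro mult_mono) auto
  then show "dtrunc k s \<le> 1" "0 \<le> dtrunc k s" by (auto simp: dtrunc_def)
qed

lemma abs_trunc_le_self: "\<bar>trunc k s\<bar> \<le> \<bar>s\<bar>"
proof -
  have "\<bar>s\<bar> / sqrt (1 + (s / k)\<^sup>2) \<le> \<bar>s\<bar> / 1"
    using one_plus_sq_pos[of "s / k"] by (intro divide_left_mono) auto
  then show ?thesis using one_plus_sq_pos[of "s / k"] by (simp add: trunc_def abs_divide)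
qed

lemma abs_trunc_le:
  assumes "k > 0" shows "\<bar>trunc k s\<bar> \<le> k"
proof -
  have "\<bar>s\<bar> / k \<le> sqrt (1 + (s / k)\<^sup>2)"
    using assms by (intro real_le_rsqrt) (simp add: power_divide)
  then have "\<bar>s\<bar> \<le> k * sqrt (1 + (s / k)\<^sup>2)" using assms by (simp add: field_simps)
  moreover have "sqrt (1 + (s / k)\<^sup>2) > 0" using one_plus_sq_pos[of "s / k"] by simp
  ultimately show ?thesis by (simp add: trunc_def abs_divide divide_le_eq)
qed

locale interaction = lsi_density +
  fixes W :: "(nat \<Rightarrow> real) \<Rightarrow> real" and G :: "(nat \<Rightarrow> real) \<Rightarrow> nat \<Rightarrow> real" and L :: real
  assumes W_grad: "\<And>x. x \<in> Rn d \<Longrightarrow> has_gradient d W (G x) x"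
    and G_lip: "\<And>x y. x \<in> Rn d \<Longrightarrow> y \<in> Rn d \<Longrightarrow>
      vnorm d (vdiff d (G x) (G y)) \<le> L * vnorm d (vdiff d x y)"
    and L_pos: "0 < L"
begin

lemma W_meas [measurable]: "W \<in> borel_measurable (leb d)"
  by (rule measurable_continuous_leb[OF has_gradient_continuous[OF W_grad]])

lemma G_meas: "i < d \<Longrightarrow> (\<lambda>x. G x i) \<in> borel_measurable (leb d)"
  by (rule measurable_continuous_leb[OF lipschitz_coord_continuous[OF G_lip]])

definition G0 :: real where
  "G0 = vnorm d (G (\<lambda>i\<in>{..<d}. 0))"

lemma G_growth:
  assumes "x \<in> Rn d"
  shows "vnorm d (G x) \<le> G0 + L * vnorm d x"
proof -
  let ?o = "\<lambda>i\<in>{..<d}. 0"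
  have "vnorm d (\<lambda>i. G x i - G ?o i) = vnorm d (vdiff d (G x) (G ?o))" by (simp add: vnorm_vdiff)
  also have "\<dots> \<le> L * vnorm d (vdiff d x ?o)" using assms by (intro G_lip) auto
  also have "vnorm d (vdiff d x ?o) = vnorm d x"
    unfolding vnorm_vdiff by (rule vnorm_cong) simp
  finally have 1: "vnorm d (\<lambda>i. G x i - G ?o i) \<le> L * vnorm d x" .
  have "vnorm d (G x) = vnorm d (\<lambda>i. G ?o i + (G x i - G ?o i))" by simp
  also have "\<dots> \<le> vnorm d (G ?o) + vnorm d (\<lambda>i. G x i - G ?o i)" by (rule vnorm_triangle)
  finally show ?thesis using 1 unfolding G0_def by linarith
qed

lemma vnorm_vdiff_le: "vnorm d (vdiff d x y) \<le> vnorm d x + vnorm d y"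
proof -
  have "vnorm d (vdiff d x y) = vnorm d (\<lambda>i. x i + (-1) * y i)" by (simp add: vnorm_vdiff)
  also have "\<dots> \<le> vnorm d x + vnorm d (\<lambda>i. (-1) * y i)" by (rule vnorm_triangle)
  also have "vnorm d (\<lambda>i. (-1) * y i) = vnorm d y" using vnorm_scale[of d "-1" y] by simp
  finally show ?thesis .
qed

lemma vnorm_line_le: "vnorm d (line d x u t) \<le> vnorm d x + \<bar>t\<bar> * vnorm d u"
proof -
  have "vnorm d (line d x u t) = vnorm d (\<lambda>i. x i + t * u i)"
    by (rule vnorm_cong) (simp add: line_def)
  also have "\<dots> \<le> vnorm d x + vnorm d (\<lambda>i. t * u i)" by (rule vnorm_triangle)
  finally show ?thesis by (simp add: vnorm_scale)
qed

text \<open>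
  \<open>\<nabla>W\<close> is only Lipschitz, while \<open>herbst\<close> asks for differentiable functions. The difference quotient of \<open>W\<close> in
  the direction \<open>u\<close> with step \<open>1 / k\<close> is differentiable, it approximates \<open>u \<bullet> \<nabla>W(a - y)\<close>, and the Lipschitz bound for \<open>\<nabla>W\<close> makes
  its gradient \<open>dquot\<close> at most \<open>L |u|\<close>, uniformly in \<open>k\<close>.
\<close>

definition quot :: "(nat \<Rightarrow> real) \<Rightarrow> (nat \<Rightarrow> real) \<Rightarrow> real \<Rightarrow> (nat \<Rightarrow> real) \<Rightarrow> real" where
  "quot a u k y = k * (W (line d (vdiff d a y) u (1 / k)) - W (vdiff d a y))"

definition dquot :: "(nat \<Rightarrow> real) \<Rightarrow> (nat \<Rightarrow> real) \<Rightarrow> real \<Rightarrow> (nat \<Rightarrow> real) \<Rightarrow> nat \<Rightarrow> real" where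
  "dquot a u k y i = k * (G (vdiff d a y) i - G (line d (vdiff d a y) u (1 / k)) i)"

lemma has_partials_quot:
  "has_partials d (quot a u k) (dquot a u k)"
  unfolding has_partials_def
proof (intro ballI allI impI)
  fix x i t assume x: "x \<in> Rn d" and i: "i < d"
  define c where "c = vdiff d a x"
  define e where "e = line d c u (1 / k)"
  have ce: "c \<in> Rn d" "e \<in> Rn d" by (simp_all add: c_def e_def)
  have 1: "vdiff d a (x(i := s)) = c(i := a i - s)" for s
    using i by (auto simp: c_def vdiff_def fun_eq_iff)
  have 2: "line d (c(i := a i - s)) u (1 / k) = e(i := (a i - s) + 1 / k * u i)" for s
    using i by (auto simp: e_def line_def fun_eq_iff)
  have d1: "((\<lambda>s. a i - s) has_real_derivative -1) (at t)"
    by (auto intro!: derivative_eq_intros)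
  have d2: "((\<lambda>s. (a i - s) + 1 / k * u i) has_real_derivative -1) (at t)"
    by (auto intro!: derivative_eq_intros)
  have w1: "((\<lambda>s. W (c(i := a i - s))) has_real_derivative G (c(i := a i - t)) i * -1) (at t)"
    by (rule DERIV_chain2[where f="\<lambda>s. W (c(i := s))", OF has_gradient_coord[OF W_grad ce(1) i] d1])
  have w2: "((\<lambda>s. W (e(i := (a i - s) + 1 / k * u i))) has_real_derivative
      G (e(i := (a i - t) + 1 / k * u i)) i * -1) (at t)"
    by (rule DERIV_chain2[where f="\<lambda>s. W (e(i := s))", OF has_gradient_coord[OF W_grad ce(2) i] d2])
  from DERIV_cmult[OF DERIV_diff[OF w2 w1], of k]
  show "((\<lambda>s. quot a u k (x(i := s))) has_real_derivative dquot a u k (x(i := t)) i) (at t)"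
    unfolding quot_def dquot_def 1 2 by (simp add: algebra_simps)
qed

lemma vnorm_dquot:
  assumes "k > 0"
  shows "vnorm d (dquot a u k y) \<le> L * vnorm d u"
proof -
  let ?x = "vdiff d a y"
  have "vnorm d (dquot a u k y) = k * vnorm d (vdiff d (G ?x) (G (line d ?x u (1 / k))))"
    unfolding dquot_def vnorm_vdiff using assms by (simp add: vnorm_scale)
  also have "\<dots> \<le> k * (L * vnorm d (vdiff d (line d ?x u 0) (line d ?x u (1 / k))))"
    using assms G_lip[of ?x "line d ?x u (1 / k)"] by (intro mult_left_mono) simp_all
  also have "\<dots> = L * vnorm d u" unfolding vnorm_line using assms by simp
  finally show ?thesis .
qed

lemma abs_quot_le:
  assumes k: "k \<ge> 1"
  shows "\<bar>quot a u k y\<bar> \<le> (G0 + L * (vnorm d a + vnorm d y + vnorm d u)) * vnorm d u"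
proof -
  let ?x = "vdiff d a y"
  have "\<exists>z>0. z < 1 / k \<and> W (line d ?x u (1 / k)) - W (line d ?x u 0)
      = (1 / k - 0) * (\<Sum>i<d. G (line d ?x u z) i * u i)"
    using k by (intro MVT2 has_gradient_line W_grad) auto
  then obtain z where z: "0 < z" "z < 1 / k"
    and eq: "W (line d ?x u (1 / k)) - W (line d ?x u 0) = 1 / k * (\<Sum>i<d. G (line d ?x u z) i * u i)"
    by auto
  have "1 / k \<le> 1" using k by simp
  then have z1: "\<bar>z\<bar> \<le> 1" using z by linarith
  have "quot a u k y = (\<Sum>i<d. G (line d ?x u z) i * u i)"
    using eq k by (simp add: quot_def)
  also have "\<bar>\<dots>\<bar> \<le> vnorm d (G (line d ?x u z)) * vnorm d u" by (rule abs_inner_le_vnorm)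
  also have "\<dots> \<le> (G0 + L * (vnorm d a + vnorm d y + vnorm d u)) * vnorm d u"
  proof (rule mult_right_mono)
    have "vnorm d (line d ?x u z) \<le> vnorm d ?x + \<bar>z\<bar> * vnorm d u" by (rule vnorm_line_le)
    also have "\<dots> \<le> (vnorm d a + vnorm d y) + 1 * vnorm d u"
      using z1 by (intro add_mono vnorm_vdiff_le mult_right_mono) auto
    finally have "L * vnorm d (line d ?x u z) \<le> L * (vnorm d a + vnorm d y + vnorm d u)"
      using L_pos by (intro mult_left_mono) auto
    moreover have "vnorm d (G (line d ?x u z)) \<le> G0 + L * vnorm d (line d ?x u z)" by (rule G_growth) simp
    ultimately show "vnorm d (G (line d ?x u z)) \<le> G0 + L * (vnorm d a + vnorm d y + vnorm d u)"
      by linarith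
  qed simp
  finally show ?thesis .
qed

lemma quot_tendsto:
  "(\<lambda>n. quot a u (real (Suc n)) y) \<longlonglongrightarrow> (\<Sum>i<d. G (vdiff d a y) i * u i)"
proof -
  let ?x = "vdiff d a y"
  have "((\<lambda>s. W (line d ?x u s)) has_real_derivative (\<Sum>i<d. G (line d ?x u 0) i * u i)) (at 0)"
    by (rule has_gradient_line) (rule W_grad, simp)
  then have "((\<lambda>s. (W (line d ?x u s) - W ?x) / s) \<longlongrightarrow> (\<Sum>i<d. G ?x i * u i)) (at 0)"
    by (simp add: has_field_derivative_iff)
  moreover have "filterlim (\<lambda>n. inverse (real (Suc n))) (at 0) sequentially"
    unfolding filterlim_at using LIMSEQ_inverse_real_of_nat by auto
  ultimately have "(\<lambda>n. (W (line d ?x u (inverse (real (Suc n)))) - W ?x) / inverse (real (Suc n)))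
      \<longlonglongrightarrow> (\<Sum>i<d. G ?x i * u i)"
    by (rule filterlim_compose)
  then show ?thesis by (simp add: quot_def divide_inverse mult.commute)
qed

lemma integrable_vnorm: "integrable \<pi> (vnorm d)"
proof -
  interpret pi: prob_space \<pi> by (rule prob)
  have "integrable \<pi> (\<lambda>z. 1 + (vnorm d z)\<^sup>2)" using integrable_moment by simp
  then show ?thesis
  proof (rule Bochner_Integration.integrable_bound)
    have "r \<le> 1 + r\<^sup>2" for r :: real
    proof -
      have "2 * r \<le> 1 + r\<^sup>2" using zero_le_power2[of "r - 1"] by (simp add: power2_diff)
      then show ?thesis using zero_le_power2[of r] by linarith
    qed
    then show "AE z in \<pi>. norm (vnorm d z) \<le> norm (1 + (vnorm d z)\<^sup>2)" by (intro AE_I2) simp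
  qed measurable
qed

lemma measurable_vdiff_pi: "a \<in> Rn d \<Longrightarrow> (\<lambda>y. vdiff d a y) \<in> measurable (leb d) (leb d)"
  by (intro measurable_vdiff) (auto simp: space_leb)

lemma integrable_linear_growth:
  assumes f: "f \<in> borel_measurable (leb d)" and le: "\<And>y. y \<in> Rn d \<Longrightarrow> \<bar>f y\<bar> \<le> c1 + c2 * vnorm d y"
  shows "integrable \<pi> f"
proof -
  interpret pi: prob_space \<pi> by (rule prob)
  have "integrable \<pi> (\<lambda>y. c1 + c2 * vnorm d y)" using integrable_vnorm by simp
  then show ?thesis
  proof (rule Bochner_Integration.integrable_bound)
    show "f \<in> borel_measurable \<pi>" using f by (simp cong: measurable_cong_sets)
    show "AE y in \<pi>. norm (f y) \<le> norm (c1 + c2 * vnorm d y)"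
    proof (rule AE_I2)
      fix y assume "y \<in> space \<pi>"
      then show "norm (f y) \<le> norm (c1 + c2 * vnorm d y)" using le[of y] by simp
    qed
  qed
qed

lemma integrable_G:
  assumes a: "a \<in> Rn d" and i: "i < d"
  shows "integrable \<pi> (\<lambda>y. G (vdiff d a y) i)"
proof (rule integrable_linear_growth[of _ "G0 + L * vnorm d a" L])
  show "(\<lambda>y. G (vdiff d a y) i) \<in> borel_measurable (leb d)"
    by (rule measurable_compose[OF measurable_vdiff_pi[OF a] G_meas[OF i]])
  fix y
  have "\<bar>G (vdiff d a y) i\<bar> \<le> vnorm d (G (vdiff d a y))" by (rule abs_coord_le_vnorm[OF i])
  also have "\<dots> \<le> G0 + L * vnorm d (vdiff d a y)" by (rule G_growth) simp
  also have "\<dots> \<le> G0 + L * (vnorm d a + vnorm d y)"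
    using L_pos vnorm_vdiff_le[of a y] by simp
  finally show "\<bar>G (vdiff d a y) i\<bar> \<le> G0 + L * vnorm d a + L * vnorm d y" by (simp add: algebra_simps)
qed

definition Gbar :: "(nat \<Rightarrow> real) \<Rightarrow> nat \<Rightarrow> real" where
  "Gbar a i = (\<integral>y. G (vdiff d a y) i \<partial>\<pi>)"

definition dev :: "(nat \<Rightarrow> real) \<Rightarrow> (nat \<Rightarrow> real) \<Rightarrow> nat \<Rightarrow> real" where
  "dev a y i = G (vdiff d a y) i - Gbar a i"

text \<open>
  \<open>herbst\<close> applies to the truncated difference quotients; the step and the truncation are removed together, by Fatou's lemma
  on the exponential side and by dominated convergence for the means.
\<close>

lemma subgaussian:
  assumes a: "a \<in> Rn d"
  shows "(\<integral>\<^sup>+y. ennreal (exp (\<Sum>i<d. u i * dev a y i)) \<partial>\<pi>) \<le> ennreal (exp (C * L\<^sup>2 / 2 * (vnorm d u)\<^sup>2))"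
proof -
  interpret pi: prob_space \<pi> by (rule prob)
  define k where "k n = real (Suc n)" for n
  have k: "k n > 0" "k n \<ge> 1" for n by (auto simp: k_def)
  define f where "f n y = trunc (k n) (quot a u (k n) y)" for n y
  define g where "g y = (\<Sum>i<d. G (vdiff d a y) i * u i)" for y
  define c1 where "c1 = (G0 + L * (vnorm d a + vnorm d u)) * vnorm d u"
  define c2 where "c2 = L * vnorm d u"
  define c where "c = C * (L * vnorm d u)\<^sup>2 / 2"
  note va[measurable] = measurable_vdiff_pi[OF a]
  have lm[measurable]: "(\<lambda>y. line d (vdiff d a y) u t) \<in> measurable (leb d) (leb d)" for t
    by (rule measurable_line[OF va])
  have qm[measurable]: "quot a u (k n) \<in> borel_measurable (leb d)" for n
    unfolding quot_def by measurable
  have dqm: "(\<lambda>y. dquot a u (k n) y i) \<in> borel_measurable (leb d)" if "i < d" for n i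
  proof -
    note measurable_compose[OF va G_meas[OF that], measurable]
      measurable_compose[OF lm G_meas[OF that], measurable]
    show ?thesis unfolding dquot_def by measurable
  qed
  have fm[measurable]: "f n \<in> borel_measurable (leb d)" for n
    unfolding f_def trunc_def by measurable
  have gm: "g \<in> borel_measurable (leb d)"
    unfolding g_def
    by (intro borel_measurable_sum borel_measurable_times measurable_compose[OF va G_meas]) auto
  have fb: "\<bar>f n y\<bar> \<le> c1 + c2 * vnorm d y" for n y
    using order_trans[OF abs_trunc_le_self abs_quot_le[OF k(2)], of "k n" a u n y]
    by (simp add: f_def c1_def c2_def algebra_simps)
  have intf: "integrable \<pi> (f n)" for n
    by (rule integrable_linear_growth[OF fm fb])
  have lim: "(\<lambda>n. f n y) \<longlonglongrightarrow> g y" for y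
  proof -
    have q: "(\<lambda>n. quot a u (k n) y) \<longlonglongrightarrow> g y" unfolding k_def g_def by (rule quot_tendsto)
    have i: "(\<lambda>n. 1 / k n) \<longlonglongrightarrow> 0"
      using LIMSEQ_inverse_real_of_nat by (simp add: k_def inverse_eq_divide)
    have "(\<lambda>n. quot a u (k n) y / sqrt (1 + (quot a u (k n) y * (1 / k n))\<^sup>2)) \<longlonglongrightarrow> g y / sqrt (1 + (g y * 0)\<^sup>2)"
      by (intro tendsto_intros q i) auto
    then show ?thesis by (simp add: f_def trunc_def)
  qed
  have her: "(\<integral>y. exp (f n y) \<partial>\<pi>) \<le> exp ((\<integral>y. f n y \<partial>\<pi>) + c)" for n
    unfolding c_def
  proof (rule herbst[OF fm, where B = "k n" and Df = "\<lambda>y i. dtrunc (k n) (quot a u (k n) y) * dquot a u (k n) y i"])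
    show "\<bar>f n y\<bar> \<le> k n" for y unfolding f_def by (rule abs_trunc_le[OF k(1)])
    show "(\<lambda>y. dtrunc (k n) (quot a u (k n) y) * dquot a u (k n) y i) \<in> borel_measurable (leb d)" if "i < d" for i
    proof (rule borel_measurable_times[OF _ dqm[OF that]])
      show "(\<lambda>y. dtrunc (k n) (quot a u (k n) y)) \<in> borel_measurable (leb d)"
        unfolding dtrunc_def by measurable
    qed
    show "has_partials d (f n) (\<lambda>y i. dtrunc (k n) (quot a u (k n) y) * dquot a u (k n) y i)"
      unfolding has_partials_def f_def
      by (intro ballI allI impI DERIV_chain2[where f="trunc (k n)", OF DERIV_trunc[OF k(1)]]
          has_partialsD[OF has_partials_quot])
    fix y
    have "vnorm d (\<lambda>i. dtrunc (k n) (quot a u (k n) y) * dquot a u (k n) y i)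
      = dtrunc (k n) (quot a u (k n) y) * vnorm d (dquot a u (k n) y)"
      using dtrunc_bounds(1)[of "k n"] by (simp add: vnorm_scale)
    also have "\<dots> \<le> 1 * (L * vnorm d u)"
      using dtrunc_bounds vnorm_dquot[OF k(1)] by (intro mult_mono) auto
    finally show "vnorm d (\<lambda>i. dtrunc (k n) (quot a u (k n) y) * dquot a u (k n) y i) \<le> L * vnorm d u" by simp
  qed
  have her': "(\<integral>\<^sup>+y. ennreal (exp (f n y)) \<partial>\<pi>) \<le> ennreal (exp ((\<integral>y. f n y \<partial>\<pi>) + c))" for n
  proof -
    have "integrable \<pi> (\<lambda>y. exp (f n y))"
    proof (rule integrable_bounded[of _ "exp (k n)"])
      show "\<bar>exp (f n y)\<bar> \<le> exp (k n)" for y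
        using abs_trunc_le[OF k(1), of n "quot a u (k n) y"] by (simp add: f_def abs_le_iff)
    qed measurable
    then have "(\<integral>\<^sup>+y. ennreal (exp (f n y)) \<partial>\<pi>) = ennreal (\<integral>y. exp (f n y) \<partial>\<pi>)"
      by (intro nn_integral_eq_integral) auto
    then show ?thesis using her[of n] by (simp add: ennreal_leI)
  qed
  have Il: "(\<lambda>n. \<integral>y. f n y \<partial>\<pi>) \<longlonglongrightarrow> (\<integral>y. g y \<partial>\<pi>)"
  proof (rule integral_dominated_convergence)
    show "integrable \<pi> (\<lambda>y. c1 + c2 * vnorm d y)" using integrable_vnorm by simp
    show "g \<in> borel_measurable \<pi>" using gm by (simp cong: measurable_cong_sets)
    show "f n \<in> borel_measurable \<pi>" for n using fm[of n] by (simp cong: measurable_cong_sets)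
  qed (use lim fb in auto)
  have Ig: "(\<integral>y. g y \<partial>\<pi>) = (\<Sum>i<d. Gbar a i * u i)"
    unfolding g_def Gbar_def using integrable_G[OF a]
    by (subst Bochner_Integration.integral_sum) auto
  have "(\<integral>\<^sup>+y. ennreal (exp (g y)) \<partial>\<pi>) = (\<integral>\<^sup>+y. liminf (\<lambda>n. ennreal (exp (f n y))) \<partial>\<pi>)"
  proof (rule nn_integral_cong)
    fix y
    have "(\<lambda>n. ennreal (exp (f n y))) \<longlonglongrightarrow> ennreal (exp (g y))"
      by (intro tendsto_ennrealI tendsto_exp lim)
    then show "ennreal (exp (g y)) = liminf (\<lambda>n. ennreal (exp (f n y)))"
      by (intro lim_imp_Liminf[symmetric]) auto
  qed
  also have "\<dots> \<le> liminf (\<lambda>n. \<integral>\<^sup>+y. ennreal (exp (f n y)) \<partial>\<pi>)"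
    by (rule nn_integral_liminf) (use fm in \<open>auto cong: measurable_cong_sets\<close>)
  also have "\<dots> \<le> liminf (\<lambda>n. ennreal (exp ((\<integral>y. f n y \<partial>\<pi>) + c)))"
    by (rule Liminf_mono) (use her' in auto)
  also have "\<dots> = ennreal (exp ((\<integral>y. g y \<partial>\<pi>) + c))"
    by (intro lim_imp_Liminf tendsto_ennrealI tendsto_exp tendsto_add Il tendsto_const) simp
  finally have main: "(\<integral>\<^sup>+y. ennreal (exp (g y)) \<partial>\<pi>) \<le> ennreal (exp ((\<integral>y. g y \<partial>\<pi>) + c))" .
  have d: "(\<Sum>i<d. u i * dev a y i) = g y - (\<integral>y. g y \<partial>\<pi>)" for y
  proof -
    have "(\<Sum>i<d. u i * dev a y i) = (\<Sum>i<d. G (vdiff d a y) i * u i) - (\<Sum>i<d. Gbar a i * u i)"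
      unfolding sum_subtractf[symmetric] by (intro sum.cong) (auto simp: dev_def algebra_simps)
    then show ?thesis by (simp only: Ig) (simp only: g_def)
  qed
  have "(\<integral>\<^sup>+y. ennreal (exp (\<Sum>i<d. u i * dev a y i)) \<partial>\<pi>)
    = (\<integral>\<^sup>+y. ennreal (exp (- (\<integral>y. g y \<partial>\<pi>))) * ennreal (exp (g y)) \<partial>\<pi>)"
    unfolding d by (intro nn_integral_cong) (simp add: ennreal_mult[symmetric] exp_add[symmetric])
  also have "\<dots> = ennreal (exp (- (\<integral>y. g y \<partial>\<pi>))) * (\<integral>\<^sup>+y. ennreal (exp (g y)) \<partial>\<pi>)"
    by (rule nn_integral_cmult) (use gm in \<open>simp cong: measurable_cong_sets\<close>)
  also have "\<dots> \<le> ennreal (exp (- (\<integral>y. g y \<partial>\<pi>))) * ennreal (exp ((\<integral>y. g y \<partial>\<pi>) + c))"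
    by (rule mult_left_mono[OF main]) simp
  also have "\<dots> = ennreal (exp c)"
    by (simp add: ennreal_mult[symmetric] exp_add[symmetric])
  also have "c = C * L\<^sup>2 / 2 * (vnorm d u)\<^sup>2" by (simp add: c_def power_mult_distrib)
  finally show ?thesis .
qed

end


section \<open>The mean-field potential\<close>

lemma lipschitz_gradient_growth:
  assumes W: "\<And>x. x \<in> Rn d \<Longrightarrow> has_gradient d W (G x) x"
    and G: "\<And>x y. x \<in> Rn d \<Longrightarrow> y \<in> Rn d \<Longrightarrow>
      vnorm d (vdiff d (G x) (G y)) \<le> L * vnorm d (vdiff d x y)" and L: "0 \<le> L"
  obtains c where "c \<ge> 0" "\<And>x. x \<in> Rn d \<Longrightarrow> \<bar>W x\<bar> \<le> c * (1 + (vnorm d x)\<^sup>2)"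
proof -
  define e0 where "e0 = (\<lambda>i\<in>{..<d}. 0 :: real)"
  have e0: "e0 \<in> Rn d" by (simp add: e0_def)
  have l0: "line d e0 x 0 = e0" and l1: "line d e0 x 1 = x" if "x \<in> Rn d" for x
    using that by (auto simp: line_def e0_def fun_eq_iff PiE_iff extensional_def)
  define g where "g = vnorm d (G e0)"
  define c where "c = \<bar>W e0\<bar> + g + L"
  have "\<bar>W x\<bar> \<le> c * (1 + (vnorm d x)\<^sup>2)" if x: "x \<in> Rn d" for x
  proof -
    define n where "n = vnorm d x"
    have n: "0 \<le> n" by (simp add: n_def)
    have "\<exists>z>0. z < 1 \<and> W (line d e0 x 1) - W (line d e0 x 0) = (1 - 0) * (\<Sum>i<d. G (line d e0 x z) i * x i)"
      by (intro MVT2 has_gradient_line W) auto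
    then obtain z where z: "0 < z" "z < 1" and eq: "W x - W e0 = (\<Sum>i<d. G (line d e0 x z) i * x i)"
      by (auto simp: l0[OF x] l1[OF x])
    have "vnorm d (\<lambda>i. G (line d e0 x z) i - G e0 i) \<le> L * vnorm d (vdiff d (line d e0 x z) (line d e0 x 0))"
      using G[of "line d e0 x z" e0] e0 by (simp add: vnorm_vdiff[symmetric] l0[OF x])
    also have "\<dots> \<le> L * n"
      unfolding vnorm_line n_def[symmetric] using z L n by (intro mult_left_mono) (auto simp: mult_left_le_one_le)
    finally have 1: "vnorm d (\<lambda>i. G (line d e0 x z) i - G e0 i) \<le> L * n" .
    have "vnorm d (G (line d e0 x z)) = vnorm d (\<lambda>i. G e0 i + (G (line d e0 x z) i - G e0 i))" by simp
    also have "\<dots> \<le> g + vnorm d (\<lambda>i. G (line d e0 x z) i - G e0 i)" unfolding g_def by (rule vnorm_triangle)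
    finally have 2: "vnorm d (G (line d e0 x z)) \<le> g + L * n" using 1 by simp
    have "\<bar>W x - W e0\<bar> \<le> vnorm d (G (line d e0 x z)) * n"
      unfolding eq n_def by (rule abs_inner_le_vnorm)
    also have "\<dots> \<le> (g + L * n) * n" using 2 n by (intro mult_right_mono)
    also have "\<dots> = g * n + L * n\<^sup>2" by (simp add: algebra_simps power2_eq_square)
    also have "g * n \<le> g * (1 + n\<^sup>2)"
    proof (rule mult_left_mono)
      have "2 * n \<le> 1 + n\<^sup>2" using zero_le_power2[of "n - 1"] by (simp add: power2_diff)
      then show "n \<le> 1 + n\<^sup>2" using n by linarith
    qed (simp add: g_def)
    finally have "\<bar>W x - W e0\<bar> \<le> g * (1 + n\<^sup>2) + L * n\<^sup>2" by simp
    moreover have "\<bar>W e0\<bar> \<le> \<bar>W e0\<bar> * (1 + n\<^sup>2)" by (simp add: distrib_left)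
    moreover have "L * n\<^sup>2 \<le> L * (1 + n\<^sup>2)" using L by (intro mult_left_mono) auto
    ultimately have "\<bar>W x\<bar> \<le> \<bar>W e0\<bar> * (1 + n\<^sup>2) + g * (1 + n\<^sup>2) + L * (1 + n\<^sup>2)" by linarith
    then show ?thesis by (simp add: c_def n_def distrib_right)
  qed
  moreover have "c \<ge> 0" using L by (simp add: c_def g_def)
  ultimately show ?thesis using that by blast
qed

lemma vnorm_vdiff_sq_le: "(vnorm d (vdiff d x y))\<^sup>2 \<le> 2 * (vnorm d x)\<^sup>2 + 2 * (vnorm d y)\<^sup>2"
proof -
  have "(x i - y i)\<^sup>2 \<le> 2 * (x i)\<^sup>2 + 2 * (y i)\<^sup>2" for i
    using zero_le_power2[of "x i + y i"] by (simp add: power2_diff power2_sum)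
  then have "(\<Sum>i<d. (x i - y i)\<^sup>2) \<le> (\<Sum>i<d. 2 * (x i)\<^sup>2 + 2 * (y i)\<^sup>2)" by (intro sum_mono)
  then show ?thesis unfolding vnorm_vdiff vnorm_sq by (simp add: sum.distrib sum_distrib_left)
qed

context interaction
begin

definition Wbar :: "(nat \<Rightarrow> real) \<Rightarrow> real" where
  "Wbar x = (\<integral>y. W (vdiff d x y) \<partial>\<pi>)"

lemma integrable_W:
  assumes a: "a \<in> Rn d"
  shows "integrable \<pi> (\<lambda>y. W (vdiff d a y))"
proof -
  interpret pi: prob_space \<pi> by (rule prob)
  obtain c where c: "c \<ge> 0" "\<And>x. x \<in> Rn d \<Longrightarrow> \<bar>W x\<bar> \<le> c * (1 + (vnorm d x)\<^sup>2)"
    using lipschitz_gradient_growth[OF W_grad G_lip] L_pos by (metis less_imp_le)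
  have "integrable \<pi> (\<lambda>y. c * (1 + (2 * (vnorm d a)\<^sup>2 + 2 * (vnorm d y)\<^sup>2)))"
    using integrable_moment by simp
  then show ?thesis
  proof (rule Bochner_Integration.integrable_bound)
    have "(\<lambda>y. W (vdiff d a y)) \<in> borel_measurable (leb d)"
      by (rule measurable_compose[OF measurable_vdiff_pi[OF a] W_meas])
    then show "(\<lambda>y. W (vdiff d a y)) \<in> borel_measurable \<pi>" by (simp cong: measurable_cong_sets)
    have "\<bar>W (vdiff d a y)\<bar> \<le> c * (1 + (2 * (vnorm d a)\<^sup>2 + 2 * (vnorm d y)\<^sup>2))" for y
    proof -
      have "\<bar>W (vdiff d a y)\<bar> \<le> c * (1 + (vnorm d (vdiff d a y))\<^sup>2)" by (rule c(2)) simp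
      also have "\<dots> \<le> c * (1 + (2 * (vnorm d a)\<^sup>2 + 2 * (vnorm d y)\<^sup>2))"
        using c(1) vnorm_vdiff_sq_le by (intro mult_left_mono add_left_mono)
      finally show ?thesis .
    qed
    then show "AE y in \<pi>. norm (W (vdiff d a y)) \<le> norm (c * (1 + (2 * (vnorm d a)\<^sup>2 + 2 * (vnorm d y)\<^sup>2)))"
      by (intro AE_I2) (auto intro: order_trans[OF _ abs_ge_self])
  qed
qed

lemma G_coord_lip:
  assumes c: "c \<in> Rn d" and i: "i < d"
  shows "\<bar>G (c(i := s)) i - G (c(i := t)) i\<bar> \<le> L * \<bar>s - t\<bar>"
proof -
  let ?x = "c(i := s)" and ?y = "c(i := t)"
  have v: "vnorm d (vdiff d ?x ?y) = \<bar>s - t\<bar>"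
  proof -
    have "vnorm d (vdiff d ?x ?y) = vnorm d (\<lambda>j. (s - t) * (if j = i then 1 else 0))"
      unfolding vnorm_vdiff by (rule vnorm_cong) auto
    also have "\<dots> = \<bar>s - t\<bar> * vnorm d (\<lambda>j. if j = i then 1 else 0)" by (rule vnorm_scale)
    also have "vnorm d (\<lambda>j. if j = i then 1 else 0) = 1"
    proof -
      have "(vnorm d (\<lambda>j. if j = i then 1 else 0))\<^sup>2 = (\<Sum>j<d. if j = i then 1 else 0)"
        unfolding vnorm_sq by (intro sum.cong) auto
      also have "\<dots> = 1\<^sup>2" using i by simp
      finally show ?thesis by (simp only: power2_eq_iff_nonneg vnorm_nonneg zero_le_one)
    qed
    finally show ?thesis by (simp only: mult_1_right)
  qed
  have "\<bar>G ?x i - G ?y i\<bar> \<le> vnorm d (\<lambda>j. G ?x j - G ?y j)"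
    by (rule abs_coord_le_vnorm[OF i, of "\<lambda>j. G ?x j - G ?y j"])
  also have "\<dots> \<le> L * vnorm d (vdiff d ?x ?y)"
    using G_lip[OF upd_in_Rn[OF c i] upd_in_Rn[OF c i]] unfolding vnorm_vdiff[of d "G _"] .
  finally show ?thesis by (simp only: v)
qed

text \<open>
  The Lipschitz bound for the gradient makes the Taylor remainder of \<open>W\<close> quadratic, uniformly in
  space, so the derivative passes under the integral directly.
\<close>

lemma has_partials_Wbar: "has_partials d Wbar Gbar"
  unfolding has_partials_def
proof (intro ballI allI impI)
  fix x i t assume x: "x \<in> Rn d" and i: "i < d"
  interpret pi: prob_space \<pi> by (rule prob)
  define z where "z s = x(i := s)" for s
  have z: "z s \<in> Rn d" for s unfolding z_def by (rule upd_in_Rn[OF x i])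
  have vz: "vdiff d (z s) y = (vdiff d (z t) y)(i := s - y i)" for s y
    using i by (auto simp: z_def vdiff_def fun_eq_iff)
  have tay: "\<bar>W (vdiff d (z s) y) - W (vdiff d (z t) y) - (s - t) * G (vdiff d (z t) y) i\<bar> \<le> L * (s - t)\<^sup>2" for s y
  proof -
    define c where "c = vdiff d (z t) y"
    have c: "c \<in> Rn d" by (simp add: c_def)
    define h where "h r = W (c(i := r)) - r * G c i" for r
    have dh: "(h has_real_derivative G (c(i := r)) i - G c i) (at r)" for r
      unfolding h_def using has_gradient_coord[OF W_grad c i] by (auto intro!: derivative_eq_intros)
    have ct: "c(i := t - y i) = c" using i by (auto simp: c_def vdiff_def z_def)
    have mono: "\<bar>h b - h a\<bar> \<le> L * (b - a)\<^sup>2"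
      if ab: "a < b" and e: "t - y i \<in> {a, b}" for a b
    proof -
      have "\<exists>r>a. r < b \<and> h b - h a = (b - a) * (G (c(i := r)) i - G c i)"
        by (intro MVT2 ab dh)
      then obtain r where r: "a < r" "r < b" and eq: "h b - h a = (b - a) * (G (c(i := r)) i - G c i)" by blast
      have "\<bar>G (c(i := r)) i - G c i\<bar> \<le> L * \<bar>r - (t - y i)\<bar>"
        using G_coord_lip[OF c i, of r "t - y i"] by (simp only: ct)
      also have "\<dots> \<le> L * (b - a)" using r e L_pos by (intro mult_left_mono) auto
      finally have "(b - a) * \<bar>G (c(i := r)) i - G c i\<bar> \<le> (b - a) * (L * (b - a))"
        using ab by (intro mult_left_mono) auto
      then show ?thesis unfolding eq using ab by (simp add: abs_mult power2_eq_square mult_ac)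
    qed
    have "\<bar>h (s - y i) - h (t - y i)\<bar> \<le> L * (s - t)\<^sup>2"
    proof (cases s t rule: linorder_cases)
      case less
      then show ?thesis using mono[of "s - y i" "t - y i"] by (simp add: abs_minus_commute power2_commute)
    next
      case greater
      then show ?thesis using mono[of "t - y i" "s - y i"] by simp
    qed simp
    moreover have "h (s - y i) - h (t - y i) = W (vdiff d (z s) y) - W (vdiff d (z t) y) - (s - t) * G (vdiff d (z t) y) i"
      unfolding vz[of s] h_def ct c_def[symmetric] by (simp add: algebra_simps)
    ultimately show ?thesis by simp
  qed
  have main: "\<bar>Wbar (z s) - Wbar (z t) - (s - t) * Gbar (z t) i\<bar> \<le> L * (s - t)\<^sup>2" for s
  proof -
    note i1 = integrable_W[OF z] and i2 = integrable_G[OF z i]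
    have int: "integrable \<pi> (\<lambda>y. W (vdiff d (z s) y) - W (vdiff d (z t) y) - (s - t) * G (vdiff d (z t) y) i)"
      using i1 i2 by (intro Bochner_Integration.integrable_diff integrable_mult_right)
    define T where "T y = W (vdiff d (z s) y) - W (vdiff d (z t) y) - (s - t) * G (vdiff d (z t) y) i" for y
    have iT: "integrable \<pi> T" unfolding T_def by (rule int)
    have "Wbar (z s) - Wbar (z t) - (s - t) * Gbar (z t) i = (\<integral>y. T y \<partial>\<pi>)"
      unfolding Wbar_def Gbar_def T_def using i1 i2 by simp
    moreover have "\<bar>\<integral>y. T y \<partial>\<pi>\<bar> \<le> (\<integral>y. \<bar>T y\<bar> \<partial>\<pi>)" by (rule integral_abs_bound)
    moreover have "(\<integral>y. \<bar>T y\<bar> \<partial>\<pi>) \<le> (\<integral>y. L * (s - t)\<^sup>2 \<partial>\<pi>)"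
      using integrable_abs[OF iT] by (rule integral_mono) (simp_all add: T_def tay)
    moreover have "(\<integral>y. L * (s - t)\<^sup>2 \<partial>\<pi>) = L * (s - t)\<^sup>2" by (simp add: pi.prob_space[simplified])
    ultimately show ?thesis by linarith
  qed
  have "((\<lambda>s. (Wbar (z s) - Wbar (z t)) / (s - t) - Gbar (z t) i) \<longlongrightarrow> 0) (at t)"
  proof (rule Lim_null_comparison)
    have "norm ((Wbar (z s) - Wbar (z t)) / (s - t) - Gbar (z t) i) \<le> L * \<bar>s - t\<bar>" if "s \<noteq> t" for s
    proof -
      have "(Wbar (z s) - Wbar (z t)) / (s - t) - Gbar (z t) i
        = (Wbar (z s) - Wbar (z t) - (s - t) * Gbar (z t) i) / (s - t)"
        using that by (simp add: diff_divide_distrib)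
      also have "norm \<dots> \<le> L * (s - t)\<^sup>2 / \<bar>s - t\<bar>"
        using main[of s] by (simp add: divide_right_mono)
      also have "\<dots> = L * \<bar>s - t\<bar>" 
      proof -
        have "(s - t)\<^sup>2 = \<bar>s - t\<bar> * \<bar>s - t\<bar>" by (simp add: power2_eq_square)
        then show ?thesis using that by (simp del: abs_mult_self_eq)
      qed
      finally show ?thesis .
    qed
    then show "\<forall>\<^sub>F s in at t. norm ((Wbar (z s) - Wbar (z t)) / (s - t) - Gbar (z t) i) \<le> L * \<bar>s - t\<bar>"
      by (auto simp: eventually_at_filter)
    have "((\<lambda>s. L * \<bar>s - t\<bar>) \<longlongrightarrow> L * \<bar>t - t\<bar>) (at t)" by (intro tendsto_intros)
    then show "((\<lambda>s. L * \<bar>s - t\<bar>) \<longlongrightarrow> 0) (at t)" by simp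
  qed
  then have "((\<lambda>s. (Wbar (z s) - Wbar (z t)) / (s - t)) \<longlongrightarrow> Gbar (z t) i) (at t)"
    by (simp add: LIM_zero_iff)
  then show "((\<lambda>s. Wbar (x(i := s))) has_real_derivative Gbar (x(i := t)) i) (at t)"
    unfolding has_field_derivative_iff z_def .
qed

text \<open>
  The deviation averages differences of \<open>\<nabla>W(a - y)\<close> in \<open>y\<close> at the same \<open>a\<close>, so the bound is uniform in \<open>a\<close>.
\<close>

lemma abs_dev_le:
  assumes a: "a \<in> Rn d" and y: "y \<in> Rn d" and i: "i < d"
  shows "\<bar>dev a y i\<bar> \<le> L * (vnorm d y + (\<integral>z. vnorm d z \<partial>\<pi>))"
proof -
  interpret pi: prob_space \<pi> by (rule prob)
  have "dev a y i = (\<integral>z. G (vdiff d a y) i - G (vdiff d a z) i \<partial>\<pi>)"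
    unfolding dev_def Gbar_def using integrable_G[OF a i] by (simp add: pi.prob_space[simplified])
  also have "\<bar>\<dots>\<bar> \<le> (\<integral>z. \<bar>G (vdiff d a y) i - G (vdiff d a z) i\<bar> \<partial>\<pi>)" by (rule integral_abs_bound)
  also have "\<dots> \<le> (\<integral>z. L * (vnorm d y + vnorm d z) \<partial>\<pi>)"
  proof (rule integral_mono)
    show "integrable \<pi> (\<lambda>z. \<bar>G (vdiff d a y) i - G (vdiff d a z) i\<bar>)"
      using integrable_G[OF a i] by simp
    show "integrable \<pi> (\<lambda>z. L * (vnorm d y + vnorm d z))" using integrable_vnorm by simp
    fix z
    have "\<bar>G (vdiff d a y) i - G (vdiff d a z) i\<bar> \<le> vnorm d (vdiff d (G (vdiff d a y)) (G (vdiff d a z)))"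
      unfolding vnorm_vdiff by (rule abs_coord_le_vnorm[OF i, of "\<lambda>i. G (vdiff d a y) i - G (vdiff d a z) i"])
    also have "\<dots> \<le> L * vnorm d (vdiff d (vdiff d a y) (vdiff d a z))" by (rule G_lip) auto
    also have "vnorm d (vdiff d (vdiff d a y) (vdiff d a z)) = vnorm d (vdiff d z y)"
      unfolding vnorm_vdiff by (rule vnorm_cong) (simp add: vdiff_apply)
    also have "L * vnorm d (vdiff d z y) \<le> L * (vnorm d y + vnorm d z)"
      using vnorm_vdiff_le[of z y] L_pos by simp
    finally show "\<bar>G (vdiff d a y) i - G (vdiff d a z) i\<bar> \<le> L * (vnorm d y + vnorm d z)" .
  qed
  also have "\<dots> = L * (vnorm d y + (\<integral>z. vnorm d z \<partial>\<pi>))"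
    using integrable_vnorm by (simp add: pi.prob_space[simplified])
  finally show ?thesis .
qed

end


section \<open>Resampling coordinates of a product measure\<close>

text \<open>
  Conditioning on the coordinates below \<open>k\<close> is expressed by resampling the others: if \<open>x\<close> and \<open>y\<close> are independent with
  law \<open>P\<close>, then \<open>cut k x y\<close>, which follows \<open>x\<close> below \<open>k\<close> and \<open>y\<close> from \<open>k\<close> on, again has law \<open>P\<close>, and integrating over \<open>y\<close> is
  the conditional expectation given the coordinates of \<open>x\<close> below \<open>k\<close>. In this way all functions live on the one space \<open>P\<close>,
  whatever the number of coordinates that they depend on.
\<close>

locale iid =
  fixes M :: "'a measure" and N :: nat
  assumes prob_M: "prob_space M"
begin

definition P :: "(nat \<Rightarrow> 'a) measure" where
  "P = PiM {..<N} (\<lambda>_. M)"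

definition cut :: "nat \<Rightarrow> (nat \<Rightarrow> 'a) \<Rightarrow> (nat \<Rightarrow> 'a) \<Rightarrow> nat \<Rightarrow> 'a" where
  "cut k x y = (\<lambda>i\<in>{..<N}. if i < k then x i else y i)"

definition reindex :: "(nat \<Rightarrow> nat) \<Rightarrow> (nat \<Rightarrow> 'a) \<Rightarrow> nat \<Rightarrow> 'a" where
  "reindex \<tau> x = (\<lambda>i\<in>{..<N}. x (\<tau> i))"

sublocale M: prob_space M by (rule prob_M)

sublocale PM: product_prob_space "\<lambda>_::nat. M" by (intro product_prob_spaceI prob_M)

sublocale P: prob_space P
  unfolding P_def by (rule prob_space_PiM) (rule prob_M)

sublocale PP: pair_sigma_finite P P ..

sublocale PM2: pair_sigma_finite P M ..

sublocale MP: pair_sigma_finite M P ..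

lemma space_P: "space P = PiE {..<N} (\<lambda>_. space M)"
  by (simp add: P_def space_PiM)

lemma coord_in_space: "x \<in> space P \<Longrightarrow> i < N \<Longrightarrow> x i \<in> space M"
  by (auto simp: space_P)

lemma measurable_coord [measurable]: "i < N \<Longrightarrow> (\<lambda>x. x i) \<in> measurable P M"
  unfolding P_def by (intro measurable_component_singleton) simp

lemma measurable_into_P:
  assumes "\<And>i. i < N \<Longrightarrow> (\<lambda>x. f x i) \<in> measurable S M" "\<And>x. x \<in> space S \<Longrightarrow> f x \<in> extensional {..<N}"
  shows "f \<in> measurable S P"
  unfolding P_def using assms
  by (intro measurable_PiM_single') (auto simp: PiE_def Pi_def dest: measurable_space)

lemma measurable_cut: "(\<lambda>(x, y). cut k x y) \<in> measurable (P \<Otimes>\<^sub>M P) P"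
proof (rule measurable_into_P)
  fix i assume i: "i < N"
  show "(\<lambda>w. (case w of (x, y) \<Rightarrow> cut k x y) i) \<in> measurable (P \<Otimes>\<^sub>M P) M"
    using measurable_compose[OF measurable_fst measurable_coord[OF i], of P]
      measurable_compose[OF measurable_snd measurable_coord[OF i], of P]
    by (cases "i < k") (simp_all add: cut_def split_beta' i)
qed (auto simp: cut_def)

lemma measurable_upd:
  assumes k: "k < N"
  shows "(\<lambda>(x, z). x(k := z)) \<in> measurable (P \<Otimes>\<^sub>M M) P"
proof (rule measurable_into_P)
  fix i assume i: "i < N"
  show "(\<lambda>w. (case w of (x, z) \<Rightarrow> x(k := z)) i) \<in> measurable (P \<Otimes>\<^sub>M M) M"
    using measurable_compose[OF measurable_fst measurable_coord[OF i], of M]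
    by (cases "i = k") (simp_all add: split_beta')
qed (use k in \<open>auto simp: space_pair_measure space_P PiE_def extensional_def\<close>)

lemma cut_in_space: "x \<in> space P \<Longrightarrow> y \<in> space P \<Longrightarrow> cut k x y \<in> space P"
proof -
  assume x: "x \<in> space P" and y: "y \<in> space P"
  have "(if i < k then x i else y i) \<in> space M" if "i < N" for i
    using coord_in_space[OF x that] coord_in_space[OF y that] by simp
  then show ?thesis unfolding space_P cut_def restrict_PiE_iff by simp
qed

lemma upd_in_space: "x \<in> space P \<Longrightarrow> z \<in> space M \<Longrightarrow> k < N \<Longrightarrow> x(k := z) \<in> space P"
  unfolding space_P PiE_iff extensional_def by simp

lemma cut_upd: "k < N \<Longrightarrow> cut (Suc k) (x(k := z)) y = (cut k x y)(k := z)"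
  by (auto simp: cut_def fun_eq_iff)

lemma cut_upd_right: "k \<le> j \<Longrightarrow> j < N \<Longrightarrow> cut k x (y(j := z)) = (cut k x y)(j := z)"
  by (auto simp: cut_def fun_eq_iff)

lemma cut_upd_left: "k \<le> j \<Longrightarrow> cut k (x(j := z)) y = cut k x y"
  by (auto simp: cut_def fun_eq_iff)

lemma emeasure_box:
  assumes "\<And>i. i < N \<Longrightarrow> A i \<in> sets M"
  shows "emeasure P (PiE {..<N} A) = (\<Prod>i<N. emeasure M (A i))"
  unfolding P_def using assms by (intro PM.emeasure_PiM) auto

lemma box_sets: "(\<And>i. i < N \<Longrightarrow> A i \<in> sets M) \<Longrightarrow> PiE {..<N} A \<in> sets P"
  unfolding P_def by (intro sets_PiM_I_finite) auto

lemma P_eqI: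
  assumes "sets Q = sets P"
    and "\<And>A. (\<And>i. i < N \<Longrightarrow> A i \<in> sets M) \<Longrightarrow> emeasure Q (PiE {..<N} A) = (\<Prod>i<N. emeasure M (A i))"
  shows "Q = P"
  using assms unfolding P_def by (intro PM.PiM_eqI) auto

lemma distr_cut: "distr (P \<Otimes>\<^sub>M P) P (\<lambda>(x, y). cut k x y) = P"
proof (rule P_eqI)
  fix A :: "nat \<Rightarrow> 'a set" assume A: "\<And>i. i < N \<Longrightarrow> A i \<in> sets M"
  define A1 where "A1 i = (if i < k then A i else space M)" for i
  define A2 where "A2 i = (if i < k then space M else A i)" for i
  have A12: "i < N \<Longrightarrow> A1 i \<in> sets M" "i < N \<Longrightarrow> A2 i \<in> sets M" for i
    using A by (auto simp: A1_def A2_def)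
  have sp: "i < N \<Longrightarrow> A i \<subseteq> space M" for i using A sets.sets_into_space by blast
  have "(\<lambda>(x, y). cut k x y) -` PiE {..<N} A \<inter> space (P \<Otimes>\<^sub>M P) = PiE {..<N} A1 \<times> PiE {..<N} A2"
  proof (rule set_eqI)
    fix w :: "(nat \<Rightarrow> 'a) \<times> (nat \<Rightarrow> 'a)"
    obtain x y where w: "w = (x, y)" by (cases w)
    show "w \<in> (\<lambda>(x, y). cut k x y) -` PiE {..<N} A \<inter> space (P \<Otimes>\<^sub>M P) \<longleftrightarrow> w \<in> PiE {..<N} A1 \<times> PiE {..<N} A2"
      unfolding w using sp
      by (auto simp: space_pair_measure space_P PiE_iff cut_def A1_def A2_def split: if_splits)
  qed
  then have "emeasure (distr (P \<Otimes>\<^sub>M P) P (\<lambda>(x, y). cut k x y)) (PiE {..<N} A)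
    = emeasure (P \<Otimes>\<^sub>M P) (PiE {..<N} A1 \<times> PiE {..<N} A2)"
    using A by (subst emeasure_distr[OF measurable_cut box_sets]) auto
  also have "\<dots> = (\<Prod>i<N. emeasure M (A1 i)) * (\<Prod>i<N. emeasure M (A2 i))"
    using A12 by (subst P.emeasure_pair_measure_Times) (auto simp: box_sets emeasure_box)
  also have "\<dots> = (\<Prod>i<N. emeasure M (A i))"
    unfolding prod.distrib[symmetric] by (intro prod.cong) (auto simp: A1_def A2_def M.emeasure_space_1)
  finally show "emeasure (distr (P \<Otimes>\<^sub>M P) P (\<lambda>(x, y). cut k x y)) (PiE {..<N} A) = (\<Prod>i<N. emeasure M (A i))" .
qed simp

lemma distr_upd:
  assumes k: "k < N"
  shows "distr (P \<Otimes>\<^sub>M M) P (\<lambda>(x, z). x(k := z)) = P"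
proof (rule P_eqI)
  fix A :: "nat \<Rightarrow> 'a set" assume A: "\<And>i. i < N \<Longrightarrow> A i \<in> sets M"
  define A1 where "A1 = A(k := space M)"
  have A1: "i < N \<Longrightarrow> A1 i \<in> sets M" for i using A by (auto simp: A1_def)
  have sp: "i < N \<Longrightarrow> A i \<subseteq> space M" for i using A sets.sets_into_space by blast
  have "(\<lambda>(x, z). x(k := z)) -` PiE {..<N} A \<inter> space (P \<Otimes>\<^sub>M M) = PiE {..<N} A1 \<times> A k"
  proof (rule set_eqI)
    fix w :: "(nat \<Rightarrow> 'a) \<times> 'a"
    obtain x z where w: "w = (x, z)" by (cases w)
    show "w \<in> (\<lambda>(x, z). x(k := z)) -` PiE {..<N} A \<inter> space (P \<Otimes>\<^sub>M M) \<longleftrightarrow> w \<in> PiE {..<N} A1 \<times> A k"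
      unfolding w using sp k
      by (auto simp: space_pair_measure space_P PiE_iff extensional_def A1_def split: if_splits)
  qed
  then have "emeasure (distr (P \<Otimes>\<^sub>M M) P (\<lambda>(x, z). x(k := z))) (PiE {..<N} A)
    = emeasure (P \<Otimes>\<^sub>M M) (PiE {..<N} A1 \<times> A k)"
    using A by (subst emeasure_distr[OF measurable_upd[OF k] box_sets]) auto
  also have "\<dots> = (\<Prod>i<N. emeasure M (A1 i)) * emeasure M (A k)"
    using A1 A[OF k] by (subst M.emeasure_pair_measure_Times) (auto simp: box_sets emeasure_box)
  also have "(\<Prod>i<N. emeasure M (A1 i)) = (\<Prod>i\<in>{..<N} - {k}. emeasure M (A i))"
    using k by (subst prod.remove[of _ k]) (auto simp: A1_def M.emeasure_space_1 intro!: prod.cong)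
  also have "\<dots> * emeasure M (A k) = (\<Prod>i<N. emeasure M (A i))"
    using k by (subst (2) prod.remove[of _ k]) (auto simp: mult.commute)
  finally show "emeasure (distr (P \<Otimes>\<^sub>M M) P (\<lambda>(x, z). x(k := z))) (PiE {..<N} A) = (\<Prod>i<N. emeasure M (A i))" .
qed simp

lemma distr_reindex:
  assumes "inj_on \<tau> {..<N}" "\<tau> ` {..<N} \<subseteq> {..<N}"
  shows "distr P P (reindex \<tau>) = P"
  using distr_PiM_reindex[of "{..<N}" "\<lambda>_. M" \<tau> "{..<N}"] assms prob_M
  by (auto simp: P_def reindex_def[abs_def] Pi_iff image_subset_iff)

lemma measurable_reindex:
  assumes "\<tau> ` {..<N} \<subseteq> {..<N}"
  shows "reindex \<tau> \<in> measurable P P"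
proof (rule measurable_into_P)
  fix i assume "i < N"
  then show "(\<lambda>x. reindex \<tau> x i) \<in> measurable P M"
    using assms measurable_coord[of "\<tau> i"] by (auto simp: reindex_def)
qed (simp add: reindex_def)

lemma nn_cut:
  assumes f: "f \<in> borel_measurable P"
  shows "(\<integral>\<^sup>+x. \<integral>\<^sup>+y. f (cut k x y) \<partial>P \<partial>P) = (\<integral>\<^sup>+x. f x \<partial>P)"
proof -
  have "(\<integral>\<^sup>+x. f x \<partial>P) = (\<integral>\<^sup>+w. f (case w of (x, y) \<Rightarrow> cut k x y) \<partial>(P \<Otimes>\<^sub>M P))"
    by (subst distr_cut[of k, symmetric], subst nn_integral_distr[OF measurable_cut])
      (simp_all add: f measurable_distr_eq1)
  also have "\<dots> = (\<integral>\<^sup>+x. \<integral>\<^sup>+y. f (cut k x y) \<partial>P \<partial>P)"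
    using P.nn_integral_fst[OF measurable_compose[OF measurable_cut f], of k] by simp
  finally show ?thesis ..
qed

lemma nn_upd:
  assumes f: "f \<in> borel_measurable P" and k: "k < N"
  shows "(\<integral>\<^sup>+x. \<integral>\<^sup>+z. f (x(k := z)) \<partial>M \<partial>P) = (\<integral>\<^sup>+x. f x \<partial>P)"
proof -
  have "(\<integral>\<^sup>+x. f x \<partial>P) = (\<integral>\<^sup>+w. f (case w of (x, z) \<Rightarrow> x(k := z)) \<partial>(P \<Otimes>\<^sub>M M))"
    by (subst distr_upd[OF k, symmetric], subst nn_integral_distr[OF measurable_upd[OF k]])
      (simp_all add: f measurable_distr_eq1)
  also have "\<dots> = (\<integral>\<^sup>+x. \<integral>\<^sup>+z. f (x(k := z)) \<partial>M \<partial>P)"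
    using M.nn_integral_fst[OF measurable_compose[OF measurable_upd[OF k] f]] by simp
  finally show ?thesis ..
qed

lemma integrable_cut_pair:
  fixes h :: "(nat \<Rightarrow> 'a) \<Rightarrow> real"
  assumes h: "integrable P h"
  shows "integrable (P \<Otimes>\<^sub>M P) (\<lambda>(x, y). h (cut k x y))"
    and "(\<integral>w. (case w of (x, y) \<Rightarrow> h (cut k x y)) \<partial>(P \<Otimes>\<^sub>M P)) = (\<integral>x. h x \<partial>P)"
proof -
  have hm: "h \<in> borel_measurable P" using h by auto
  have e: "(\<lambda>w. h (case w of (x, y) \<Rightarrow> cut k x y)) = (\<lambda>(x, y). h (cut k x y))" by auto
  show "integrable (P \<Otimes>\<^sub>M P) (\<lambda>(x, y). h (cut k x y))"
    using integrable_distr_eq[OF measurable_cut hm, of k] h unfolding distr_cut e by simp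
  show "(\<integral>w. (case w of (x, y) \<Rightarrow> h (cut k x y)) \<partial>(P \<Otimes>\<^sub>M P)) = (\<integral>x. h x \<partial>P)"
    using integral_distr[OF measurable_cut hm, of k] unfolding distr_cut e by simp
qed

lemma AE_integrable_cut:
  fixes h :: "(nat \<Rightarrow> 'a) \<Rightarrow> real"
  assumes "integrable P h"
  shows "AE x in P. integrable P (\<lambda>y. h (cut k x y))"
  using PP.AE_integrable_fst'[OF integrable_cut_pair(1)[OF assms]] by simp

lemma integral_cut:
  fixes h :: "(nat \<Rightarrow> 'a) \<Rightarrow> real"
  assumes "integrable P h"
  shows "integrable P (\<lambda>x. \<integral>y. h (cut k x y) \<partial>P)" "(\<integral>x. \<integral>y. h (cut k x y) \<partial>P \<partial>P) = (\<integral>x. h x \<partial>P)"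
  using PP.integrable_fst'[OF integrable_cut_pair(1)[OF assms]]
    PP.integral_fst'[OF integrable_cut_pair(1)[OF assms]] integrable_cut_pair(2)[OF assms] by simp_all

lemma integral_upd:
  fixes h :: "(nat \<Rightarrow> 'a) \<Rightarrow> real"
  assumes h: "integrable P h" and k: "k < N"
  shows "(\<integral>z. \<integral>x. h (x(k := z)) \<partial>P \<partial>M) = (\<integral>x. h x \<partial>P)"
proof -
  have hm: "h \<in> borel_measurable P" using h by auto
  have e: "(\<lambda>w. h (case w of (x, z) \<Rightarrow> x(k := z))) = (\<lambda>(x, z). h (x(k := z)))" by auto
  have i: "integrable (P \<Otimes>\<^sub>M M) (\<lambda>(x, z). h (x(k := z)))"
    using integrable_distr_eq[OF measurable_upd[OF k] hm] h unfolding distr_upd[OF k] e by simp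
  have "(\<integral>x. h x \<partial>P) = (\<integral>w. (case w of (x, z) \<Rightarrow> h (x(k := z))) \<partial>(P \<Otimes>\<^sub>M M))"
    using integral_distr[OF measurable_upd[OF k] hm] unfolding distr_upd[OF k] e by simp
  also have "\<dots> = (\<integral>z. \<integral>x. h (x(k := z)) \<partial>P \<partial>M)"
    using PM2.integral_snd[OF i] by simp
  finally show ?thesis ..
qed

text \<open>
  Past, present and future: \<open>x\<close> carries the coordinates below \<open>k\<close>, \<open>z\<close> the coordinate \<open>k\<close>, and \<open>y\<close> the rest.
  For almost every past this provides the joint integrability that \<open>lsi_mixture\<close> asks for.
\<close>

lemma AE_integrable_cut_upd:
  fixes h :: "(nat \<Rightarrow> 'a) \<Rightarrow> real"
  assumes h: "integrable P h" and k: "k < N"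
  shows "AE x in P. integrable (M \<Otimes>\<^sub>M P) (\<lambda>(z, y). h ((cut k x y)(k := z)))"
proof -
  have hm[measurable]: "h \<in> borel_measurable P" using h by auto
  note [measurable] = measurable_cut measurable_upd[OF k]
  define u where "u X = (\<integral>\<^sup>+z. ennreal \<bar>h (X(k := z))\<bar> \<partial>M)" for X
  have m0: "(\<lambda>(X, z). ennreal \<bar>h (X(k := z))\<bar>) \<in> borel_measurable (P \<Otimes>\<^sub>M M)"
    using measurable_compose[OF measurable_upd[OF k] hm] by (simp add: split_beta')
  have um: "u \<in> borel_measurable P"
    unfolding u_def using M.borel_measurable_nn_integral_fst[OF m0] by simp
  have m1: "(\<lambda>(x, y). u (cut k x y)) \<in> borel_measurable (P \<Otimes>\<^sub>M P)"
    using measurable_compose[OF measurable_cut um] by (simp add: split_beta')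
  have "(\<integral>\<^sup>+x. \<integral>\<^sup>+y. u (cut k x y) \<partial>P \<partial>P) = (\<integral>\<^sup>+X. u X \<partial>P)" by (rule nn_cut[OF um])
  also have "\<dots> = (\<integral>\<^sup>+X. ennreal \<bar>h X\<bar> \<partial>P)"
    unfolding u_def by (rule nn_upd[OF _ k]) measurable
  also have "\<dots> \<noteq> \<infinity>" using h by (simp add: integrable_iff_bounded less_top)
  finally have fin: "(\<integral>\<^sup>+x. \<integral>\<^sup>+y. u (cut k x y) \<partial>P \<partial>P) \<noteq> \<infinity>" .
  have "AE x in P. (\<integral>\<^sup>+y. u (cut k x y) \<partial>P) \<noteq> \<infinity>"
    by (rule nn_integral_PInf_AE[OF _ fin]) (use P.borel_measurable_nn_integral_fst[OF m1] in simp)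
  then show ?thesis
    using AE_space
  proof eventually_elim
    case (elim x)
    have c: "(\<lambda>y. cut k x y) \<in> measurable P P"
      using measurable_Pair2[OF measurable_cut elim(2), of k] by simp
    have "(\<lambda>(z, y). (cut k x y)(k := z)) \<in> measurable (M \<Otimes>\<^sub>M P) P"
    proof -
      have "(\<lambda>w. (cut k x (snd w), fst w)) \<in> measurable (M \<Otimes>\<^sub>M P) (P \<Otimes>\<^sub>M M)"
        by (intro measurable_Pair measurable_compose[OF measurable_snd c] measurable_fst)
      from measurable_compose[OF this measurable_upd[OF k]] show ?thesis by (simp add: split_beta')
    qed
    from measurable_compose[OF this hm]
    have m: "(\<lambda>(z, y). h ((cut k x y)(k := z))) \<in> borel_measurable (M \<Otimes>\<^sub>M P)" by (simp add: split_beta')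
    have "(\<integral>\<^sup>+w. ennreal (norm (case w of (z, y) \<Rightarrow> h ((cut k x y)(k := z)))) \<partial>(M \<Otimes>\<^sub>M P))
      = (\<integral>\<^sup>+y. \<integral>\<^sup>+z. ennreal \<bar>h ((cut k x y)(k := z))\<bar> \<partial>M \<partial>P)"
      by (subst MP.nn_integral_snd[symmetric]) (use m in \<open>auto simp: split_beta'\<close>)
    also have "\<dots> < \<infinity>" using elim(1) by (simp add: u_def less_top)
    finally show ?case using m by (simp add: integrable_iff_bounded)
  qed
qed

end


section \<open>Conditional densities and the chain rule for the entropy\<close>

locale iid_density = iid +
  fixes r :: "(nat \<Rightarrow> 'a) \<Rightarrow> real"
  assumes r_pos: "\<And>x. x \<in> space P \<Longrightarrow> 0 < r x"
    and r_integrable: "integrable P r" and r_mass: "(\<integral>x. r x \<partial>P) = 1"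
begin

lemma r_meas [measurable]: "r \<in> borel_measurable P"
  using r_integrable by auto

text \<open>
  The marginal density of the first \<open>k\<close> coordinates under \<open>r \<cdot> P\<close>, kept as a function on all of \<open>P\<close> that ignores the other
  coordinates. As a Bochner integral it is 0 on the null set where \<open>r\<close> is not integrable in the future coordinates.
\<close>

definition R :: "nat \<Rightarrow> (nat \<Rightarrow> 'a) \<Rightarrow> real" where
  "R k x = (\<integral>y. r (cut k x y) \<partial>P)"

text \<open>
  The expected relative entropy, with respect to \<open>M\<close>, of the conditional law of coordinate \<open>k\<close> given the earlier ones. Its
  density is \<open>R (Suc k) / R k\<close>; multiplied by the density \<open>R k\<close> of the conditions, the entropy integrand becomes
  \<open>ent (R (Suc k)) (R k)\<close>.
\<close>

definition D :: "nat \<Rightarrow> ennreal" where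
  "D k = (\<integral>\<^sup>+x. ennreal (ent (R (Suc k) x) (R k x)) \<partial>P)"

lemma R_meas [measurable]: "R k \<in> borel_measurable P"
proof -
  have "(\<lambda>(x, y). r (cut k x y)) \<in> borel_measurable (P \<Otimes>\<^sub>M P)"
    using measurable_compose[OF measurable_cut r_meas] by (simp add: split_beta')
  from P.borel_measurable_lebesgue_integral[OF this] show ?thesis by (simp add: R_def[abs_def])
qed

lemma R_nonneg: "x \<in> space P \<Longrightarrow> 0 \<le> R k x"
  unfolding R_def
  by (rule Bochner_Integration.integral_nonneg) (auto intro: less_imp_le r_pos cut_in_space)

lemma R_upd: "k \<le> j \<Longrightarrow> R k (x(j := z)) = R k x"
  by (simp add: R_def cut_upd_left)

lemma R_cut: "R k (cut k x y) = R k x"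
proof -
  have "cut k (cut k x y) y' = cut k x y'" for y' by (auto simp: cut_def fun_eq_iff)
  then show ?thesis by (simp add: R_def)
qed

lemma R_Suc_upd: "k < N \<Longrightarrow> R (Suc k) (x(k := z)) = (\<integral>y. r ((cut k x y)(k := z)) \<partial>P)"
  by (simp add: R_def cut_upd)

lemma AE_R_integrable: "AE x in P. integrable P (\<lambda>y. r (cut k x y))"
  by (rule AE_integrable_cut[OF r_integrable])

lemma AE_R_pos: "AE x in P. 0 < R k x"
  using AE_R_integrable[of k] AE_space
proof eventually_elim
  case (elim x)
  have pos: "0 < r (cut k x y)" if "y \<in> space P" for y using elim(2) that by (intro r_pos cut_in_space)
  have "R k x \<noteq> 0"
  proof
    assume "R k x = 0"
    then have "AE y in P. r (cut k x y) = 0"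
      unfolding R_def using elim(1) pos
      by (subst integral_nonneg_eq_0_iff_AE[symmetric]) (auto intro!: AE_I2 less_imp_le)
    then have "AE y in P. False"
      using AE_space by eventually_elim (use pos in force)
    then show False by simp
  qed
  then show ?case using R_nonneg[OF elim(2), of k] by simp
qed

lemma AE_R_ennreal: "AE x in P. ennreal (R k x) = (\<integral>\<^sup>+y. ennreal (r (cut k x y)) \<partial>P)"
  using AE_R_integrable[of k] AE_space
proof eventually_elim
  case (elim x)
  have "0 \<le> r (cut k x y)" if "y \<in> space P" for y
    using elim(2) that by (intro less_imp_le r_pos cut_in_space)
  then show ?case unfolding R_def using elim(1) by (intro nn_integral_eq_integral[symmetric]) auto
qed

text \<open>Resampling the coordinates from \<open>k\<close> on fixes \<open>h\<close> and averages \<open>r\<close> to \<open>R k\<close>.\<close>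

lemma nn_tower:
  assumes h[measurable]: "h \<in> borel_measurable P"
    and hc: "\<And>x y. x \<in> space P \<Longrightarrow> y \<in> space P \<Longrightarrow> h (cut k x y) = h x"
  shows "(\<integral>\<^sup>+x. h x * ennreal (r x) \<partial>P) = (\<integral>\<^sup>+x. h x * ennreal (R k x) \<partial>P)"
proof -
  have "(\<integral>\<^sup>+x. h x * ennreal (r x) \<partial>P) = (\<integral>\<^sup>+x. \<integral>\<^sup>+y. h (cut k x y) * ennreal (r (cut k x y)) \<partial>P \<partial>P)"
    by (rule nn_cut[symmetric]) measurable
  also have "\<dots> = (\<integral>\<^sup>+x. h x * (\<integral>\<^sup>+y. ennreal (r (cut k x y)) \<partial>P) \<partial>P)"
  proof (rule nn_integral_cong)
    fix x assume x: "x \<in> space P"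
    have m: "(\<lambda>y. ennreal (r (cut k x y))) \<in> borel_measurable P"
      using measurable_compose[OF measurable_Pair2[OF measurable_cut x] r_meas, of k] by simp
    have "(\<integral>\<^sup>+y. h (cut k x y) * ennreal (r (cut k x y)) \<partial>P) = (\<integral>\<^sup>+y. h x * ennreal (r (cut k x y)) \<partial>P)"
      using hc[OF x] by (intro nn_integral_cong) simp
    also have "\<dots> = h x * (\<integral>\<^sup>+y. ennreal (r (cut k x y)) \<partial>P)" by (rule nn_integral_cmult[OF m])
    finally show "(\<integral>\<^sup>+y. h (cut k x y) * ennreal (r (cut k x y)) \<partial>P) = h x * (\<integral>\<^sup>+y. ennreal (r (cut k x y)) \<partial>P)" .
  qed
  also have "\<dots> = (\<integral>\<^sup>+x. h x * ennreal (R k x) \<partial>P)"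
    using AE_R_ennreal[of k] by (intro nn_integral_cong_AE) auto
  finally show ?thesis .
qed

lemma integral_tower:
  fixes h :: "(nat \<Rightarrow> 'a) \<Rightarrow> real"
  assumes h[measurable]: "h \<in> borel_measurable P"
    and hc: "\<And>x y. x \<in> space P \<Longrightarrow> y \<in> space P \<Longrightarrow> h (cut k x y) = h x"
    and i: "integrable P (\<lambda>x. h x * R k x)"
  shows "integrable P (\<lambda>x. h x * r x)" "(\<integral>x. h x * r x \<partial>P) = (\<integral>x. h x * R k x \<partial>P)"
proof -
  have n: "(\<integral>\<^sup>+x. ennreal (norm (h x * g x)) \<partial>P) = (\<integral>\<^sup>+x. ennreal \<bar>h x\<bar> * ennreal (g x) \<partial>P)"
    if "\<And>x. x \<in> space P \<Longrightarrow> 0 \<le> g x" for g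
    using that by (intro nn_integral_cong) (simp add: abs_mult ennreal_mult)
  have n1: "(\<integral>\<^sup>+x. ennreal (norm (h x * r x)) \<partial>P) = (\<integral>\<^sup>+x. ennreal \<bar>h x\<bar> * ennreal (r x) \<partial>P)"
    by (rule n) (rule less_imp_le[OF r_pos])
  have n2: "(\<integral>\<^sup>+x. ennreal (norm (h x * R k x)) \<partial>P) = (\<integral>\<^sup>+x. ennreal \<bar>h x\<bar> * ennreal (R k x) \<partial>P)"
    by (rule n) (rule R_nonneg)
  have "(\<integral>\<^sup>+x. ennreal (norm (h x * r x)) \<partial>P) = (\<integral>\<^sup>+x. ennreal (norm (h x * R k x)) \<partial>P)"
    unfolding n1 n2 by (rule nn_tower) (simp_all add: hc)
  then show hr: "integrable P (\<lambda>x. h x * r x)" using i by (simp add: integrable_iff_bounded)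
  have "(\<integral>x. h x * r x \<partial>P) = (\<integral>x. \<integral>y. h (cut k x y) * r (cut k x y) \<partial>P \<partial>P)"
    using integral_cut(2)[OF hr, of k] by simp
  also have "\<dots> = (\<integral>x. h x * R k x \<partial>P)"
    unfolding R_def integral_mult_right_zero[symmetric]
    by (intro Bochner_Integration.integral_cong refl) (simp add: hc)
  finally show "(\<integral>x. h x * r x \<partial>P) = (\<integral>x. h x * R k x \<partial>P)" .
qed

lemma integrable_R: "integrable P (R k)" "(\<integral>x. R k x \<partial>P) = 1"
  using integral_cut[OF r_integrable, of k] r_mass by (simp_all add: R_def[abs_def])

lemma integral_R_fibre:
  assumes k: "k < N" and i: "integrable P (\<lambda>y. r (cut k x y))"
  shows "(\<integral>z. R (Suc k) (x(k := z)) \<partial>M) = R k x"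
  using integral_upd[OF i k] by (simp only: cut_upd_right[OF order_refl k] R_Suc_upd[OF k]) (simp only: R_def)

lemma AE_R_fibre:
  assumes k: "k < N"
  shows "AE x in P. integrable M (\<lambda>z. R (Suc k) (x(k := z))) \<and> (\<integral>z. R (Suc k) (x(k := z)) \<partial>M) = R k x"
  using AE_R_integrable[of k] AE_integrable_cut_upd[OF r_integrable k]
proof eventually_elim
  case (elim x)
  show ?case
    using MP.integrable_fst[OF elim(2)] integral_R_fibre[OF k elim(1)] by (simp add: R_Suc_upd[OF k])
qed

lemma D_fibre:
  assumes k: "k < N"
  shows "D k = (\<integral>\<^sup>+x. \<integral>\<^sup>+z. ennreal (ent (R (Suc k) (x(k := z))) (R k x)) \<partial>M \<partial>P)"
  unfolding D_def
  by (subst nn_upd[symmetric, OF _ k]) (simp_all add: R_upd)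

lemma R_0: "R 0 x = 1"
proof -
  have "cut 0 x y = y" if "y \<in> space P" for y
    using that by (auto simp: cut_def space_P fun_eq_iff PiE_iff extensional_def)
  then have "R 0 x = (\<integral>y. r y \<partial>P)"
    unfolding R_def by (intro Bochner_Integration.integral_cong) auto
  then show ?thesis by (simp add: r_mass)
qed

text \<open>
  \<open>R (Suc k) ln (R (Suc k))\<close> splits into the integrand of \<open>D k\<close> and \<open>R (Suc k) ln (R k)\<close>, whose integral is that of
  \<open>R k ln (R k)\<close> because \<open>ln (R k)\<close> ignores coordinate \<open>k\<close>. The summands are integrable only once all \<open>D j\<close> are known to be
  finite.
\<close>

lemma entropy_chain_rule:
  assumes fin: "\<And>j. j < k \<Longrightarrow> D j = ennreal (\<delta> j)" and \<delta>: "\<And>j. j < k \<Longrightarrow> 0 \<le> \<delta> j" and k: "k \<le> N"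
  shows "integrable P (\<lambda>x. R k x * ln (R k x)) \<and> (\<integral>x. R k x * ln (R k x) \<partial>P) = (\<Sum>j<k. \<delta> j)"
  using assms
proof (induction k)
  case 0
  then show ?case by (simp add: R_0)
next
  case (Suc k)
  have IH: "integrable P (\<lambda>x. R k x * ln (R k x))" "(\<integral>x. R k x * ln (R k x) \<partial>P) = (\<Sum>j<k. \<delta> j)"
    using Suc by auto
  have cutR: "R k (cut (Suc k) x y) = R k x" for x y
  proof -
    have "cut k (cut (Suc k) x y) y' = cut k x y'" for y' by (auto simp: cut_def fun_eq_iff)
    then show ?thesis by (simp add: R_def)
  qed
  have ik: "integrable P (\<lambda>x. ln (R k x) * R k x)" using IH(1) by (simp add: mult.commute)
  have ikr: "integrable P (\<lambda>x. ln (R k x) * r x)" "(\<integral>x. ln (R k x) * r x \<partial>P) = (\<integral>x. ln (R k x) * R k x \<partial>P)"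
    by (rule integral_tower[OF _ _ ik]; simp add: R_cut)+
  have "(\<integral>\<^sup>+x. ennreal (norm (ln (R k x) * r x)) \<partial>P) = (\<integral>\<^sup>+x. ennreal \<bar>ln (R k x)\<bar> * ennreal (r x) \<partial>P)"
    using r_pos by (intro nn_integral_cong) (auto simp: abs_mult ennreal_mult less_imp_le)
  also have "\<dots> = (\<integral>\<^sup>+x. ennreal \<bar>ln (R k x)\<bar> * ennreal (R (Suc k) x) \<partial>P)"
    by (rule nn_tower) (simp_all add: cutR)
  also have "\<dots> = (\<integral>\<^sup>+x. ennreal (norm (ln (R k x) * R (Suc k) x)) \<partial>P)"
    using R_nonneg by (intro nn_integral_cong) (auto simp: abs_mult ennreal_mult)
  finally have iS: "integrable P (\<lambda>x. ln (R k x) * R (Suc k) x)"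
    using ikr(1) by (simp add: integrable_iff_bounded)
  have vS: "(\<integral>x. ln (R k x) * R (Suc k) x \<partial>P) = (\<integral>x. ln (R k x) * R k x \<partial>P)"
    using integral_tower(2)[OF _ _ iS] ikr(2) by (simp add: cutR)
  have ent0: "AE x in P. 0 \<le> ent (R (Suc k) x) (R k x)"
    using AE_R_pos[of k] AE_space by eventually_elim (rule ent_nonneg[OF R_nonneg])
  have ie: "integrable P (\<lambda>x. ent (R (Suc k) x) (R k x))"
    using Suc.prems(1)[of k] ent0 by (intro integrableI_nonneg) (auto simp: D_def)
  have "ennreal (\<integral>x. ent (R (Suc k) x) (R k x) \<partial>P) = ennreal (\<delta> k)"
    using Suc.prems(1)[of k] nn_integral_eq_integral[OF ie ent0] by (simp add: D_def)
  then have ve: "(\<integral>x. ent (R (Suc k) x) (R k x) \<partial>P) = \<delta> k"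
    using Suc.prems(2)[of k] ent0 by (simp add: integral_nonneg_AE)
  define T where "T x = ent (R (Suc k) x) (R k x) + R (Suc k) x - R k x + ln (R k x) * R (Suc k) x" for x
  have iT: "integrable P T"
    unfolding T_def by (intro Bochner_Integration.integrable_add Bochner_Integration.integrable_diff ie integrable_R iS)
  have eq: "AE x in P. R (Suc k) x * ln (R (Suc k) x) = T x"
    using AE_R_pos[of k] AE_R_pos[of "Suc k"]
    by eventually_elim (simp add: T_def ent_def ln_div algebra_simps)
  have "(\<integral>x. R (Suc k) x * ln (R (Suc k) x) \<partial>P) = (\<integral>x. T x \<partial>P)"
    using eq by (intro integral_cong_AE) (auto simp: T_def)
  also have "\<dots> = \<delta> k + (\<integral>x. ln (R k x) * R k x \<partial>P)"
    unfolding T_def using ie iS integrable_R by (simp add: ve vS)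
  also have "\<dots> = (\<Sum>j<Suc k. \<delta> j)" using IH(2) by (simp add: mult.commute)
  finally have "(\<integral>x. R (Suc k) x * ln (R (Suc k) x) \<partial>P) = (\<Sum>j<Suc k. \<delta> j)" .
  moreover have "integrable P (\<lambda>x. R (Suc k) x * ln (R (Suc k) x))"
    by (rule integrable_cong_AE_imp[OF iT]) (use eq in auto)
  ultimately show ?case by simp
qed

lemma KL_marginal:
  assumes fin: "\<And>j. j < k \<Longrightarrow> D j = ennreal (\<delta> j)" and \<delta>: "\<And>j. j < k \<Longrightarrow> 0 \<le> \<delta> j" and k: "k \<le> N"
    and Q: "Q = PiM {..<k} (\<lambda>_. M)" and S: "sets S = sets Q"
  shows "KL (distr (density P (\<lambda>x. ennreal (r x))) S (\<lambda>x. restrict x {..<k})) Q = ereal (\<Sum>j<k. \<delta> j)"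
proof -
  interpret Q: prob_space Q unfolding Q by (rule prob_space_PiM) (rule prob_M)
  define rs where "rs x = restrict x {..<k}" for x :: "nat \<Rightarrow> 'a"
  have rsm: "rs \<in> measurable P Q"
    unfolding rs_def P_def Q using k by (intro measurable_restrict_subset) auto
  have Qd: "distr P Q rs = Q"
    using PM.distr_restrict[of "{..<k}" "{..<N}"] k unfolding rs_def[abs_def] P_def Q by (simp add: subset_eq)
  have Rrs: "R k (rs x) = R k x" for x
  proof -
    have "cut k (rs x) y = cut k x y" for y by (auto simp: rs_def cut_def fun_eq_iff)
    then show ?thesis by (simp add: R_def)
  qed
  have cutQ: "(\<lambda>(x, y). cut k x y) \<in> measurable (Q \<Otimes>\<^sub>M P) P"
  proof (rule measurable_into_P)
    fix i assume i: "i < N"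
    have "(\<lambda>x. x i) \<in> measurable Q M" if "i < k" for i
      unfolding Q using that by (intro measurable_component_singleton) simp
    then show "(\<lambda>w. (case w of (x, y) \<Rightarrow> cut k x y) i) \<in> measurable (Q \<Otimes>\<^sub>M P) M"
      using measurable_compose[OF measurable_fst, of "\<lambda>x. x i" Q M P]
        measurable_compose[OF measurable_snd measurable_coord[OF i], of Q]
      by (cases "i < k") (simp_all add: cut_def split_beta' i)
  qed (auto simp: cut_def)
  have RQ[measurable]: "R k \<in> borel_measurable Q"
    using P.borel_measurable_lebesgue_integral[of "\<lambda>x y. r (cut k x y)" Q]
      measurable_compose[OF cutQ r_meas] by (simp add: R_def[abs_def] split_beta')
  have Qne: "rs (cut k x y) = rs x" for x y using k by (auto simp: rs_def cut_def fun_eq_iff)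
  have RQ0: "0 \<le> R k x" if "x \<in> space Q" for x
  proof -
    have "cut k x y' \<in> space P" if "y' \<in> space P" for y'
      using measurable_space[OF cutQ, of "(x, y')"] \<open>x \<in> space Q\<close> that by (simp add: space_pair_measure)
    then show ?thesis unfolding R_def
      by (intro Bochner_Integration.integral_nonneg) (auto intro: less_imp_le r_pos)
  qed
  have law: "distr (density P (\<lambda>x. ennreal (r x))) S rs = density Q (\<lambda>x. ennreal (R k x))"
  proof (rule measure_eqI)
    fix A assume "A \<in> sets (distr (density P (\<lambda>x. ennreal (r x))) S rs)"
    then have A[measurable]: "A \<in> sets Q" using S by simp
    have rsm': "rs \<in> measurable (density P (\<lambda>x. ennreal (r x))) S"
      using rsm S by (simp cong: measurable_cong_sets)
    have vm: "rs -` A \<inter> space P \<in> sets P" using rsm A by (rule measurable_sets)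
    have "emeasure (distr (density P (\<lambda>x. ennreal (r x))) S rs) A
      = emeasure (density P (\<lambda>x. ennreal (r x))) (rs -` A \<inter> space P)"
      using S A by (subst emeasure_distr[OF rsm']) auto
    also have "\<dots> = (\<integral>\<^sup>+x. ennreal (r x) * indicator (rs -` A \<inter> space P) x \<partial>P)"
      using vm by (subst emeasure_density) auto
    also have "\<dots> = (\<integral>\<^sup>+x. indicator A (rs x) * ennreal (r x) \<partial>P)"
      by (intro nn_integral_cong) (auto simp: indicator_def)
    also have "\<dots> = (\<integral>\<^sup>+x. indicator A (rs x) * ennreal (R k x) \<partial>P)"
      by (rule nn_tower) (use rsm A Qne in \<open>auto intro: measurable_compose[OF rsm]\<close>)
    also have "\<dots> = (\<integral>\<^sup>+x. indicator A (rs x) * ennreal (R k (rs x)) \<partial>P)" by (simp add: Rrs)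
    also have "\<dots> = (\<integral>\<^sup>+x. indicator A x * ennreal (R k x) \<partial>distr P Q rs)"
      by (rule nn_integral_distr[symmetric, OF rsm]) simp
    also have "\<dots> = emeasure (density Q (\<lambda>x. ennreal (R k x))) A"
      unfolding Qd by (subst emeasure_density) (auto simp: mult.commute)
    finally show "emeasure (distr (density P (\<lambda>x. ennreal (r x))) S rs) A = emeasure (density Q (\<lambda>x. ennreal (R k x))) A" .
  qed (simp add: S)
  have "integrable (distr P Q rs) (\<lambda>x. R k x * ln (R k x)) \<longleftrightarrow> integrable P (\<lambda>x. R k x * ln (R k x))"
    by (subst integrable_distr_eq[OF rsm]) (simp_all add: Rrs)
  moreover have "(\<integral>x. R k x * ln (R k x) \<partial>distr P Q rs) = (\<integral>x. R k x * ln (R k x) \<partial>P)"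
    by (subst integral_distr[OF rsm]) (simp_all add: Rrs)
  ultimately have "integrable Q (\<lambda>x. R k x * ln (R k x))" "(\<integral>x. R k x * ln (R k x) \<partial>Q) = (\<Sum>j<k. \<delta> j)"
    using entropy_chain_rule[OF fin \<delta> k] unfolding Qd by auto
  then show ?thesis
    unfolding rs_def[symmetric, abs_def] law
    using KL_density_eq[OF Q.sigma_finite_measure_axioms RQ RQ0] by simp
qed

end


section \<open>The hierarchy of conditional entropies\<close>

text \<open>
  The Gibbs measure of the particles, seen through its density \<open>r\<close> with respect to the product of the \<open>\<pi>\<close>. The confinement
  potential cancels in \<open>r\<close>, so only the interaction appears in its logarithmic gradient. With \<open>\<kappa> = 2 / (\<sigma>\<^sup>2 (N - 1))\<close>,
  \<open>coupling\<close> says that \<open>24 C\<^sup>2 L\<^sup>2 \<le> \<sigma>\<^sup>4\<close>.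
\<close>

locale particle_system = interaction d p C \<pi> W G L + iid_density \<pi> N r
  for d p C \<pi> W G L N and r :: "(nat \<Rightarrow> nat \<Rightarrow> real) \<Rightarrow> real" +
  fixes \<kappa> :: real
  assumes N_ge: "100 \<le> N" and \<kappa>_pos: "0 < \<kappa>"
    and coupling: "6 * (C * L * \<kappa> * (real N - 1))\<^sup>2 \<le> 1"
    and r_sym: "\<And>\<tau> x. bij_betw \<tau> {..<N} {..<N} \<Longrightarrow> x \<in> space P \<Longrightarrow> r (reindex \<tau> x) = r x"
    and r_partials: "\<And>x k. x \<in> space P \<Longrightarrow> k < N \<Longrightarrow>
      has_partials d (\<lambda>z. r (x(k := z)))
        (\<lambda>z i. r (x(k := z)) * (- \<kappa> * (\<Sum>j\<in>{..<N} - {k}. dev z (x j) i)))"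
    and r_moment: "\<And>k. k < N \<Longrightarrow> integrable P (\<lambda>x. (vnorm d (x k))\<^sup>2 * r x)"
begin

lemma measurable_coord_leb: "i < N \<Longrightarrow> (\<lambda>x. x i) \<in> measurable P (leb d)"
  using measurable_coord[of i] measurable_cong_sets[OF refl sets_\<pi>, of P] by simp

lemma coord_Rn: "x \<in> space P \<Longrightarrow> i < N \<Longrightarrow> x i \<in> Rn d"
  using coord_in_space[of x i] by simp

lemma dev_meas:
  assumes i: "i < d"
  shows "(\<lambda>(a, y). dev a y i) \<in> borel_measurable (leb d \<Otimes>\<^sub>M leb d)"
proof -
  have g: "(\<lambda>(a, y). G (vdiff d a y) i) \<in> borel_measurable (leb d \<Otimes>\<^sub>M leb d)"
  proof -
    have "(\<lambda>w. vdiff d (fst w) (snd w)) \<in> measurable (leb d \<Otimes>\<^sub>M leb d) (leb d)"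
      by (intro measurable_vdiff measurable_fst measurable_snd)
    from measurable_compose[OF this G_meas[OF i]] show ?thesis by (simp add: split_beta')
  qed
  have "sets (leb d \<Otimes>\<^sub>M \<pi>) = sets (leb d \<Otimes>\<^sub>M leb d)" by (intro sets_pair_measure_cong) auto
  then have "(\<lambda>(a, y). G (vdiff d a y) i) \<in> borel_measurable (leb d \<Otimes>\<^sub>M \<pi>)"
    using g by (simp cong: measurable_cong_sets)
  then have "(\<lambda>a. Gbar a i) \<in> borel_measurable (leb d)"
    unfolding Gbar_def by (rule M.borel_measurable_lebesgue_integral)
  from borel_measurable_diff[OF g measurable_compose[OF measurable_fst this]]
  show ?thesis by (simp add: dev_def split_beta')
qed

lemma dev_meas_right:
  assumes a: "a \<in> Rn d" and i: "i < d"
  shows "(\<lambda>y. dev a y i) \<in> borel_measurable \<pi>"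
proof -
  have "(\<lambda>y. dev a y i) \<in> borel_measurable (leb d)"
    using measurable_Pair2[OF dev_meas[OF i], of a] a by (simp add: space_leb)
  then show ?thesis by (simp cong: measurable_cong_sets)
qed

lemma dev_meas_P:
  assumes "k < N" "j < N" "i < d"
  shows "(\<lambda>x. dev (x k) (x j) i) \<in> borel_measurable P"
  using measurable_compose[OF measurable_Pair[OF measurable_coord_leb[OF assms(1)] measurable_coord_leb[OF assms(2)]]
      dev_meas[OF assms(3)]] by simp

lemma integrable_dev_sq:
  assumes k: "k < N" and j: "j < N" and i: "i < d"
  shows "integrable P (\<lambda>x. r x * (dev (x k) (x j) i)\<^sup>2)"
proof -
  define m1 where "m1 = (\<integral>z. vnorm d z \<partial>\<pi>)"
  have "integrable P (\<lambda>x. 2 * L\<^sup>2 * ((vnorm d (x j))\<^sup>2 * r x) + 2 * L\<^sup>2 * m1\<^sup>2 * r x)"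
    using r_moment[OF j] r_integrable by simp
  then show ?thesis
  proof (rule Bochner_Integration.integrable_bound)
    note dev_meas_P[OF k j i, measurable]
    show "(\<lambda>x. r x * (dev (x k) (x j) i)\<^sup>2) \<in> borel_measurable P" by measurable
    show "AE x in P. norm (r x * (dev (x k) (x j) i)\<^sup>2) \<le> norm (2 * L\<^sup>2 * ((vnorm d (x j))\<^sup>2 * r x) + 2 * L\<^sup>2 * m1\<^sup>2 * r x)"
    proof (rule AE_I2)
      fix x assume x: "x \<in> space P"
      define v where "v = vnorm d (x j)"
      have "\<bar>dev (x k) (x j) i\<bar> \<le> L * (v + m1)"
        unfolding v_def m1_def by (rule abs_dev_le[OF coord_Rn[OF x k] coord_Rn[OF x j] i])
      then have "\<bar>dev (x k) (x j) i\<bar>\<^sup>2 \<le> (L * (v + m1))\<^sup>2" by (rule power_mono) simp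
      also have "\<dots> = L\<^sup>2 * (v + m1)\<^sup>2" by (simp add: power_mult_distrib)
      also have "\<dots> \<le> L\<^sup>2 * (2 * v\<^sup>2 + 2 * m1\<^sup>2)"
        using zero_le_power2[of "v - m1"] by (intro mult_left_mono) (auto simp: power2_sum power2_diff)
      finally have "r x * (dev (x k) (x j) i)\<^sup>2 \<le> r x * (L\<^sup>2 * (2 * v\<^sup>2 + 2 * m1\<^sup>2))"
        using r_pos[OF x] by (intro mult_left_mono) auto
      also have "\<dots> = 2 * L\<^sup>2 * (v\<^sup>2 * r x) + 2 * L\<^sup>2 * m1\<^sup>2 * r x" by (simp add: algebra_simps)
      finally have "r x * (dev (x k) (x j) i)\<^sup>2 \<le> 2 * L\<^sup>2 * (v\<^sup>2 * r x) + 2 * L\<^sup>2 * m1\<^sup>2 * r x" .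
      then show "norm (r x * (dev (x k) (x j) i)\<^sup>2) \<le> norm (2 * L\<^sup>2 * ((vnorm d (x j))\<^sup>2 * r x) + 2 * L\<^sup>2 * m1\<^sup>2 * r x)"
        using r_pos[OF x] unfolding v_def by (auto simp: abs_mult intro: order_trans[OF _ abs_ge_self])
    qed
  qed
qed

lemma integrable_dev:
  assumes k: "k < N" and j: "j < N" and i: "i < d"
  shows "integrable P (\<lambda>x. r x * dev (x k) (x j) i)"
proof -
  have "integrable P (\<lambda>x. r x + r x * (dev (x k) (x j) i)\<^sup>2)"
    using r_integrable integrable_dev_sq[OF assms] by simp
  then show ?thesis
  proof (rule Bochner_Integration.integrable_bound)
    note dev_meas_P[OF k j i, measurable]
    show "(\<lambda>x. r x * dev (x k) (x j) i) \<in> borel_measurable P" by measurable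
    show "AE x in P. norm (r x * dev (x k) (x j) i) \<le> norm (r x + r x * (dev (x k) (x j) i)\<^sup>2)"
    proof (rule AE_I2)
      fix x assume x: "x \<in> space P"
      have t: "\<bar>t\<bar> \<le> 1 + t\<^sup>2" for t :: real
      proof -
        have "2 * \<bar>t\<bar> \<le> 1 + \<bar>t\<bar>\<^sup>2" using zero_le_power2[of "\<bar>t\<bar> - 1"] by (simp add: power2_diff)
        then show ?thesis by simp
      qed
      have "r x * \<bar>dev (x k) (x j) i\<bar> \<le> r x * (1 + (dev (x k) (x j) i)\<^sup>2)"
        using r_pos[OF x] t by (intro mult_left_mono) auto
      then show "norm (r x * dev (x k) (x j) i) \<le> norm (r x + r x * (dev (x k) (x j) i)\<^sup>2)"
        using r_pos[OF x] by (simp add: abs_mult distrib_left)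
    qed
  qed
qed

text \<open>The gradient in particle \<open>k\<close> of the density \<open>R (Suc k)\<close> of the first \<open>k + 1\<close> particles.\<close>

definition grad :: "nat \<Rightarrow> (nat \<Rightarrow> nat \<Rightarrow> real) \<Rightarrow> nat \<Rightarrow> real" where
  "grad k x i = (\<integral>y. r (cut (Suc k) x y) * (- \<kappa> * (\<Sum>j\<in>{..<N} - {k}. dev (x k) (cut (Suc k) x y j) i)) \<partial>P)"

text \<open>
  The conditional mean of the interaction of particles \<open>k\<close> and \<open>k + 1\<close>, given the particles up to \<open>k\<close>, multiplied by their density
  \<open>R (Suc k)\<close>.
\<close>

definition mm :: "nat \<Rightarrow> (nat \<Rightarrow> nat \<Rightarrow> real) \<Rightarrow> nat \<Rightarrow> real" where
  "mm k x i = (\<integral>y. r (cut (Suc k) x y) * dev (x k) (y (Suc k)) i \<partial>P)"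

lemma measurable_integral_cut:
  assumes "(\<lambda>(x, y). h x y) \<in> borel_measurable (P \<Otimes>\<^sub>M P)"
  shows "(\<lambda>x. \<integral>y. (h x y :: real) \<partial>P) \<in> borel_measurable P"
  using P.borel_measurable_lebesgue_integral[OF assms] .

lemma measurable_r_cut: "(\<lambda>(x, y). r (cut k x y)) \<in> borel_measurable (P \<Otimes>\<^sub>M P)"
  using measurable_compose[OF measurable_cut r_meas] by (simp add: split_beta')

lemma measurable_dev_pair:
  assumes "k < N" "j < N" "i < d"
  shows "(\<lambda>(x, y). dev (x k) (y j) i) \<in> borel_measurable (P \<Otimes>\<^sub>M P)"
proof -
  have "(\<lambda>w. (fst w k, snd w j)) \<in> measurable (P \<Otimes>\<^sub>M P) (leb d \<Otimes>\<^sub>M leb d)"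
    by (intro measurable_Pair measurable_compose[OF measurable_fst measurable_coord_leb[OF assms(1)]]
        measurable_compose[OF measurable_snd measurable_coord_leb[OF assms(2)]])
  from measurable_compose[OF this dev_meas[OF assms(3)]] show ?thesis by (simp add: split_beta')
qed

lemma measurable_dev_cut:
  assumes "k < N" "j < N" "i < d"
  shows "(\<lambda>(x, y). dev (x k) (cut l x y j) i) \<in> borel_measurable (P \<Otimes>\<^sub>M P)"
proof -
  have "(\<lambda>w. (fst w k, (case w of (x, y) \<Rightarrow> cut l x y) j)) \<in> measurable (P \<Otimes>\<^sub>M P) (leb d \<Otimes>\<^sub>M leb d)"
    by (intro measurable_Pair measurable_compose[OF measurable_fst measurable_coord_leb[OF assms(1)]]
        measurable_compose[OF measurable_cut measurable_coord_leb[OF assms(2)]])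
  from measurable_compose[OF this dev_meas[OF assms(3)]] show ?thesis by (simp add: split_beta')
qed

lemma grad_meas:
  assumes k: "k < N" and i: "i < d"
  shows "(\<lambda>x. grad k x i) \<in> borel_measurable P"
proof -
  have s: "(\<lambda>w. \<Sum>j\<in>{..<N} - {k}. (case w of (x, y) \<Rightarrow> dev (x k) (cut (Suc k) x y j) i)) \<in> borel_measurable (P \<Otimes>\<^sub>M P)"
    using k i by (intro borel_measurable_sum measurable_dev_cut) auto
  have "(\<lambda>w. (case w of (x, y) \<Rightarrow> r (cut (Suc k) x y)) *
      (- \<kappa> * (\<Sum>j\<in>{..<N} - {k}. (case w of (x, y) \<Rightarrow> dev (x k) (cut (Suc k) x y j) i))))
      \<in> borel_measurable (P \<Otimes>\<^sub>M P)"
    by (intro borel_measurable_times measurable_r_cut borel_measurable_const s)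
  then show ?thesis unfolding grad_def by (intro measurable_integral_cut) (simp add: split_beta')
qed

lemma mm_meas:
  assumes k: "Suc k < N" and i: "i < d"
  shows "(\<lambda>x. mm k x i) \<in> borel_measurable P"
proof -
  have "(\<lambda>w. (case w of (x, y) \<Rightarrow> r (cut (Suc k) x y)) * (case w of (x, y) \<Rightarrow> dev (x k) (y (Suc k)) i))
      \<in> borel_measurable (P \<Otimes>\<^sub>M P)"
    using k i by (intro borel_measurable_times measurable_r_cut measurable_dev_pair) auto
  then show ?thesis unfolding mm_def by (intro measurable_integral_cut) (simp add: split_beta')
qed

text \<open>
  The log-Sobolev inequality for the conditional law of particle \<open>k\<close> given the earlier ones. This
  law is a mixture over the later particles, so its weak gradient is \<open>grad k\<close>.
\<close>

lemma D_le_fisher: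
  assumes k: "k < N"
  shows "D k \<le> ennreal (C / 2) * (\<integral>\<^sup>+x. ennreal (R (Suc k) x * (vnorm d (\<lambda>i. grad k x i / R (Suc k) x))\<^sup>2) \<partial>P)"
proof -
  define Phi where "Phi x = ennreal (R (Suc k) x * (vnorm d (\<lambda>i. grad k x i / R (Suc k) x))\<^sup>2)" for x
  have vm[measurable]: "(\<lambda>x. vnorm d (\<lambda>i. grad k x i / R (Suc k) x)) \<in> borel_measurable P"
    by (rule measurable_vnorm_fun) (intro borel_measurable_divide grad_meas[OF k] R_meas)
  have Phim: "Phi \<in> borel_measurable P" unfolding Phi_def by measurable
  define h where "h i x = r x * (- \<kappa> * (\<Sum>j\<in>{..<N} - {k}. dev (x k) (x j) i))" for i x
  have ih: "integrable P (h i)" if "i < d" for i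
  proof -
    have "integrable P (\<lambda>x. - \<kappa> * (\<Sum>j\<in>{..<N} - {k}. r x * dev (x k) (x j) i))"
      using k that by (intro integrable_mult_right Bochner_Integration.integrable_sum integrable_dev) auto
    moreover have "(\<lambda>x. - \<kappa> * (\<Sum>j\<in>{..<N} - {k}. r x * dev (x k) (x j) i)) = h i"
      by (auto simp: h_def sum_distrib_left mult_ac)
    ultimately show ?thesis by (simp only:)
  qed
  have "AE x in P. \<forall>i\<in>{..<d}. integrable (\<pi> \<Otimes>\<^sub>M P) (\<lambda>(z, y). h i ((cut k x y)(k := z)))"
    by (rule AE_finite_allI) (auto intro!: AE_integrable_cut_upd[OF ih k])
  moreover note AE_integrable_cut_upd[OF r_integrable k] AE_integrable_cut_upd[OF r_moment[OF k] k]
    AE_R_pos[of k] AE_R_fibre[OF k] AE_space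
  ultimately have "AE x in P. (\<integral>\<^sup>+z. ennreal (ent (R (Suc k) (x(k := z))) (R k x)) \<partial>\<pi>)
    \<le> ennreal (C / 2) * (\<integral>\<^sup>+z. Phi (x(k := z)) \<partial>\<pi>)"
  proof eventually_elim
    case (elim x)
    have cx: "cut k x y \<in> space P" if "y \<in> space P" for y using elim(6) that by (rule cut_in_space)
    have dj: "dev ((((cut k x y)(k := z))) k) (((cut k x y)(k := z)) j) i = dev z (cut k x y j) i"
      if "j \<in> {..<N} - {k}" for z y j i using that by simp
    have hh: "h i ((cut k x y)(k := z)) = r ((cut k x y)(k := z)) * (- \<kappa> * (\<Sum>j\<in>{..<N} - {k}. dev z (cut k x y j) i))"
      for i z y unfolding h_def by (simp add: dj)
    show ?case
      unfolding Phi_def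
    proof (rule lsi_mixture[where Q = P and F = "\<lambda>z y. r ((cut k x y)(k := z))"
          and S = "\<lambda>z y i. r ((cut k x y)(k := z)) * (- \<kappa> * (\<Sum>j\<in>{..<N} - {k}. dev z (cut k x y j) i))"])
      show "sigma_finite_measure P" ..
      show "0 \<le> r ((cut k x y)(k := z))" if "z \<in> Rn d" "y \<in> space P" for z y
        using that k by (intro less_imp_le r_pos upd_in_space cx) auto
      show "has_partials d (\<lambda>z. r ((cut k x y)(k := z)))
        (\<lambda>z i. r ((cut k x y)(k := z)) * (- \<kappa> * (\<Sum>j\<in>{..<N} - {k}. dev z (cut k x y j) i)))"
        if "y \<in> space P" for y
        by (rule r_partials[OF cx[OF that] k])
      show "integrable (\<pi> \<Otimes>\<^sub>M P) (\<lambda>(z, y). r ((cut k x y)(k := z)))" by (rule elim(2))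
      show "integrable (\<pi> \<Otimes>\<^sub>M P) (\<lambda>(z, y). r ((cut k x y)(k := z)) * (- \<kappa> * (\<Sum>j\<in>{..<N} - {k}. dev z (cut k x y j) i)))"
        if "i < d" for i using elim(1) that unfolding hh by simp
      show "integrable (\<pi> \<Otimes>\<^sub>M P) (\<lambda>(z, y). (vnorm d z)\<^sup>2 * r ((cut k x y)(k := z)))"
        using elim(3) by simp
      show "R (Suc k) (x(k := z)) = (\<integral>y. r ((cut k x y)(k := z)) \<partial>P)" for z by (rule R_Suc_upd[OF k])
      show "grad k (x(k := z)) i = (\<integral>y. r ((cut k x y)(k := z)) * (- \<kappa> * (\<Sum>j\<in>{..<N} - {k}. dev z (cut k x y j) i)) \<partial>P)" for z i
        unfolding grad_def cut_upd[OF k] by simp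
      show "R k x = (\<integral>z. R (Suc k) (x(k := z)) \<partial>\<pi>)" using elim(5) by simp
      show "R k x > 0" by (rule elim(4))
    qed
  qed
  then have "D k \<le> (\<integral>\<^sup>+x. ennreal (C / 2) * (\<integral>\<^sup>+z. Phi (x(k := z)) \<partial>\<pi>) \<partial>P)"
    unfolding D_fibre[OF k] by (rule nn_integral_mono_AE)
  also have "\<dots> = ennreal (C / 2) * (\<integral>\<^sup>+x. \<integral>\<^sup>+z. Phi (x(k := z)) \<partial>\<pi> \<partial>P)"
  proof (rule nn_integral_cmult)
    have "(\<lambda>(x, z). Phi (x(k := z))) \<in> borel_measurable (P \<Otimes>\<^sub>M \<pi>)"
      using measurable_compose[OF measurable_upd[OF k] Phim] by (simp add: split_beta')
    from M.borel_measurable_nn_integral_fst[OF this]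
    show "(\<lambda>x. \<integral>\<^sup>+z. Phi (x(k := z)) \<partial>\<pi>) \<in> borel_measurable P" by simp
  qed
  also have "(\<integral>\<^sup>+x. \<integral>\<^sup>+z. Phi (x(k := z)) \<partial>\<pi> \<partial>P) = (\<integral>\<^sup>+x. Phi x \<partial>P)"
    by (rule nn_upd[OF Phim k])
  finally show ?thesis by (simp add: Phi_def)
qed

text \<open>The transposition of \<open>k + 1\<close> and \<open>j\<close> fixes the past and leaves \<open>r\<close> and \<open>P\<close> invariant.\<close>

lemma integral_later_particle:
  assumes x: "x \<in> space P" and j: "Suc k \<le> j" "j < N" and i: "i < d"
  shows "(\<integral>y. r (cut (Suc k) x y) * dev (x k) (y j) i \<partial>P) = mm k x i"
proof -
  have k: "k < N" "Suc k < N" using j by auto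
  define \<tau> where "\<tau> = Transposition.transpose (Suc k) j"
  have b: "bij_betw \<tau> {..<N} {..<N}"
    unfolding \<tau>_def using j k by (intro bij_betw_transpose_iff) simp
  have \<tau>: "inj_on \<tau> {..<N}" "\<tau> ` {..<N} \<subseteq> {..<N}"
    using b by (auto simp: bij_betw_def)
  define \<phi> where "\<phi> y = r (cut (Suc k) x y) * dev (x k) (y (Suc k)) i" for y
  have \<phi>m: "\<phi> \<in> borel_measurable P"
    unfolding \<phi>_def
  proof (intro borel_measurable_times)
    show "(\<lambda>y. r (cut (Suc k) x y)) \<in> borel_measurable P"
      using measurable_compose[OF measurable_Pair2[OF measurable_cut x] r_meas] by simp
    show "(\<lambda>y. dev (x k) (y (Suc k)) i) \<in> borel_measurable P"
      using measurable_compose[OF measurable_coord[OF k(2)] dev_meas_right[OF coord_Rn[OF x k(1)] i]] .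
  qed
  have "(\<integral>y. \<phi> (reindex \<tau> y) \<partial>P) = (\<integral>y. \<phi> y \<partial>P)"
    using integral_distr[OF measurable_reindex[OF \<tau>(2)] \<phi>m] distr_reindex[OF \<tau>] by simp
  moreover have "\<phi> (reindex \<tau> y) = r (cut (Suc k) x y) * dev (x k) (y j) i" if y: "y \<in> space P" for y
  proof -
    have "cut (Suc k) x (reindex \<tau> y) = reindex \<tau> (cut (Suc k) x y)"
    proof
      fix l
      show "cut (Suc k) x (reindex \<tau> y) l = reindex \<tau> (cut (Suc k) x y) l"
      proof (cases "l < N")
        case True
        have "\<tau> l < N" using \<tau>(2) True by auto
        moreover have "\<tau> l = l" if "l < Suc k" using that j by (auto simp: \<tau>_def Transposition.transpose_def split: if_splits)
        moreover have "\<not> \<tau> l < Suc k" if "\<not> l < Suc k" using that j by (auto simp: \<tau>_def Transposition.transpose_def split: if_splits)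
        ultimately show ?thesis using True by (auto simp: cut_def reindex_def)
      qed (simp add: cut_def reindex_def)
    qed
    then have "r (cut (Suc k) x (reindex \<tau> y)) = r (cut (Suc k) x y)"
      using r_sym[OF b cut_in_space[OF x y]] by simp
    then show ?thesis using k by (simp add: \<phi>_def reindex_def \<tau>_def)
  qed
  then have "(\<integral>y. \<phi> (reindex \<tau> y) \<partial>P) = (\<integral>y. r (cut (Suc k) x y) * dev (x k) (y j) i \<partial>P)"
    by (rule Bochner_Integration.integral_cong[OF refl])
  ultimately show ?thesis by (simp add: \<phi>_def mm_def)
qed

lemma AE_grad_eq:
  assumes k: "k < N"
  shows "AE x in P. \<forall>i<d. grad k x i =
    - \<kappa> * ((\<Sum>j<k. dev (x k) (x j) i) * R (Suc k) x + (real N - 1 - real k) * mm k x i)"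
proof -
  have "AE x in P. \<forall>(i, j)\<in>{..<d} \<times> {..<N}. integrable P (\<lambda>y. r (cut (Suc k) x y) * dev (cut (Suc k) x y k) (cut (Suc k) x y j) i)"
    by (rule AE_finite_allI) (use k in \<open>auto intro!: AE_integrable_cut integrable_dev\<close>)
  then show ?thesis
    using AE_space
  proof eventually_elim
    case (elim x)
    show ?case
    proof (intro allI impI)
      fix i assume i: "i < d"
      have int: "integrable P (\<lambda>y. r (cut (Suc k) x y) * dev (x k) (cut (Suc k) x y j) i)" if "j < N" for j
        using elim(1) i that k by (auto simp: cut_def)
      have "grad k x i = (\<integral>y. - \<kappa> * (\<Sum>j\<in>{..<N} - {k}. r (cut (Suc k) x y) * dev (x k) (cut (Suc k) x y j) i) \<partial>P)"
        unfolding grad_def by (intro Bochner_Integration.integral_cong refl) (simp add: sum_distrib_left mult_ac)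
      also have "\<dots> = - \<kappa> * (\<Sum>j\<in>{..<N} - {k}. \<integral>y. r (cut (Suc k) x y) * dev (x k) (cut (Suc k) x y j) i \<partial>P)"
        using int by (subst integral_mult_right_zero, subst Bochner_Integration.integral_sum) auto
      also have "{..<N} - {k} = {..<k} \<union> {Suc k..<N}" using k by auto
      also have "(\<Sum>j\<in>{..<k} \<union> {Suc k..<N}. \<integral>y. r (cut (Suc k) x y) * dev (x k) (cut (Suc k) x y j) i \<partial>P)
        = (\<Sum>j<k. \<integral>y. r (cut (Suc k) x y) * dev (x k) (cut (Suc k) x y j) i \<partial>P)
        + (\<Sum>j\<in>{Suc k..<N}. \<integral>y. r (cut (Suc k) x y) * dev (x k) (cut (Suc k) x y j) i \<partial>P)"
        by (rule sum.union_disjoint) auto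
      also have "(\<Sum>j<k. \<integral>y. r (cut (Suc k) x y) * dev (x k) (cut (Suc k) x y j) i \<partial>P) = (\<Sum>j<k. dev (x k) (x j) i) * R (Suc k) x"
        unfolding sum_distrib_right
      proof (rule sum.cong[OF refl])
        fix j assume "j \<in> {..<k}"
        then have "cut (Suc k) x y j = x j" for y using k by (simp add: cut_def)
        then show "(\<integral>y. r (cut (Suc k) x y) * dev (x k) (cut (Suc k) x y j) i \<partial>P) = dev (x k) (x j) i * R (Suc k) x"
          by (simp add: R_def mult.commute)
      qed
      also have "(\<Sum>j\<in>{Suc k..<N}. \<integral>y. r (cut (Suc k) x y) * dev (x k) (cut (Suc k) x y j) i \<partial>P) = (\<Sum>j\<in>{Suc k..<N}. mm k x i)"
      proof (rule sum.cong[OF refl])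
        fix j assume j: "j \<in> {Suc k..<N}"
        then have "cut (Suc k) x y j = y j" for y by (simp add: cut_def)
        then show "(\<integral>y. r (cut (Suc k) x y) * dev (x k) (cut (Suc k) x y j) i \<partial>P) = mm k x i"
          using integral_later_particle[OF elim(2), of k j i] j i by simp
      qed
      also have "\<dots> = (real N - 1 - real k) * mm k x i" using k by (simp add: of_nat_diff)
      finally show "grad k x i = - \<kappa> * ((\<Sum>j<k. dev (x k) (x j) i) * R (Suc k) x + (real N - 1 - real k) * mm k x i)" .
    qed
  qed
qed

text \<open>
  \<open>transport_bound\<close> for the law of particle \<open>k + 1\<close> given the earlier ones: its relative entropy with respect to \<open>\<pi>\<close> controls how far the
  mean of \<open>dev (x k)\<close> is from 0, its mean under \<open>\<pi>\<close>.
\<close>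

lemma mm_bound:
  assumes k: "Suc k < N"
  shows "(\<integral>\<^sup>+x. ennreal ((vnorm d (mm k x))\<^sup>2 / R (Suc k) x) \<partial>P) \<le> ennreal (2 * (C * L\<^sup>2)) * D (Suc k)"
proof -
  have k': "k < N" using k by simp
  define K where "K = C * L\<^sup>2"
  have K: "K > 0" using C_pos L_pos by (simp add: K_def)
  have "AE x in P. \<forall>i\<in>{..<d}. integrable (\<pi> \<Otimes>\<^sub>M P) (\<lambda>(z, y). r ((cut (Suc k) x y)(Suc k := z)) *
      dev (((cut (Suc k) x y)(Suc k := z)) k) (((cut (Suc k) x y)(Suc k := z)) (Suc k)) i)"
    by (rule AE_finite_allI) (simp, rule AE_integrable_cut_upd[OF integrable_dev[OF k' k] k], simp)
  moreover have "AE x in P. \<forall>i\<in>{..<d}. integrable P (\<lambda>y. r (cut (Suc k) x y) * dev (cut (Suc k) x y k) (cut (Suc k) x y (Suc k)) i)"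
    by (rule AE_finite_allI) (use k k' in \<open>auto intro!: AE_integrable_cut[OF integrable_dev]\<close>)
  moreover note AE_R_fibre[OF k] AE_R_pos[of "Suc k"] AE_space
  ultimately have "AE x in P. ennreal ((vnorm d (mm k x))\<^sup>2 / R (Suc k) x)
    \<le> ennreal (2 * K) * (\<integral>\<^sup>+z. ennreal (ent (R (Suc (Suc k)) (x(Suc k := z))) (R (Suc k) x)) \<partial>\<pi>)"
  proof eventually_elim
    case (elim x)
    define b where "b = R (Suc k) x"
    define A where "A z = R (Suc (Suc k)) (x(Suc k := z))" for z
    have b: "b > 0" unfolding b_def by (rule elim(4))
    have xk: "x k \<in> Rn d" by (rule coord_Rn[OF elim(5) k'])
    have ck: "cut (Suc k) x y k = x k" for y using k' by (simp add: cut_def)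
    have cS: "cut (Suc k) x y (Suc k) = y (Suc k)" for y using k by (simp add: cut_def)
    have i1: "integrable (\<pi> \<Otimes>\<^sub>M P) (\<lambda>(z, y). r ((cut (Suc k) x y)(Suc k := z)) * dev (x k) z i)" if "i < d" for i
      using elim(1) that by (simp add: ck)
    have i2: "integrable P (\<lambda>y. r (cut (Suc k) x y) * dev (x k) (y (Suc k)) i)" if "i < d" for i
      using elim(2) that by (simp add: ck cS)
    have AB: "(\<integral>y. r ((cut (Suc k) x y)(Suc k := z)) * dev (x k) z i \<partial>P) = A z * dev (x k) z i" for z i
      unfolding A_def R_Suc_upd[OF k] by simp
    have iAB: "integrable \<pi> (\<lambda>z. A z * dev (x k) z i)" if "i < d" for i
      using MP.integrable_fst[OF i1[OF that]] unfolding AB .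
    have vAB: "(\<integral>z. A z * dev (x k) z i \<partial>\<pi>) = mm k x i" if "i < d" for i
    proof -
      have "(\<integral>z. \<integral>y. r ((cut (Suc k) x y)(Suc k := z)) * dev (x k) z i \<partial>P \<partial>\<pi>) = mm k x i"
        using integral_upd[OF i2[OF that] k] unfolding cut_upd_right[OF order_refl k] fun_upd_same mm_def .
      then show ?thesis unfolding AB .
    qed
    have "ennreal ((vnorm d (\<lambda>i. \<integral>z. A z * dev (x k) z i \<partial>\<pi>))\<^sup>2) \<le> ennreal (2 * K * b) * (\<integral>\<^sup>+z. ennreal (ent (A z) b) \<partial>\<pi>)"
    proof (rule transport_bound[OF prob K b])
      show "(\<lambda>z. dev (x k) z i) \<in> borel_measurable \<pi>" if "i < d" for i by (rule dev_meas_right[OF xk that])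
      show "(\<integral>\<^sup>+z. ennreal (exp (\<Sum>i<d. u i * dev (x k) z i)) \<partial>\<pi>) \<le> ennreal (exp (K / 2 * (vnorm d u)\<^sup>2))" for u
        unfolding K_def by (rule subgaussian[OF xk])
      show "0 \<le> A z" if "z \<in> space \<pi>" for z
        unfolding A_def using elim(5) that k by (intro R_nonneg upd_in_space) auto
      show "integrable \<pi> A" "(\<integral>z. A z \<partial>\<pi>) = b" using elim(3) by (simp_all add: A_def[abs_def] b_def)
      show "integrable \<pi> (\<lambda>z. A z * dev (x k) z i)" if "i < d" for i by (rule iAB[OF that])
    qed
    also have "vnorm d (\<lambda>i. \<integral>z. A z * dev (x k) z i \<partial>\<pi>) = vnorm d (mm k x)"
      by (rule vnorm_cong) (rule vAB)
    finally have "ennreal (1 / b) * ennreal ((vnorm d (mm k x))\<^sup>2)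
      \<le> ennreal (1 / b) * (ennreal (2 * K * b) * (\<integral>\<^sup>+z. ennreal (ent (A z) b) \<partial>\<pi>))"
      by (rule mult_left_mono) simp
    also have "\<dots> = ennreal (1 / b * (2 * K * b)) * (\<integral>\<^sup>+z. ennreal (ent (A z) b) \<partial>\<pi>)"
      using b K by (subst ennreal_mult) (auto simp: mult.assoc)
    also have "1 / b * (2 * K * b) = 2 * K" using b by simp
    also have "ennreal (1 / b) * ennreal ((vnorm d (mm k x))\<^sup>2) = ennreal ((vnorm d (mm k x))\<^sup>2 / b)"
      using b by (subst ennreal_mult[symmetric]) auto
    finally show ?case unfolding A_def b_def .
  qed
  then have "(\<integral>\<^sup>+x. ennreal ((vnorm d (mm k x))\<^sup>2 / R (Suc k) x) \<partial>P)
    \<le> (\<integral>\<^sup>+x. ennreal (2 * K) * (\<integral>\<^sup>+z. ennreal (ent (R (Suc (Suc k)) (x(Suc k := z))) (R (Suc k) x)) \<partial>\<pi>) \<partial>P)"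
    by (rule nn_integral_mono_AE)
  also have "\<dots> = ennreal (2 * K) * D (Suc k)"
    unfolding D_fibre[OF k]
  proof (rule nn_integral_cmult)
    have "(\<lambda>(x, z). ennreal (ent (R (Suc (Suc k)) (x(Suc k := z))) (R (Suc k) x))) \<in> borel_measurable (P \<Otimes>\<^sub>M \<pi>)"
      using measurable_ent[OF measurable_compose[OF measurable_upd[OF k] R_meas] measurable_compose[OF measurable_fst R_meas], of "Suc (Suc k)" "Suc k"]
      by (simp add: split_beta')
    from M.borel_measurable_nn_integral_fst[OF this]
    show "(\<lambda>x. \<integral>\<^sup>+z. ennreal (ent (R (Suc (Suc k)) (x(Suc k := z))) (R (Suc k) x)) \<partial>\<pi>) \<in> borel_measurable P" by simp
  qed
  finally show ?thesis unfolding K_def .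
qed

definition A :: "nat \<Rightarrow> ennreal" where
  "A k = (\<integral>\<^sup>+x. ennreal (r x * (vnorm d (\<lambda>i. \<Sum>j<k. dev (x k) (x j) i))\<^sup>2) \<partial>P)"

lemma vnorm_add_sq_le: "(vnorm d (\<lambda>i. a i + b i))\<^sup>2 \<le> 2 * (vnorm d a)\<^sup>2 + 2 * (vnorm d b)\<^sup>2"
proof -
  have "(a i + b i)\<^sup>2 \<le> 2 * (a i)\<^sup>2 + 2 * (b i)\<^sup>2" for i
    using zero_le_power2[of "a i - b i"] by (simp add: power2_diff power2_sum)
  then have "(\<Sum>i<d. (a i + b i)\<^sup>2) \<le> (\<Sum>i<d. 2 * (a i)\<^sup>2 + 2 * (b i)\<^sup>2)" by (intro sum_mono)
  then show ?thesis by (simp add: vnorm_sq sum.distrib sum_distrib_left)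
qed

lemma fisher_le:
  assumes k: "k < N"
  shows "(\<integral>\<^sup>+x. ennreal (R (Suc k) x * (vnorm d (\<lambda>i. grad k x i / R (Suc k) x))\<^sup>2) \<partial>P)
    \<le> ennreal (2 * \<kappa>\<^sup>2) * A k +
      ennreal (2 * \<kappa>\<^sup>2 * (real N - 1 - real k)\<^sup>2) * (\<integral>\<^sup>+x. ennreal ((vnorm d (mm k x))\<^sup>2 / R (Suc k) x) \<partial>P)"
proof (cases "Suc k < N \<or> Suc k = N")
  case True
  define s where "s x i = (\<Sum>j<k. dev (x k) (x j) i)" for x i
  define n where "n = real N - 1 - real k"
  have sm: "(\<lambda>x. s x i) \<in> borel_measurable P" if "i < d" for i
    unfolding s_def using k that by (intro borel_measurable_sum dev_meas_P) auto
  have svm[measurable]: "(\<lambda>x. vnorm d (s x)) \<in> borel_measurable P"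
    by (rule measurable_vnorm_fun[OF sm])
  have "AE x in P. ennreal (R (Suc k) x * (vnorm d (\<lambda>i. grad k x i / R (Suc k) x))\<^sup>2)
    \<le> ennreal (2 * \<kappa>\<^sup>2) * (ennreal ((vnorm d (s x))\<^sup>2) * ennreal (R (Suc k) x)) +
      ennreal (2 * \<kappa>\<^sup>2 * n\<^sup>2) * ennreal ((vnorm d (mm k x))\<^sup>2 / R (Suc k) x)"
    using AE_grad_eq[OF k] AE_R_pos[of "Suc k"]
  proof eventually_elim
    case (elim x)
    define b where "b = R (Suc k) x"
    have b: "b > 0" unfolding b_def by (rule elim(2))
    have "vnorm d (\<lambda>i. grad k x i / b) = vnorm d (\<lambda>i. - \<kappa> * (s x i + n / b * mm k x i))"
    proof (rule vnorm_cong)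
      fix i assume "i < d"
      then have "grad k x i = - \<kappa> * (s x i * b + n * mm k x i)" using elim(1) by (simp add: s_def n_def b_def)
      then show "grad k x i / b = - \<kappa> * (s x i + n / b * mm k x i)" using b by (simp add: field_simps)
    qed
    also have "\<dots> = \<kappa> * vnorm d (\<lambda>i. s x i + n / b * mm k x i)"
      unfolding vnorm_scale using \<kappa>_pos by simp
    finally have "(vnorm d (\<lambda>i. grad k x i / b))\<^sup>2 = \<kappa>\<^sup>2 * (vnorm d (\<lambda>i. s x i + n / b * mm k x i))\<^sup>2"
      by (simp add: power_mult_distrib)
    also have "\<dots> \<le> \<kappa>\<^sup>2 * (2 * (vnorm d (s x))\<^sup>2 + 2 * (vnorm d (\<lambda>i. n / b * mm k x i))\<^sup>2)"
      by (intro mult_left_mono vnorm_add_sq_le) simp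
    also have "vnorm d (\<lambda>i. n / b * mm k x i) = \<bar>n / b\<bar> * vnorm d (mm k x)" by (rule vnorm_scale)
    finally have "b * (vnorm d (\<lambda>i. grad k x i / b))\<^sup>2
      \<le> b * (\<kappa>\<^sup>2 * (2 * (vnorm d (s x))\<^sup>2 + 2 * (\<bar>n / b\<bar> * vnorm d (mm k x))\<^sup>2))"
      using b by (intro mult_left_mono) auto
    also have "\<dots> = 2 * \<kappa>\<^sup>2 * ((vnorm d (s x))\<^sup>2 * b) + 2 * \<kappa>\<^sup>2 * n\<^sup>2 * ((vnorm d (mm k x))\<^sup>2 / b)"
      using b by (simp add: power_mult_distrib power_divide distrib_left power2_eq_square)
    finally have "ennreal (b * (vnorm d (\<lambda>i. grad k x i / b))\<^sup>2)
      \<le> ennreal (2 * \<kappa>\<^sup>2 * ((vnorm d (s x))\<^sup>2 * b) + 2 * \<kappa>\<^sup>2 * n\<^sup>2 * ((vnorm d (mm k x))\<^sup>2 / b))"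
      by (rule ennreal_leI)
    also have "\<dots> = ennreal (2 * \<kappa>\<^sup>2) * (ennreal ((vnorm d (s x))\<^sup>2) * ennreal b) +
      ennreal (2 * \<kappa>\<^sup>2 * n\<^sup>2) * ennreal ((vnorm d (mm k x))\<^sup>2 / b)"
    proof -
      have e: "ennreal (2 * \<kappa>\<^sup>2 * ((vnorm d (s x))\<^sup>2 * b)) = ennreal (2 * \<kappa>\<^sup>2) * ennreal ((vnorm d (s x))\<^sup>2 * b)"
        "ennreal ((vnorm d (s x))\<^sup>2 * b) = ennreal ((vnorm d (s x))\<^sup>2) * ennreal b"
        "ennreal (2 * \<kappa>\<^sup>2 * n\<^sup>2 * ((vnorm d (mm k x))\<^sup>2 / b))
          = ennreal (2 * \<kappa>\<^sup>2 * n\<^sup>2) * ennreal ((vnorm d (mm k x))\<^sup>2 / b)"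
        using b by (intro ennreal_mult; simp)+
      show ?thesis using b by (subst ennreal_plus) (simp_all only: e, simp_all)
    qed
    finally show ?case unfolding b_def .
  qed
  then have "(\<integral>\<^sup>+x. ennreal (R (Suc k) x * (vnorm d (\<lambda>i. grad k x i / R (Suc k) x))\<^sup>2) \<partial>P)
    \<le> (\<integral>\<^sup>+x. ennreal (2 * \<kappa>\<^sup>2) * (ennreal ((vnorm d (s x))\<^sup>2) * ennreal (R (Suc k) x)) +
      ennreal (2 * \<kappa>\<^sup>2 * n\<^sup>2) * ennreal ((vnorm d (mm k x))\<^sup>2 / R (Suc k) x) \<partial>P)"
    by (rule nn_integral_mono_AE)
  also have "\<dots> = ennreal (2 * \<kappa>\<^sup>2) * (\<integral>\<^sup>+x. ennreal ((vnorm d (s x))\<^sup>2) * ennreal (R (Suc k) x) \<partial>P) +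
      ennreal (2 * \<kappa>\<^sup>2 * n\<^sup>2) * (\<integral>\<^sup>+x. ennreal ((vnorm d (mm k x))\<^sup>2 / R (Suc k) x) \<partial>P)"
  proof (cases "Suc k < N")
    case True
    have [measurable]: "(\<lambda>x. vnorm d (mm k x)) \<in> borel_measurable P"
      by (rule measurable_vnorm_fun[OF mm_meas[OF True]])
    show ?thesis by (subst nn_integral_add, measurable, subst (1 2) nn_integral_cmult, auto)
  next
    case False
    then have "n = 0" using True k by (simp add: n_def)
    then show ?thesis by (simp add: nn_integral_cmult)
  qed
  also have "(\<integral>\<^sup>+x. ennreal ((vnorm d (s x))\<^sup>2) * ennreal (R (Suc k) x) \<partial>P) = (\<integral>\<^sup>+x. ennreal ((vnorm d (s x))\<^sup>2) * ennreal (r x) \<partial>P)"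
  proof (rule nn_tower[symmetric])
    show "(\<lambda>x. ennreal ((vnorm d (s x))\<^sup>2)) \<in> borel_measurable P" by measurable
    fix x y assume "x \<in> space P" "y \<in> space P"
    have "s (cut (Suc k) x y) = s x" using k by (auto simp: s_def cut_def fun_eq_iff intro!: sum.cong)
    then show "ennreal ((vnorm d (s (cut (Suc k) x y)))\<^sup>2) = ennreal ((vnorm d (s x))\<^sup>2)" by simp
  qed
  also have "\<dots> = A k"
    unfolding A_def s_def[abs_def] using r_pos
    by (intro nn_integral_cong) (auto simp: ennreal_mult[symmetric] mult.commute less_imp_le)
  finally show ?thesis unfolding n_def .
qed (use k in auto)

text \<open>
  The Fisher information of the conditional law is split into the contributions of the earlier and of the later particles. The latter come
  back as \<open>D (Suc k)\<close>, with the factor \<open>2 C\<^sup>2 L\<^sup>2 \<kappa>\<^sup>2 (N - 1 - k)\<^sup>2\<close>, at most \<open>1/3\<close> by \<open>coupling\<close>.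
\<close>

lemma D_recursion:
  assumes k: "k < N"
  shows "D k \<le> ennreal (C * \<kappa>\<^sup>2) * A k + (if Suc k < N then ennreal (1 / 3) * D (Suc k) else 0)"
proof -
  define X where "X = (\<integral>\<^sup>+x. ennreal ((vnorm d (mm k x))\<^sup>2 / R (Suc k) x) \<partial>P)"
  define n where "n = real N - 1 - real k"
  have "D k \<le> ennreal (C / 2) * (ennreal (2 * \<kappa>\<^sup>2) * A k + ennreal (2 * \<kappa>\<^sup>2 * n\<^sup>2) * X)"
    using order_trans[OF D_le_fisher[OF k] mult_left_mono[OF fisher_le[OF k]]] unfolding X_def n_def by simp
  also have "\<dots> = ennreal (C * \<kappa>\<^sup>2) * A k + ennreal (C * \<kappa>\<^sup>2 * n\<^sup>2) * X"
    using C_pos by (simp add: distrib_left mult.assoc[symmetric] ennreal_mult[symmetric])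
  finally have le: "D k \<le> ennreal (C * \<kappa>\<^sup>2) * A k + ennreal (C * \<kappa>\<^sup>2 * n\<^sup>2) * X" .
  show ?thesis
  proof (cases "Suc k < N")
    case True
    have X: "X \<le> ennreal (2 * (C * L\<^sup>2)) * D (Suc k)" unfolding X_def by (rule mm_bound[OF True])
    have n: "0 \<le> n" "n \<le> real N - 1" using True by (auto simp: n_def)
    then have "n\<^sup>2 \<le> (real N - 1)\<^sup>2" by (intro power_mono) auto
    then have "C * \<kappa>\<^sup>2 * n\<^sup>2 * (2 * (C * L\<^sup>2)) \<le> C * \<kappa>\<^sup>2 * (real N - 1)\<^sup>2 * (2 * (C * L\<^sup>2))"
      using C_pos by (intro mult_right_mono mult_left_mono) auto
    also have "\<dots> = 2 * (C * L * \<kappa> * (real N - 1))\<^sup>2" by (simp add: power_mult_distrib power2_eq_square mult_ac)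
    also have "\<dots> \<le> 1 / 3" using coupling by simp
    finally have c: "C * \<kappa>\<^sup>2 * n\<^sup>2 * (2 * (C * L\<^sup>2)) \<le> 1 / 3" .
    have "ennreal (C * \<kappa>\<^sup>2 * n\<^sup>2) * X \<le> ennreal (C * \<kappa>\<^sup>2 * n\<^sup>2) * (ennreal (2 * (C * L\<^sup>2)) * D (Suc k))"
      using X by (rule mult_left_mono) simp
    also have "\<dots> = ennreal (C * \<kappa>\<^sup>2 * n\<^sup>2 * (2 * (C * L\<^sup>2))) * D (Suc k)"
      using C_pos by (subst ennreal_mult) (auto simp: mult.assoc)
    also have "\<dots> \<le> ennreal (1 / 3) * D (Suc k)" by (intro mult_right_mono ennreal_leI c) simp
    finally show ?thesis using le True by (auto intro: order_trans add_left_mono)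
  next
    case False
    then have "n = 0" using k by (simp add: n_def)
    then show ?thesis using le False by simp
  qed
qed

end


section \<open>Second moments of the interactions\<close>

text \<open>Any supersolution \<open>g\<close> of the recursion that dominates at \<open>N\<close> dominates below.\<close>

lemma geometric_recursion:
  fixes \<delta> f g :: "nat \<Rightarrow> real"
  assumes rec: "\<And>k. k < N \<Longrightarrow> \<delta> k \<le> f k + \<delta> (Suc k) / 3" and last: "\<delta> N \<le> g N"
    and g: "\<And>k. k < N \<Longrightarrow> f k + g (Suc k) / 3 \<le> g k" and k: "k \<le> N"
  shows "\<delta> k \<le> g k"
  using k
proof (induction k rule: inc_induct)
  case (step n)
  then show ?case using rec[of n] g[of n] by simp
qed (rule last)

context particle_system
begin

definition cross :: "nat \<Rightarrow> nat \<Rightarrow> nat \<Rightarrow> real" where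
  "cross j i l = (\<integral>x. r x * (\<Sum>c<d. dev (x j) (x i) c * dev (x j) (x l) c) \<partial>P)"

lemma integrable_cross:
  assumes j: "j < N" and i: "i < N" and l: "l < N"
  shows "integrable P (\<lambda>x. r x * (\<Sum>c<d. dev (x j) (x i) c * dev (x j) (x l) c))"
proof -
  have "integrable P (\<lambda>x. r x * (dev (x j) (x i) c * dev (x j) (x l) c))" if c: "c < d" for c
  proof -
    have "integrable P (\<lambda>x. r x * (dev (x j) (x i) c)\<^sup>2 + r x * (dev (x j) (x l) c)\<^sup>2)"
      using integrable_dev_sq[OF j i c] integrable_dev_sq[OF j l c] by simp
    then show ?thesis
    proof (rule Bochner_Integration.integrable_bound)
      note dev_meas_P[OF j i c, measurable] dev_meas_P[OF j l c, measurable]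
      show "(\<lambda>x. r x * (dev (x j) (x i) c * dev (x j) (x l) c)) \<in> borel_measurable P" by measurable
      show "AE x in P. norm (r x * (dev (x j) (x i) c * dev (x j) (x l) c))
        \<le> norm (r x * (dev (x j) (x i) c)\<^sup>2 + r x * (dev (x j) (x l) c)\<^sup>2)"
      proof (rule AE_I2)
        fix x assume x: "x \<in> space P"
        have ab: "\<bar>a * b\<bar> \<le> a\<^sup>2 + b\<^sup>2" for a b :: real
        proof -
          have "2 * (\<bar>a\<bar> * \<bar>b\<bar>) \<le> a\<^sup>2 + b\<^sup>2" using zero_le_power2[of "\<bar>a\<bar> - \<bar>b\<bar>"] by (simp add: power2_diff)
          moreover have "0 \<le> \<bar>a\<bar> * \<bar>b\<bar>" by simp
          ultimately show ?thesis unfolding abs_mult by linarith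
        qed
        have "r x * \<bar>dev (x j) (x i) c * dev (x j) (x l) c\<bar> \<le> r x * ((dev (x j) (x i) c)\<^sup>2 + (dev (x j) (x l) c)\<^sup>2)"
          using r_pos[OF x] ab by (intro mult_left_mono) auto
        then show "norm (r x * (dev (x j) (x i) c * dev (x j) (x l) c))
          \<le> norm (r x * (dev (x j) (x i) c)\<^sup>2 + r x * (dev (x j) (x l) c)\<^sup>2)"
          using r_pos[OF x] by (simp add: abs_mult distrib_left)
      qed
    qed
  qed
  then have "integrable P (\<lambda>x. \<Sum>c<d. r x * (dev (x j) (x i) c * dev (x j) (x l) c))"
    by (intro Bochner_Integration.integrable_sum) auto
  then show ?thesis by (simp add: sum_distrib_left)
qed

lemma cross_permute:
  assumes b: "bij_betw \<tau> {..<N} {..<N}" and j: "j < N" and i: "i < N" and l: "l < N"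
  shows "cross (\<tau> j) (\<tau> i) (\<tau> l) = cross j i l"
proof -
  have \<tau>: "inj_on \<tau> {..<N}" "\<tau> ` {..<N} \<subseteq> {..<N}" using b by (auto simp: bij_betw_def)
  define \<phi> where "\<phi> x = r x * (\<Sum>c<d. dev (x j) (x i) c * dev (x j) (x l) c)" for x
  have \<phi>m: "\<phi> \<in> borel_measurable P"
    using integrable_cross[OF j i l] by (auto simp: \<phi>_def[abs_def])
  have "cross j i l = (\<integral>x. \<phi> x \<partial>P)" by (simp only: cross_def \<phi>_def)
  also have "\<dots> = (\<integral>x. \<phi> (reindex \<tau> x) \<partial>P)"
    using integral_distr[OF measurable_reindex[OF \<tau>(2)] \<phi>m] unfolding distr_reindex[OF \<tau>] .
  also have "\<dots> = cross (\<tau> j) (\<tau> i) (\<tau> l)"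
    unfolding cross_def
    by (rule Bochner_Integration.integral_cong[OF refl]) (simp add: \<phi>_def r_sym[OF b], simp add: reindex_def i j l)
  finally show ?thesis ..
qed

lemma cross_transpose:
  assumes "j < N" "i < N" "l < N" "a < N" "b < N"
  shows "cross (Transposition.transpose a b j) (Transposition.transpose a b i) (Transposition.transpose a b l) = cross j i l"
  using assms by (intro cross_permute bij_betw_transpose_iff) auto

lemma cross_distinct:
  assumes "j < N" "i < N" "l < N" "i \<noteq> j" "l \<noteq> j" "i \<noteq> l"
  shows "cross j i l = cross 1 0 2"
proof -
  define i1 l1 where "i1 = Transposition.transpose j 1 i" and "l1 = Transposition.transpose j 1 l"
  have 1: "cross j i l = cross 1 i1 l1"
    using cross_transpose[of j i l j 1] assms N_ge by (simp add: i1_def l1_def)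
  have b1: "i1 < N" "l1 < N" "i1 \<noteq> 1" "l1 \<noteq> 1" "i1 \<noteq> l1"
    using assms N_ge by (auto simp: i1_def l1_def Transposition.transpose_def)
  define l2 where "l2 = Transposition.transpose i1 0 l1"
  have 2: "cross 1 i1 l1 = cross 1 0 l2"
    using cross_transpose[of 1 i1 l1 i1 0] b1 N_ge by (simp add: l2_def Transposition.transpose_def)
  have b2: "l2 < N" "l2 \<noteq> 1" "l2 \<noteq> 0"
    using b1 N_ge by (auto simp: l2_def Transposition.transpose_def)
  have "cross 1 0 l2 = cross 1 0 2"
    using cross_transpose[of 1 0 l2 l2 2] b2 N_ge by (simp add: Transposition.transpose_def)
  then show ?thesis using 1 2 by simp
qed

lemma cross_diag:
  assumes "j < N" "i < N" "i \<noteq> j"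
  shows "cross j i i = cross 0 1 1"
proof -
  define i1 where "i1 = Transposition.transpose j 0 i"
  have 1: "cross j i i = cross 0 i1 i1"
    using cross_transpose[of j i i j 0] assms N_ge by (simp add: i1_def)
  have b1: "i1 < N" "i1 \<noteq> 0" using assms N_ge by (auto simp: i1_def Transposition.transpose_def)
  have "cross 0 i1 i1 = cross 0 1 1"
    using cross_transpose[of 0 i1 i1 i1 1] b1 N_ge by (simp add: Transposition.transpose_def)
  then show ?thesis using 1 by simp
qed

text \<open>The mean square of one interaction, and the covariance of two interactions with a common particle.\<close>

definition Mq :: real where "Mq = cross 0 1 1"
definition Pc :: real where "Pc = cross 1 0 2"

lemma sum_sq_cross: "(vnorm d v)\<^sup>2 = (\<Sum>c<d. v c * v c)"
  unfolding vnorm_sq by (simp add: power2_eq_square)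

lemma Mq_nonneg: "0 \<le> Mq"
  unfolding Mq_def cross_def sum_sq_cross[symmetric]
  by (intro Bochner_Integration.integral_nonneg mult_nonneg_nonneg) (auto intro: less_imp_le r_pos)

lemma A_eq:
  assumes k: "k < N"
  shows "A k = ennreal (real k * Mq + real k * (real k - 1) * Pc)"
proof -
  define s where "s x i = (\<Sum>j<k. dev (x k) (x j) i)" for x i
  have eq: "r x * (vnorm d (s x))\<^sup>2 = (\<Sum>i<k. \<Sum>l<k. r x * (\<Sum>c<d. dev (x k) (x i) c * dev (x k) (x l) c))" for x
  proof -
    have "(vnorm d (s x))\<^sup>2 = (\<Sum>c<d. \<Sum>i<k. \<Sum>l<k. dev (x k) (x i) c * dev (x k) (x l) c)"
      unfolding sum_sq_cross s_def by (simp add: sum_product)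
    also have "\<dots> = (\<Sum>i<k. \<Sum>c<d. \<Sum>l<k. dev (x k) (x i) c * dev (x k) (x l) c)" by (rule sum.swap)
    also have "\<dots> = (\<Sum>i<k. \<Sum>l<k. \<Sum>c<d. dev (x k) (x i) c * dev (x k) (x l) c)"
      by (intro sum.cong refl sum.swap)
    finally show ?thesis by (simp add: sum_distrib_left)
  qed
  have ii: "integrable P (\<lambda>x. r x * (\<Sum>c<d. dev (x k) (x i) c * dev (x k) (x l) c))" if "i < k" "l < k" for i l
    using that k by (intro integrable_cross) auto
  have int: "integrable P (\<lambda>x. r x * (vnorm d (s x))\<^sup>2)"
    unfolding eq using ii by (intro Bochner_Integration.integrable_sum) auto
  have "(\<integral>x. r x * (vnorm d (s x))\<^sup>2 \<partial>P) = (\<Sum>i<k. \<Sum>l<k. cross k i l)"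
    unfolding eq cross_def
    by (subst Bochner_Integration.integral_sum, intro Bochner_Integration.integrable_sum ii, simp, simp)
      (intro sum.cong refl Bochner_Integration.integral_sum ii, auto)
  also have "\<dots> = (\<Sum>i<k. Mq + (real k - 1) * Pc)"
  proof (rule sum.cong[OF refl])
    fix i assume i: "i \<in> {..<k}"
    have "(\<Sum>l<k. cross k i l) = cross k i i + (\<Sum>l\<in>{..<k} - {i}. cross k i l)"
      using i by (intro sum.remove) auto
    also have "cross k i i = Mq" using i k cross_diag[of k i] by (simp add: Mq_def)
    also have "(\<Sum>l\<in>{..<k} - {i}. cross k i l) = (\<Sum>l\<in>{..<k} - {i}. Pc)"
      using i k cross_distinct[of k i] by (intro sum.cong) (auto simp: Pc_def)
    also have "\<dots> = (real k - 1) * Pc" using i by (simp add: of_nat_diff)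
    finally show "(\<Sum>l<k. cross k i l) = Mq + (real k - 1) * Pc" .
  qed
  also have "\<dots> = real k * Mq + real k * (real k - 1) * Pc" by (simp add: algebra_simps)
  finally have v: "(\<integral>x. r x * (vnorm d (s x))\<^sup>2 \<partial>P) = real k * Mq + real k * (real k - 1) * Pc" .
  have "A k = ennreal (\<integral>x. r x * (vnorm d (s x))\<^sup>2 \<partial>P)"
    unfolding A_def s_def[symmetric]
    using r_pos by (intro nn_integral_eq_integral int AE_I2 mult_nonneg_nonneg) (auto intro: less_imp_le)
  then show ?thesis by (simp add: v)
qed

lemma Pc_le_Mq: "Pc \<le> Mq"
proof -
  have n: "(0::nat) < N" "1 < N" "2 < N" using N_ge by auto
  have "Pc \<le> (\<integral>x. (r x * (\<Sum>c<d. dev (x 1) (x 0) c * dev (x 1) (x 0) c)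
      + r x * (\<Sum>c<d. dev (x 1) (x 2) c * dev (x 1) (x 2) c)) / 2 \<partial>P)"
    unfolding Pc_def cross_def
  proof (rule integral_mono)
    show "integrable P (\<lambda>x. r x * (\<Sum>c<d. dev (x 1) (x 0) c * dev (x 1) (x 2) c))"
      by (rule integrable_cross) (use n in auto)
    show "integrable P (\<lambda>x. (r x * (\<Sum>c<d. dev (x 1) (x 0) c * dev (x 1) (x 0) c)
      + r x * (\<Sum>c<d. dev (x 1) (x 2) c * dev (x 1) (x 2) c)) / 2)"
      by (intro integrable_divide Bochner_Integration.integrable_add integrable_cross n)
    fix x assume x: "x \<in> space P"
    have ab: "a * b \<le> (a * a + b * b) / 2" for a b :: real
      using zero_le_power2[of "a - b"] by (simp add: power2_eq_square algebra_simps)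
    have "(\<Sum>c<d. dev (x 1) (x 0) c * dev (x 1) (x 2) c)
      \<le> (\<Sum>c<d. (dev (x 1) (x 0) c * dev (x 1) (x 0) c + dev (x 1) (x 2) c * dev (x 1) (x 2) c) / 2)"
      by (intro sum_mono ab)
    also have "\<dots> = ((\<Sum>c<d. dev (x 1) (x 0) c * dev (x 1) (x 0) c) + (\<Sum>c<d. dev (x 1) (x 2) c * dev (x 1) (x 2) c)) / 2"
      by (simp add: sum_divide_distrib[symmetric] sum.distrib)
    finally have "r x * (\<Sum>c<d. dev (x 1) (x 0) c * dev (x 1) (x 2) c)
      \<le> r x * (((\<Sum>c<d. dev (x 1) (x 0) c * dev (x 1) (x 0) c) + (\<Sum>c<d. dev (x 1) (x 2) c * dev (x 1) (x 2) c)) / 2)"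
      using r_pos[OF x] by (intro mult_left_mono) auto
    then show "r x * (\<Sum>c<d. dev (x 1) (x 0) c * dev (x 1) (x 2) c)
      \<le> (r x * (\<Sum>c<d. dev (x 1) (x 0) c * dev (x 1) (x 0) c)
      + r x * (\<Sum>c<d. dev (x 1) (x 2) c * dev (x 1) (x 2) c)) / 2"
      by (simp add: distrib_left)
  qed
  also have "\<dots> = (cross 1 0 0 + cross 1 2 2) / 2"
    unfolding cross_def using integrable_cross[OF n(2) n(1) n(1)] integrable_cross[OF n(2) n(3) n(3)] by simp
  also have "\<dots> = Mq" using cross_diag[of 1 0] cross_diag[of 1 2] n by (simp add: Mq_def)
  finally show ?thesis .
qed

text \<open>
  Given particle 0, the law of particle 1 is a tilt of \<open>\<pi>\<close> with expected relative entropy \<open>D 1\<close>, and \<open>square_bound\<close> applies to the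
  deviation of the force, which is subgaussian under \<open>\<pi>\<close>.
\<close>

lemma Mq_le: "ennreal Mq \<le> ennreal (4 * (C * L\<^sup>2)) * (D 1 + ennreal (real d / 2))"
proof -
  define K where "K = C * L\<^sup>2"
  have K: "K > 0" using C_pos L_pos by (simp add: K_def)
  have n: "(0::nat) < N" "1 < N" "Suc 0 < N" using N_ge by auto
  define e :: "(nat \<Rightarrow> nat \<Rightarrow> real) \<Rightarrow> real" where "e x = (vnorm d (dev (x 0) (x 1)))\<^sup>2" for x
  have em[measurable]: "e \<in> borel_measurable P"
  proof -
    have "(\<lambda>x. vnorm d (dev (x 0) (x 1))) \<in> borel_measurable P"
      by (rule measurable_vnorm_fun) (rule dev_meas_P[OF n(1,2)])
    then show ?thesis unfolding e_def by measurable
  qed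
  define Phi where "Phi x = ennreal (R 2 x * e x)" for x
  have Phim: "Phi \<in> borel_measurable P" unfolding Phi_def by measurable
  have int: "integrable P (\<lambda>x. r x * e x)"
    unfolding e_def sum_sq_cross by (rule integrable_cross[OF n(1,2,2)])
  have Mqe: "Mq = (\<integral>x. r x * e x \<partial>P)" by (simp only: Mq_def cross_def e_def sum_sq_cross)
  have "ennreal Mq = (\<integral>\<^sup>+x. ennreal (r x * e x) \<partial>P)"
    unfolding Mqe using r_pos
    by (intro nn_integral_eq_integral[symmetric] int AE_I2 mult_nonneg_nonneg) (auto simp: e_def intro: less_imp_le)
  also have "\<dots> = (\<integral>\<^sup>+x. ennreal (e x) * ennreal (r x) \<partial>P)"
    using r_pos by (intro nn_integral_cong) (auto simp: ennreal_mult[symmetric] mult.commute less_imp_le e_def)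
  also have "\<dots> = (\<integral>\<^sup>+x. ennreal (e x) * ennreal (R 2 x) \<partial>P)"
  proof (rule nn_tower)
    show "(\<lambda>x. ennreal (e x)) \<in> borel_measurable P" by measurable
    show "ennreal (e (cut 2 x y)) = ennreal (e x)" for x y using n by (simp add: e_def cut_def)
  qed
  also have "\<dots> = (\<integral>\<^sup>+x. Phi x \<partial>P)"
    unfolding Phi_def using R_nonneg
    by (intro nn_integral_cong) (auto simp: ennreal_mult[symmetric] mult.commute e_def)
  also have "\<dots> = (\<integral>\<^sup>+x. \<integral>\<^sup>+z. Phi (x(1 := z)) \<partial>\<pi> \<partial>P)" by (rule nn_upd[symmetric, OF Phim n(2)])
  also have "\<dots> \<le> (\<integral>\<^sup>+x. ennreal (4 * K) * ((\<integral>\<^sup>+z. ennreal (ent (R 2 (x(1 := z))) (R 1 x)) \<partial>\<pi>) + ennreal (R 1 x * (real d / 2))) \<partial>P)"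
  proof (rule nn_integral_mono_AE)
    show "AE x in P. (\<integral>\<^sup>+z. Phi (x(1 := z)) \<partial>\<pi>)
      \<le> ennreal (4 * K) * ((\<integral>\<^sup>+z. ennreal (ent (R 2 (x(1 := z))) (R 1 x)) \<partial>\<pi>) + ennreal (R 1 x * (real d / 2)))"
      using AE_R_fibre[OF n(2)] AE_R_pos[of 1] AE_space
    proof eventually_elim
      case (elim x)
      have x0: "x 0 \<in> Rn d" by (rule coord_Rn[OF elim(3) n(1)])
      have two: "Suc 1 = 2" by simp
      have "(\<integral>\<^sup>+z. ennreal (R 2 (x(1 := z)) * (vnorm d (dev (x 0) z))\<^sup>2) \<partial>\<pi>)
        \<le> ennreal (4 * K) * ((\<integral>\<^sup>+z. ennreal (ent (R 2 (x(1 := z))) (R 1 x)) \<partial>\<pi>) + ennreal (R 1 x * (real d / 2)))"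
      proof (rule square_bound[OF prob K elim(2)])
        show m: "(\<lambda>z. dev (x 0) z i) \<in> borel_measurable \<pi>" if "i < d" for i by (rule dev_meas_right[OF x0 that])
        show "(\<integral>\<^sup>+z. ennreal (exp ((vnorm d (dev (x 0) z))\<^sup>2 / (4 * K))) \<partial>\<pi>) \<le> ennreal (sqrt 2 ^ d)"
        proof (rule gaussian_linearisation[OF M.sigma_finite_measure_axioms K m])
          show "(\<integral>\<^sup>+z. ennreal (exp (\<Sum>i<d. u i * dev (x 0) z i)) \<partial>\<pi>) \<le> ennreal (exp (K / 2 * (vnorm d u)\<^sup>2))" for u
            unfolding K_def by (rule subgaussian[OF x0])
        qed
        show "0 \<le> R 2 (x(1 := z))" if "z \<in> space \<pi>" for z
          using elim(3) that n by (intro R_nonneg upd_in_space) auto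
        show "integrable \<pi> (\<lambda>z. R 2 (x(1 := z)))" "(\<integral>z. R 2 (x(1 := z)) \<partial>\<pi>) = R 1 x"
          using elim(1) unfolding two by auto
      qed
      then show ?case by (simp add: Phi_def e_def)
    qed
  qed
  also have "\<dots> = ennreal (4 * K) * (D 1 + ennreal (real d / 2))"
  proof -
    have m: "(\<lambda>x. \<integral>\<^sup>+z. ennreal (ent (R 2 (x(1 := z))) (R 1 x)) \<partial>\<pi>) \<in> borel_measurable P"
    proof -
      have "(\<lambda>(x, z). ennreal (ent (R 2 (x(1 := z))) (R 1 x))) \<in> borel_measurable (P \<Otimes>\<^sub>M \<pi>)"
        using measurable_ent[OF measurable_compose[OF measurable_upd[OF n(2)] R_meas] measurable_compose[OF measurable_fst R_meas], of 2 1]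
        by (simp add: split_beta')
      from M.borel_measurable_nn_integral_fst[OF this] show ?thesis by simp
    qed
    have mR: "(\<lambda>x. ennreal (R 1 x * (real d / 2))) \<in> borel_measurable P" by measurable
    have R1: "(\<integral>\<^sup>+x. ennreal (R 1 x * (real d / 2)) \<partial>P) = ennreal (real d / 2)"
    proof -
      have "(\<integral>\<^sup>+x. ennreal (R 1 x * (real d / 2)) \<partial>P) = ennreal (\<integral>x. R 1 x * (real d / 2) \<partial>P)"
        using R_nonneg integrable_R(1)[of 1]
        by (intro nn_integral_eq_integral integrable_mult_left AE_I2 mult_nonneg_nonneg) auto
      then show ?thesis using integrable_R(2)[of 1] by simp
    qed
    have D1: "(\<integral>\<^sup>+x. \<integral>\<^sup>+z. ennreal (ent (R 2 (x(1 := z))) (R 1 x)) \<partial>\<pi> \<partial>P) = D 1"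
      using D_fibre[OF n(2)] by (simp add: numeral_2_eq_2)
    have "(\<integral>\<^sup>+x. ennreal (4 * K) * ((\<integral>\<^sup>+z. ennreal (ent (R 2 (x(1 := z))) (R 1 x)) \<partial>\<pi>) + ennreal (R 1 x * (real d / 2))) \<partial>P)
      = ennreal (4 * K) * (\<integral>\<^sup>+x. (\<integral>\<^sup>+z. ennreal (ent (R 2 (x(1 := z))) (R 1 x)) \<partial>\<pi>) + ennreal (R 1 x * (real d / 2)) \<partial>P)"
      by (rule nn_integral_cmult[OF borel_measurable_add[OF m mR]])
    also have "(\<integral>\<^sup>+x. (\<integral>\<^sup>+z. ennreal (ent (R 2 (x(1 := z))) (R 1 x)) \<partial>\<pi>) + ennreal (R 1 x * (real d / 2)) \<partial>P)
      = D 1 + ennreal (real d / 2)"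
      by (simp only: nn_integral_add[OF m mR] D1 R1)
    finally show ?thesis .
  qed
  finally show ?thesis unfolding K_def .
qed

text \<open>
  Given the particles 0 and 1, the interaction with particle 2 averages to \<open>mm 1\<close>, which \<open>mm_bound\<close> makes small; this is what
  improves on \<open>Pc_le_Mq\<close>. The parameter \<open>s\<close> balances the two factors of the product.
\<close>

lemma Pc_le:
  assumes D2: "D 2 = ennreal \<delta>" "0 \<le> \<delta>" and s: "s > 0"
  shows "Pc \<le> s / 2 * Mq + C * L\<^sup>2 * \<delta> / s"
proof -
  have n: "(0::nat) < N" "1 < N" "2 < N" "Suc 1 < N" using N_ge by auto
  have two: "Suc 1 = 2" by simp
  define K where "K = C * L\<^sup>2"
  have K: "K > 0" using C_pos L_pos by (simp add: K_def)
  define g :: "(nat \<Rightarrow> nat \<Rightarrow> real) \<Rightarrow> real" where "g x = (\<Sum>c<d. dev (x 1) (x 0) c * mm 1 x c)" for x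
  define e :: "(nat \<Rightarrow> nat \<Rightarrow> real) \<Rightarrow> real" where "e x = (vnorm d (dev (x 1) (x 0)))\<^sup>2" for x
  define f :: "(nat \<Rightarrow> nat \<Rightarrow> real) \<Rightarrow> real" where "f x = (vnorm d (mm 1 x))\<^sup>2 / R 2 x" for x
  define h :: "(nat \<Rightarrow> nat \<Rightarrow> real) \<Rightarrow> real" where "h x = r x * (\<Sum>c<d. dev (x 1) (x 0) c * dev (x 1) (x 2) c)" for x
  have ih: "integrable P h" unfolding h_def by (rule integrable_cross[OF n(2,1,3)])
  have gm: "g \<in> borel_measurable P"
    unfolding g_def using n(4)
    by (intro borel_measurable_sum borel_measurable_times dev_meas_P[OF n(2,1)] mm_meas) auto
  have em[measurable]: "e \<in> borel_measurable P"
  proof -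
    have "(\<lambda>x. vnorm d (dev (x 1) (x 0))) \<in> borel_measurable P"
      by (rule measurable_vnorm_fun) (rule dev_meas_P[OF n(2,1)])
    then show ?thesis unfolding e_def by measurable
  qed
  have fm[measurable]: "f \<in> borel_measurable P"
  proof -
    have "(\<lambda>x. vnorm d (mm 1 x)) \<in> borel_measurable P"
      by (rule measurable_vnorm_fun) (rule mm_meas[OF n(4)])
    then show ?thesis unfolding f_def by measurable
  qed
  have "AE x in P. \<forall>c\<in>{..<d}. integrable P (\<lambda>y. r (cut 2 x y) * dev (cut 2 x y 1) (cut 2 x y 2) c)"
    by (rule AE_finite_allI) (use n in \<open>auto intro!: AE_integrable_cut[OF integrable_dev]\<close>)
  then have gh: "AE x in P. (\<integral>y. h (cut 2 x y) \<partial>P) = g x"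
  proof eventually_elim
    case (elim x)
    have c: "cut 2 x y 0 = x 0" "cut 2 x y 1 = x 1" "cut 2 x y 2 = y 2" for y
      using n by (auto simp: cut_def)
    have int: "integrable P (\<lambda>y. r (cut 2 x y) * dev (x 1) (y 2) i)" if "i < d" for i
      using elim that unfolding c by auto
    have "(\<integral>y. h (cut 2 x y) \<partial>P) = (\<integral>y. (\<Sum>i<d. dev (x 1) (x 0) i * (r (cut 2 x y) * dev (x 1) (y 2) i)) \<partial>P)"
      unfolding h_def c by (simp add: sum_distrib_left mult_ac)
    also have "\<dots> = (\<Sum>i<d. \<integral>y. dev (x 1) (x 0) i * (r (cut 2 x y) * dev (x 1) (y 2) i) \<partial>P)"
      using int by (intro Bochner_Integration.integral_sum integrable_mult_right) auto
    also have "\<dots> = g x" by (simp add: g_def mm_def numeral_2_eq_2)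
    finally show ?case .
  qed
  have hm: "(\<lambda>x. \<integral>y. h (cut 2 x y) \<partial>P) \<in> borel_measurable P" using integral_cut(1)[OF ih, of 2] by auto
  have ig: "integrable P g"
    by (rule integrable_cong_AE_imp[OF integral_cut(1)[OF ih, of 2] gm]) (use gh in auto)
  have Pg: "Pc = (\<integral>x. g x \<partial>P)"
    using integral_cut(2)[OF ih, of 2] integral_cong_AE[OF hm gm gh] by (simp add: Pc_def cross_def h_def)
  have f0: "0 \<le> f x" if "x \<in> space P" for x using R_nonneg[OF that] by (simp add: f_def)
  have ff: "(\<integral>\<^sup>+x. ennreal (f x) \<partial>P) \<le> ennreal (2 * K * \<delta>)"
    using mm_bound[OF n(4)] D2 K unfolding two by (simp add: f_def K_def ennreal_mult[symmetric])
  have "if": "integrable P f"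
    using ff f0 by (intro integrableI_nonneg AE_I2) (auto intro: le_less_trans)
  have vf: "(\<integral>x. f x \<partial>P) \<le> 2 * K * \<delta>"
    using ff f0 K D2(2) by (subst (asm) nn_integral_eq_integral[OF "if"]) (auto simp: ennreal_le_iff)
  have er: "integrable P (\<lambda>x. e x * r x)" "(\<integral>x. e x * r x \<partial>P) = Mq"
    using integrable_cross[OF n(2,1,1)] cross_diag[OF n(2,1)]
    unfolding e_def sum_sq_cross Mq_def cross_def by (simp_all add: mult.commute)
  have ec: "e (cut 2 x y) = e x" for x y using n by (simp add: e_def cut_def)
  have e0: "0 \<le> e x" for x by (simp add: e_def)
  have "(\<integral>\<^sup>+x. ennreal (norm (e x * R 2 x)) \<partial>P) = (\<integral>\<^sup>+x. ennreal (e x) * ennreal (R 2 x) \<partial>P)"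
    using R_nonneg e0 by (intro nn_integral_cong) (simp add: ennreal_mult)
  also have "\<dots> = (\<integral>\<^sup>+x. ennreal (e x) * ennreal (r x) \<partial>P)"
    by (rule nn_tower[symmetric]) (simp_all add: ec)
  also have "\<dots> = (\<integral>\<^sup>+x. ennreal (norm (e x * r x)) \<partial>P)"
    using r_pos e0 by (intro nn_integral_cong) (simp add: ennreal_mult less_imp_le)
  also have "\<dots> < \<infinity>" using er(1) by (simp add: integrable_iff_bounded)
  finally have ie: "integrable P (\<lambda>x. e x * R 2 x)" by (simp add: integrable_iff_bounded)
  have ve: "(\<integral>x. e x * R 2 x \<partial>P) = Mq"
    using integral_tower(2)[OF em _ ie] er(2) by (simp add: ec)
  have "(\<integral>x. g x \<partial>P) \<le> (\<integral>x. s / 2 * (e x * R 2 x) + 1 / (2 * s) * f x \<partial>P)"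
  proof (rule integral_mono_AE[OF ig])
    show "integrable P (\<lambda>x. s / 2 * (e x * R 2 x) + 1 / (2 * s) * f x)"
      by (intro Bochner_Integration.integrable_add integrable_mult_right ie "if")
    show "AE x in P. g x \<le> s / 2 * (e x * R 2 x) + 1 / (2 * s) * f x"
      using AE_R_pos[of 2]
    proof eventually_elim
      case (elim x)
      define u v b where "u = vnorm d (dev (x 1) (x 0))" and "v = vnorm d (mm 1 x)" and "b = s * R 2 x"
      have b: "b > 0" using s elim by (simp add: b_def)
      have "g x \<le> u * v" unfolding g_def u_def v_def using abs_inner_le_vnorm abs_le_D1 by blast
      moreover have "u * v \<le> b / 2 * u\<^sup>2 + 1 / (2 * b) * v\<^sup>2"
      proof -
        have "0 \<le> (b * u - v)\<^sup>2 / (2 * b)" using b by simp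
        also have "\<dots> = b / 2 * u\<^sup>2 + 1 / (2 * b) * v\<^sup>2 - u * v"
          using b by (simp add: field_simps power2_eq_square)
        finally show ?thesis by simp
      qed
      moreover have "b / 2 * u\<^sup>2 + 1 / (2 * b) * v\<^sup>2 = s / 2 * (e x * R 2 x) + 1 / (2 * s) * f x"
        by (simp add: e_def f_def u_def v_def b_def mult_ac)
      ultimately show ?case by linarith
    qed
  qed
  also have "\<dots> = s / 2 * Mq + 1 / (2 * s) * (\<integral>x. f x \<partial>P)"
    using ie "if" by (simp add: ve)
  also have "\<dots> \<le> s / 2 * Mq + 1 / (2 * s) * (2 * K * \<delta>)"
    using vf s by (intro add_left_mono mult_left_mono) auto
  also have "1 / (2 * s) * (2 * K * \<delta>) = C * L\<^sup>2 * \<delta> / s" using s by (simp add: K_def)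
  finally show ?thesis unfolding Pg .
qed

text \<open>The recursion is run downwards from \<open>k = N - 1\<close>, where the average over later particles is empty.\<close>

lemma D_finite:
  assumes "k < N"
  shows "D k < \<infinity>"
proof -
  have "k \<le> N - 1" using assms by simp
  then show ?thesis
  proof (induction k rule: inc_induct)
    case base
    have "D (N - 1) \<le> ennreal (C * \<kappa>\<^sup>2) * A (N - 1)"
      using D_recursion[of "N - 1"] N_ge by (simp add: not_less)
    also have "\<dots> < \<infinity>" using A_eq[of "N - 1"] N_ge by (simp add: ennreal_mult_less_top)
    finally show ?case .
  next
    case (step n)
    then have n: "n < N" "Suc n < N" by auto
    have "D n \<le> ennreal (C * \<kappa>\<^sup>2) * A n + ennreal (1 / 3) * D (Suc n)"
      using D_recursion[OF n(1)] n(2) by simp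
    also have "\<dots> < \<infinity>" using A_eq[OF n(1)] step.IH by (simp add: ennreal_mult_less_top)
    finally show ?case .
  qed
qed

definition \<delta> :: "nat \<Rightarrow> real" where
  "\<delta> k = (if k < N then enn2real (D k) else 0)"

lemma D_eq: "k < N \<Longrightarrow> D k = ennreal (\<delta> k)"
  using D_finite[of k] by (simp add: \<delta>_def)

lemma \<delta>_nonneg: "0 \<le> \<delta> k"
  by (simp add: \<delta>_def)

lemma \<delta>_recursion:
  assumes k: "k < N" and a: "real k * Mq + real k * (real k - 1) * Pc \<le> a" and a0: "0 \<le> a"
  shows "\<delta> k \<le> C * \<kappa>\<^sup>2 * a + \<delta> (Suc k) / 3"
proof -
  have "ennreal (\<delta> k) \<le> ennreal (C * \<kappa>\<^sup>2) * A k + ennreal (1 / 3) * ennreal (\<delta> (Suc k))"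
  proof (cases "Suc k < N")
    case True
    show ?thesis using D_recursion[OF k] unfolding D_eq[OF k] D_eq[OF True] using True by (simp only: if_True)
  next
    case False
    then have "\<delta> (Suc k) = 0" by (simp add: \<delta>_def)
    then show ?thesis using D_recursion[OF k] unfolding D_eq[OF k] using False by simp
  qed
  also have "\<dots> \<le> ennreal (C * \<kappa>\<^sup>2) * ennreal a + ennreal (1 / 3) * ennreal (\<delta> (Suc k))"
    unfolding A_eq[OF k] using a by (intro add_right_mono mult_left_mono ennreal_leI) auto
  also have "\<dots> = ennreal (C * \<kappa>\<^sup>2 * a + 1 / 3 * \<delta> (Suc k))"
    using C_pos a0 \<delta>_nonneg by (simp add: ennreal_mult[symmetric] ennreal_plus[symmetric] del: ennreal_plus)
  finally show ?thesis
    using C_pos a0 \<delta>_nonneg by (subst (asm) ennreal_le_iff) auto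
qed

text \<open>
  Bootstrap: with the crude bound \<open>Pc \<le> Mq\<close>, the recursion makes \<open>D 1\<close> and \<open>D 2\<close> of order \<open>C \<kappa>\<^sup>2 Mq\<close>. The first closes the
  inequality \<open>Mq_le\<close> for \<open>Mq\<close>, the second improves the bound on \<open>Pc\<close> by a factor \<open>N - 1\<close>, which is put back into the recursion.
\<close>

lemma sum_\<delta>_le:
  assumes k: "k \<le> N"
  shows "(\<Sum>j<k. \<delta> j) \<le> 8 * (real d * (real k)\<^sup>2 / (real N)\<^sup>2)"
proof -
  define n where "n = real N - 1"
  define K where "K = C * L\<^sup>2"
  define \<alpha> where "\<alpha> = C * \<kappa>\<^sup>2"
  have n: "n \<ge> 99" using N_ge by (simp add: n_def)
  have K: "K > 0" and \<alpha>: "\<alpha> > 0" using C_pos L_pos \<kappa>_pos by (auto simp: K_def \<alpha>_def)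
  have "6 * (\<alpha> * K) * n\<^sup>2 \<le> 1"
    using coupling by (simp add: K_def \<alpha>_def n_def power_mult_distrib power2_eq_square mult_ac)
  then have q: "\<alpha> * K \<le> 1 / (6 * n\<^sup>2)" using n by (simp add: field_simps)
  have crude: "\<delta> j \<le> 2 * \<alpha> * Mq * (real j + 2)\<^sup>2" if "j \<le> N" for j
  proof (rule geometric_recursion[where \<delta> = \<delta> and k = j and N = N and f = "\<lambda>k. \<alpha> * ((real k)\<^sup>2 * Mq)"
        and g = "\<lambda>k. 2 * \<alpha> * Mq * (real k + 2)\<^sup>2"])
    fix k assume k: "k < N"
    have "real k * (real k - 1) * Pc \<le> real k * (real k - 1) * Mq"
      using Pc_le_Mq by (cases k) (auto intro!: mult_left_mono)
    then have "real k * Mq + real k * (real k - 1) * Pc \<le> (real k)\<^sup>2 * Mq"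
      by (simp add: algebra_simps power2_eq_square)
    from \<delta>_recursion[OF k this] show "\<delta> k \<le> \<alpha> * ((real k)\<^sup>2 * Mq) + \<delta> (Suc k) / 3"
      using Mq_nonneg by (simp add: \<alpha>_def)
    have "(real k)\<^sup>2 + 2 * (real k + 3)\<^sup>2 / 3 \<le> 2 * (real k + 2)\<^sup>2"
      by (simp add: power2_eq_square field_simps)
    then have "\<alpha> * Mq * ((real k)\<^sup>2 + 2 * (real k + 3)\<^sup>2 / 3) \<le> \<alpha> * Mq * (2 * (real k + 2)\<^sup>2)"
      using \<alpha> Mq_nonneg by (intro mult_left_mono) auto
    moreover have "\<alpha> * ((real k)\<^sup>2 * Mq) + 2 * \<alpha> * Mq * (real (Suc k) + 2)\<^sup>2 / 3
      = \<alpha> * Mq * ((real k)\<^sup>2 + 2 * (real k + 3)\<^sup>2 / 3)"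
      by (simp add: algebra_simps)
    ultimately show "\<alpha> * ((real k)\<^sup>2 * Mq) + 2 * \<alpha> * Mq * (real (Suc k) + 2)\<^sup>2 / 3 \<le> 2 * \<alpha> * Mq * (real k + 2)\<^sup>2"
      by (simp add: mult_ac)
  next
    show "\<delta> N \<le> 2 * \<alpha> * Mq * (real N + 2)\<^sup>2"
      using \<alpha> Mq_nonneg by (simp add: \<delta>_def)
  qed (rule that)
  have d1: "\<delta> 1 \<le> 18 * \<alpha> * Mq" and d2: "\<delta> 2 \<le> 32 * \<alpha> * Mq"
    using crude[of 1] crude[of 2] N_ge by simp_all
  have Mq: "Mq \<le> 4 * K * real d"
  proof -
    have "ennreal Mq \<le> ennreal (4 * K) * (ennreal (\<delta> 1) + ennreal (real d / 2))"
      using Mq_le D_eq[of 1] N_ge by (simp add: K_def)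
    also have "\<dots> = ennreal (4 * K * (\<delta> 1 + real d / 2))"
      using K \<delta>_nonneg by (simp add: ennreal_mult[symmetric] ennreal_plus[symmetric] del: ennreal_plus)
    finally have "Mq \<le> 4 * K * (\<delta> 1 + real d / 2)"
      using K \<delta>_nonneg[of 1] by (subst (asm) ennreal_le_iff) auto
    also have "\<dots> \<le> 4 * K * (18 * \<alpha> * Mq + real d / 2)"
      using d1 K by (intro mult_left_mono add_right_mono) auto
    also have "\<dots> = 72 * (\<alpha> * K) * Mq + 2 * K * real d" by (simp add: algebra_simps)
    also have "72 * (\<alpha> * K) * Mq \<le> 1 / 2 * Mq"
    proof (rule mult_right_mono[OF _ Mq_nonneg])
      have "99\<^sup>2 \<le> n\<^sup>2" using n by (intro power_mono) auto
      then have "1 / (6 * n\<^sup>2) \<le> 1 / 144" by (intro divide_left_mono) (auto intro!: mult_pos_pos)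
      then show "72 * (\<alpha> * K) \<le> 1 / 2" using q by linarith
    qed
    finally show ?thesis by simp
  qed
  have Pc: "Pc \<le> 4 / n * Mq"
  proof -
    \<comment> \<open>\<open>s = 4 / n\<close> makes both terms of \<open>Pc_le\<close> of order \<open>Mq / n\<close>.\<close>
    have "Pc \<le> (4 / n) / 2 * Mq + K * \<delta> 2 / (4 / n)"
      using Pc_le[OF D_eq[of 2] \<delta>_nonneg, of "4 / n"] n N_ge by (simp add: K_def)
    also have "K * \<delta> 2 / (4 / n) = n / 4 * K * \<delta> 2" using n by simp
    also have "\<dots> \<le> n / 4 * K * (32 * \<alpha> * Mq)"
      using d2 K n by (intro mult_left_mono) auto
    also have "\<dots> = 8 * n * Mq * (\<alpha> * K)" by simp
    also have "\<dots> \<le> 8 * n * Mq * (1 / (6 * n\<^sup>2))"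
      using q n Mq_nonneg by (intro mult_left_mono) auto
    also have "\<dots> = 4 / 3 * (1 / n) * Mq" using n by (simp add: power2_eq_square)
    finally have "Pc \<le> 2 * (1 / n) * Mq + 4 / 3 * (1 / n) * Mq" by simp
    also have "\<dots> \<le> 4 * (1 / n) * Mq"
    proof -
      have "0 \<le> (1 / n) * Mq" using n Mq_nonneg by simp
      then show ?thesis unfolding mult.assoc by linarith
    qed
    finally show ?thesis by simp
  qed
  have fine: "\<delta> j \<le> 10 * \<alpha> * Mq * (real j + 1)" if "j \<le> N" for j
  proof (rule geometric_recursion[where \<delta> = \<delta> and k = j and N = N and f = "\<lambda>k. \<alpha> * (5 * real k * Mq)"
        and g = "\<lambda>k. 10 * \<alpha> * Mq * (real k + 1)"])
    fix k assume k: "k < N"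
    have "real k * Mq + real k * (real k - 1) * Pc \<le> 5 * real k * Mq"
    proof (cases "k = 0")
      case False
      have "real k * (real k - 1) * Pc \<le> real k * (real k - 1) * (4 / n * Mq)"
        using Pc False by (intro mult_left_mono) auto
      also have "\<dots> = real k * Mq * (4 * ((real k - 1) / n))" by simp
      also have "\<dots> \<le> real k * Mq * (4 * 1)"
        using k n Mq_nonneg by (intro mult_left_mono) (auto simp: n_def divide_le_eq)
      finally show ?thesis by simp
    qed simp
    from \<delta>_recursion[OF k this] show "\<delta> k \<le> \<alpha> * (5 * real k * Mq) + \<delta> (Suc k) / 3"
      using Mq_nonneg by (simp add: \<alpha>_def)
    have "\<alpha> * Mq * (5 * real k + 10 * (real k + 2) / 3) \<le> \<alpha> * Mq * (10 * (real k + 1))"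
      using \<alpha> Mq_nonneg by (intro mult_left_mono) auto
    then show "\<alpha> * (5 * real k * Mq) + 10 * \<alpha> * Mq * (real (Suc k) + 1) / 3 \<le> 10 * \<alpha> * Mq * (real k + 1)"
      by (simp add: algebra_simps)
  next
    show "\<delta> N \<le> 10 * \<alpha> * Mq * (real N + 1)" using \<alpha> Mq_nonneg by (simp add: \<delta>_def)
  qed (rule that)
  have "(\<Sum>j<k. \<delta> j) \<le> (\<Sum>j<k. 10 * \<alpha> * Mq * real k)"
  proof (rule sum_mono)
    fix j assume j: "j \<in> {..<k}"
    then have "\<delta> j \<le> 10 * \<alpha> * Mq * (real j + 1)" using k by (intro fine) simp
    also have "\<dots> \<le> 10 * \<alpha> * Mq * real k" using j \<alpha> Mq_nonneg by (intro mult_left_mono) auto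
    finally show "\<delta> j \<le> 10 * \<alpha> * Mq * real k" .
  qed
  also have "\<dots> = 10 * (real k)\<^sup>2 * (\<alpha> * Mq)" by (simp add: power2_eq_square)
  also have "\<dots> \<le> 10 * (real k)\<^sup>2 * (4 * real d * (1 / (6 * n\<^sup>2)))"
  proof (rule mult_left_mono)
    have "\<alpha> * Mq \<le> \<alpha> * (4 * K * real d)" using Mq \<alpha> by (intro mult_left_mono) auto
    also have "\<dots> = 4 * real d * (\<alpha> * K)" by simp
    also have "\<dots> \<le> 4 * real d * (1 / (6 * n\<^sup>2))" using q by (intro mult_left_mono) auto
    finally show "\<alpha> * Mq \<le> 4 * real d * (1 / (6 * n\<^sup>2))" .
  qed simp
  also have "\<dots> = real d * (real k)\<^sup>2 * (20 / 3 * (1 / n\<^sup>2))" by simp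
  also have "\<dots> \<le> real d * (real k)\<^sup>2 * (8 * (1 / (real N)\<^sup>2))"
  proof (rule mult_left_mono)
    have "20 * (real N)\<^sup>2 \<le> 24 * n\<^sup>2"
    proof -
      have "(11 * real N)\<^sup>2 \<le> (12 * n)\<^sup>2" using N_ge by (intro power_mono) (auto simp: n_def)
      then have "121 * (real N)\<^sup>2 \<le> 144 * n\<^sup>2" by (simp add: power_mult_distrib)
      then show ?thesis using zero_le_power2[of n] by linarith
    qed
    then show "20 / 3 * (1 / n\<^sup>2) \<le> 8 * (1 / (real N)\<^sup>2)"
      using n N_ge by (simp add: field_simps)
  qed simp
  finally show ?thesis by (simp add: mult_ac)
qed

lemma KL_marginal_le:
  assumes k: "k \<le> N" and S: "sets S = sets (PiM {..<k} (\<lambda>_. \<pi>))"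
  shows "KL (distr (density P (\<lambda>x. ennreal (r x))) S (\<lambda>x. restrict x {..<k})) (PiM {..<k} (\<lambda>_. \<pi>))
    \<le> ereal (8 * (real d * (real k)\<^sup>2 / (real N)\<^sup>2))"
proof -
  have "KL (distr (density P (\<lambda>x. ennreal (r x))) S (\<lambda>x. restrict x {..<k})) (PiM {..<k} (\<lambda>_. \<pi>)) = ereal (\<Sum>j<k. \<delta> j)"
    using k by (intro KL_marginal[OF _ \<delta>_nonneg k refl S]) (simp add: D_eq)
  then show ?thesis using sum_\<delta>_le[OF k] by simp
qed

end


section \<open>Gibbs measures with smooth potentials\<close>

lemma PiM_density_prob:
  assumes \<nu>: "sigma_finite_measure \<nu>" and f[measurable]: "f \<in> borel_measurable \<nu>"
    and pr: "prob_space (density \<nu> f)"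
  shows "PiM {..<N::nat} (\<lambda>_. density \<nu> f) = density (PiM {..<N} (\<lambda>_. \<nu>)) (\<lambda>x. \<Prod>i<N. f (x i))"
proof -
  interpret n: sigma_finite_measure \<nu> by (rule \<nu>)
  interpret np: product_sigma_finite "\<lambda>_::nat. \<nu>" by standard
  interpret f: product_prob_space "\<lambda>_::nat. density \<nu> f" by (intro product_prob_spaceI pr)
  have c: "(\<lambda>x. x i) \<in> measurable (PiM {..<N} (\<lambda>_. \<nu>)) \<nu>" if "i \<in> {..<N}" for i
    using that by (rule measurable_component_singleton)
  have fm: "(\<lambda>x. \<Prod>i<N. f (x i)) \<in> borel_measurable (PiM {..<N} (\<lambda>_. \<nu>))"
    by (intro borel_measurable_prod_ennreal measurable_compose[OF c f])
  have S: "sets (PiM {..<N} (\<lambda>_. density \<nu> f)) = sets (PiM {..<N} (\<lambda>_. \<nu>))"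
    by (intro sets_PiM_cong) auto
  show ?thesis
  proof (rule f.PiM_eqI[symmetric])
    show "sets (density (PiM {..<N} (\<lambda>_. \<nu>)) (\<lambda>x. \<Prod>i<N. f (x i))) = sets (PiM {..<N} (\<lambda>_. density \<nu> f))"
      using S by simp
    fix A :: "nat \<Rightarrow> 'a set" assume A: "\<And>i. i \<in> {..<N} \<Longrightarrow> A i \<in> sets (density \<nu> f)"
    have A': "PiE {..<N} A \<in> sets (PiM {..<N} (\<lambda>_. \<nu>))" using A by (intro sets_PiM_I_finite) auto
    have "emeasure (density (PiM {..<N} (\<lambda>_. \<nu>)) (\<lambda>x. \<Prod>i<N. f (x i))) (PiE {..<N} A)
      = (\<integral>\<^sup>+x. (\<Prod>i<N. f (x i)) * indicator (PiE {..<N} A) x \<partial>PiM {..<N} (\<lambda>_. \<nu>))"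
      by (rule emeasure_density[OF fm A'])
    also have "\<dots> = (\<integral>\<^sup>+x. (\<Prod>i<N. f (x i) * indicator (A i) (x i)) \<partial>PiM {..<N} (\<lambda>_. \<nu>))"
    proof (rule nn_integral_cong)
      fix x assume x: "x \<in> space (PiM {..<N} (\<lambda>_. \<nu>))"
      show "(\<Prod>i<N. f (x i)) * indicator (PiE {..<N} A) x = (\<Prod>i<N. f (x i) * indicator (A i) (x i))"
      proof (cases "x \<in> PiE {..<N} A")
        case True
        then have "\<And>i. i < N \<Longrightarrow> x i \<in> A i" by auto
        then show ?thesis using True by simp
      next
        case False
        then obtain i where i: "i < N" "x i \<notin> A i"
          using x by (auto simp: space_PiM PiE_iff)
        then have "(\<Prod>i<N. f (x i) * indicator (A i) (x i)) = 0"
          by (intro prod_zero) (auto intro!: bexI[of _ i])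
        then show ?thesis using False by simp
      qed
    qed
    also have "\<dots> = (\<Prod>i<N. \<integral>\<^sup>+y. f y * indicator (A i) y \<partial>\<nu>)"
      using A by (intro np.product_nn_integral_prod borel_measurable_times_ennreal f borel_measurable_indicator) auto
    also have "\<dots> = (\<Prod>i<N. emeasure (density \<nu> f) (A i))"
      using A by (intro prod.cong refl emeasure_density[symmetric] f) auto
    finally show "emeasure (density (PiM {..<N} (\<lambda>_. \<nu>)) (\<lambda>x. \<Prod>i<N. f (x i))) (PiE {..<N} A)
      = (\<Prod>i<N. emeasure (density \<nu> f) (A i))" .
  qed simp
qed

lemma has_partials_cong:
  assumes "has_partials d U DU" "\<And>z. z \<in> Rn d \<Longrightarrow> U z = U' z" "\<And>z i. z \<in> Rn d \<Longrightarrow> i < d \<Longrightarrow> DU z i = DU' z i"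
  shows "has_partials d U' DU'"
  unfolding has_partials_def
proof (intro ballI allI impI)
  fix x i t assume x: "x \<in> Rn d" and i: "i < d"
  have u: "x(i := s) \<in> Rn d" for s by (rule upd_in_Rn[OF x i])
  show "((\<lambda>s. U' (x(i := s))) has_real_derivative DU' (x(i := t)) i) (at t)"
    using has_partialsD[OF assms(1) x i, of t] by (simp add: assms(2)[OF u] assms(3)[OF u i])
qed

lemma has_partials_cmult:
  assumes "has_partials d U DU"
  shows "has_partials d (\<lambda>z. c * U z) (\<lambda>z i. c * DU z i)"
  unfolding has_partials_def by (intro ballI allI impI DERIV_cmult has_partialsD[OF assms])

lemma has_partials_vdiff:
  assumes W: "\<And>x. x \<in> Rn d \<Longrightarrow> has_gradient d W (G x) x"
  shows "has_partials d (\<lambda>z. W (vdiff d z y)) (\<lambda>z i. G (vdiff d z y) i)"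
  unfolding has_partials_def
proof (intro ballI allI impI)
  fix x i t assume x: "x \<in> Rn d" and i: "i < d"
  define c where "c = vdiff d x y"
  have c: "c \<in> Rn d" by (simp add: c_def)
  have v: "vdiff d (x(i := s)) y = c(i := s - y i)" for s
    using i by (auto simp: c_def vdiff_def fun_eq_iff)
  have d: "((\<lambda>s. s - y i) has_real_derivative 1) (at t)" by (auto intro!: derivative_eq_intros)
  from DERIV_chain2[where f="\<lambda>s. W (c(i := s))", OF has_gradient_coord[OF W c i] d]
  show "((\<lambda>s. W (vdiff d (x(i := s)) y)) has_real_derivative G (vdiff d (x(i := t)) y) i) (at t)"
    unfolding v by simp
qed

text \<open>
  A symmetric interaction counts the pairs of particle \<open>k\<close> twice; this cancels the factor \<open>1/2\<close> between the normalisations of the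
  interaction in the two densities.
\<close>

lemma sum_pairs_split:
  fixes w :: "nat \<Rightarrow> nat \<Rightarrow> real"
  assumes k: "k < N" and sym: "\<And>i. i < N \<Longrightarrow> w i k = w k i"
  shows "(\<Sum>i<N. \<Sum>j\<in>{..<N} - {i}. w i j)
    = 2 * (\<Sum>j\<in>{..<N} - {k}. w k j) + (\<Sum>i\<in>{..<N} - {k}. \<Sum>j\<in>{..<N} - {i} - {k}. w i j)"
proof -
  have "(\<Sum>i<N. \<Sum>j\<in>{..<N} - {i}. w i j) = (\<Sum>j\<in>{..<N} - {k}. w k j) + (\<Sum>i\<in>{..<N} - {k}. \<Sum>j\<in>{..<N} - {i}. w i j)"
    using k by (intro sum.remove) auto
  also have "(\<Sum>i\<in>{..<N} - {k}. \<Sum>j\<in>{..<N} - {i}. w i j)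
    = (\<Sum>i\<in>{..<N} - {k}. w i k + (\<Sum>j\<in>{..<N} - {i} - {k}. w i j))"
    using k by (intro sum.cong refl sum.remove) auto
  also have "\<dots> = (\<Sum>i\<in>{..<N} - {k}. w k i) + (\<Sum>i\<in>{..<N} - {k}. \<Sum>j\<in>{..<N} - {i} - {k}. w i j)"
    using sym by (simp add: sum.distrib)
  finally show ?thesis by simp
qed

text \<open>
  The mean-field density is bounded below on balls, because its exponent is bounded there: \<open>V\<close> is continuous, and the
  convolution of \<open>W\<close> with \<open>\<pi>\<close> grows at most quadratically.
\<close>

lemma lsi_density_mean_field:
  assumes V: "smooth d \<beta>V V" and W: "\<And>x. x \<in> Rn d \<Longrightarrow> has_gradient d W (G x) x"
    and G: "\<And>x y. x \<in> Rn d \<Longrightarrow> y \<in> Rn d \<Longrightarrow>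
      vnorm d (vdiff d (G x) (G y)) \<le> L * vnorm d (vdiff d x y)" and L: "0 \<le> L"
    and mf: "mean_field_stationary d \<sigma> V W p" and pi: "\<pi> = density (leb d) (\<lambda>x. ennreal (p x))"
    and lsi: "LSI d \<pi> C"
  shows "lsi_density d p C \<pi>"
    and "\<exists>c>0. \<forall>x\<in>Rn d. p x = c * exp (- (2 / \<sigma>\<^sup>2) * V x - (2 / \<sigma>\<^sup>2) * (\<integral>y. W (vdiff d x y) \<partial>\<pi>))"
proof -
  define Wb where "Wb x = (\<integral>y. W (vdiff d x y) \<partial>\<pi>)" for x
  have pm: "p \<in> borel_measurable (leb d)" and pr: "prob_space \<pi>"
    and mom: "(\<integral>\<^sup>+x. ennreal ((vnorm d x)\<^sup>2) \<partial>\<pi>) < \<infinity>"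
    using mf unfolding mean_field_stationary_def prob_density_prop_to_def pi by auto
  obtain c where c: "c > 0" and pc: "\<And>x. x \<in> Rn d \<Longrightarrow>
      p x = c * exp (- (2 / \<sigma>\<^sup>2) * V x - (2 / \<sigma>\<^sup>2) * (\<integral>y. W (vdiff d x y) * p y \<partial>leb d))"
    using mf unfolding mean_field_stationary_def prob_density_prop_to_def space_leb by auto
  have p0: "0 \<le> p x" if "x \<in> Rn d" for x using pc[OF that] c by simp
  have Wm: "W \<in> borel_measurable (leb d)"
    by (rule measurable_continuous_leb[OF has_gradient_continuous[OF W]])
  have conv: "(\<integral>y. W (vdiff d x y) * p y \<partial>leb d) = Wb x" if x: "x \<in> Rn d" for x
  proof -
    have "(\<lambda>y. vdiff d x y) \<in> measurable (leb d) (leb d)"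
      using x by (intro measurable_vdiff) (auto simp: space_leb)
    from measurable_compose[OF this Wm]
    have "Wb x = (\<integral>y. p y *\<^sub>R W (vdiff d x y) \<partial>leb d)"
      unfolding Wb_def pi using p0 by (intro integral_density pm AE_I2) (auto simp: space_leb)
    then show ?thesis by (simp add: mult.commute)
  qed
  have form: "p x = c * exp (- (2 / \<sigma>\<^sup>2) * V x - (2 / \<sigma>\<^sup>2) * Wb x)" if "x \<in> Rn d" for x
    using pc[OF that] conv[OF that] by simp
  then show "\<exists>c>0. \<forall>x\<in>Rn d. p x = c * exp (- (2 / \<sigma>\<^sup>2) * V x - (2 / \<sigma>\<^sup>2) * (\<integral>y. W (vdiff d x y) \<partial>\<pi>))"
    using c unfolding Wb_def by auto
  interpret pi: prob_space \<pi> by (rule pr)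
  have spi: "space \<pi> = Rn d" by (simp add: pi space_leb)
  have im: "integrable \<pi> (\<lambda>y. (vnorm d y)\<^sup>2)"
    using mom by (intro integrableI_bounded) (auto simp: pi)
  have lower: "\<exists>c>0. \<forall>x\<in>Rn d. vnorm d x \<le> r \<longrightarrow> c \<le> p x" for r
  proof -
    obtain GV where GV: "\<And>x. x \<in> Rn d \<Longrightarrow> has_gradient d V (GV x) x"
      using V unfolding smooth_def by auto
    obtain B1 where B1: "\<And>x. x \<in> Rn d \<Longrightarrow> vnorm d x \<le> r \<Longrightarrow> \<bar>V x\<bar> \<le> B1"
      using continuous_bounded_on_ball[OF has_gradient_continuous[OF GV]] by metis
    obtain cW where cW: "cW \<ge> 0" "\<And>x. x \<in> Rn d \<Longrightarrow> \<bar>W x\<bar> \<le> cW * (1 + (vnorm d x)\<^sup>2)"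
      using lipschitz_gradient_growth[OF W G L] by metis
    define m2 where "m2 = (\<integral>y. (vnorm d y)\<^sup>2 \<partial>\<pi>)"
    define B2 where "B2 = cW * (1 + (2 * r\<^sup>2 + 2 * m2))"
    have B2: "\<bar>Wb x\<bar> \<le> B2" if x: "x \<in> Rn d" "vnorm d x \<le> r" for x
    proof -
      have "\<bar>Wb x\<bar> \<le> (\<integral>y. \<bar>W (vdiff d x y)\<bar> \<partial>\<pi>)"
        unfolding Wb_def by (rule integral_abs_bound)
      also have "\<dots> \<le> (\<integral>y. cW * (1 + (2 * r\<^sup>2 + 2 * (vnorm d y)\<^sup>2)) \<partial>\<pi>)"
      proof (rule integral_mono')
        show "integrable \<pi> (\<lambda>y. cW * (1 + (2 * r\<^sup>2 + 2 * (vnorm d y)\<^sup>2)))" using im by simp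
        fix y
        have "\<bar>W (vdiff d x y)\<bar> \<le> cW * (1 + (vnorm d (vdiff d x y))\<^sup>2)" using cW(2) by simp
        also have "\<dots> \<le> cW * (1 + (2 * (vnorm d x)\<^sup>2 + 2 * (vnorm d y)\<^sup>2))"
          using cW(1) by (intro mult_left_mono add_left_mono vnorm_vdiff_sq_le)
        also have "\<dots> \<le> cW * (1 + (2 * r\<^sup>2 + 2 * (vnorm d y)\<^sup>2))"
          using cW(1) x(2) by (intro mult_left_mono add_left_mono add_right_mono power_mono) auto
        finally show "\<bar>W (vdiff d x y)\<bar> \<le> cW * (1 + (2 * r\<^sup>2 + 2 * (vnorm d y)\<^sup>2))" .
        show "0 \<le> cW * (1 + (2 * r\<^sup>2 + 2 * (vnorm d y)\<^sup>2))" using cW(1) by simp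
      qed
      also have "\<dots> = B2" using im by (simp add: B2_def m2_def pi.prob_space)
      finally show ?thesis by simp
    qed
    define b where "b = c * exp (- ((2 / \<sigma>\<^sup>2) * B1 + (2 / \<sigma>\<^sup>2) * B2))"
    have "b \<le> p x" if x: "x \<in> Rn d" "vnorm d x \<le> r" for x
    proof -
      have "(2 / \<sigma>\<^sup>2) * V x \<le> (2 / \<sigma>\<^sup>2) * B1" "(2 / \<sigma>\<^sup>2) * Wb x \<le> (2 / \<sigma>\<^sup>2) * B2"
        using B1[OF x] B2[OF x] by (intro mult_left_mono; simp add: abs_le_iff)+
      then have "exp (- ((2 / \<sigma>\<^sup>2) * B1 + (2 / \<sigma>\<^sup>2) * B2)) \<le> exp (- (2 / \<sigma>\<^sup>2) * V x - (2 / \<sigma>\<^sup>2) * Wb x)" by simp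
      then show ?thesis unfolding b_def form[OF x(1)] using c by (intro mult_left_mono) auto
    qed
    moreover have "b > 0" using c by (simp add: b_def)
    ultimately show ?thesis by blast
  qed
  show "lsi_density d p C \<pi>"
    using pm pr mom lower lsi by unfold_locales (auto simp: pi prob_space_def)
qed

text \<open>
  The Lipschitz constant \<open>\<beta>W\<close> is enlarged to the largest \<open>L\<close> that the condition on the interaction strength admits; this treats
  \<open>\<beta>W = 0\<close>, and the negative \<open>\<beta>W\<close> that are possible for \<open>d = 0\<close>, together with the other cases.
\<close>

lemma particle_KL_le:
  assumes \<sigma>: "\<sigma> > 0" and V: "smooth d \<beta>V V" and W: "smooth d \<beta>W W" and ev: "even_fun d W"
    and mf: "mean_field_stationary d \<sigma> V W p" and pi: "\<pi> = density (leb d) (\<lambda>x. ennreal (p x))"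
    and lsi: "LSI d \<pi> C" and coup: "\<beta>W = 0 \<or> \<sigma> ^ 4 / (8 * \<beta>W\<^sup>2 * C\<^sup>2) \<ge> 3"
    and N: "N \<ge> 100" and ps: "particle_stationary d N \<sigma> V W q"
    and mu: "\<mu> = density (configs d N) (\<lambda>x. ennreal (q x))" and k: "k \<le> N"
  shows "KL (marginal d k \<mu>) (tensor_power k \<pi>) \<le> ereal (8 * (real d * (real k)\<^sup>2 / (real N)\<^sup>2))"
proof -
  have C: "C > 0" using lsi by (simp add: LSI_def)
  define L where "L = \<sigma>\<^sup>2 / (C * sqrt 24)"
  have L: "L > 0" using \<sigma> C by (simp add: L_def)
  have CL: "(C * L)\<^sup>2 = \<sigma> ^ 4 / 24"
    using C by (simp add: L_def power_divide power_mult_distrib)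
  have bL: "\<bar>\<beta>W\<bar> \<le> L"
  proof (cases "\<beta>W = 0")
    case False
    then have "0 < 8 * \<beta>W\<^sup>2 * C\<^sup>2" "3 \<le> \<sigma> ^ 4 / (8 * \<beta>W\<^sup>2 * C\<^sup>2)" using coup C by auto
    then have "3 * (8 * \<beta>W\<^sup>2 * C\<^sup>2) \<le> \<sigma> ^ 4" by (simp only: pos_le_divide_eq)
    moreover have "3 * (8 * \<beta>W\<^sup>2 * C\<^sup>2) = 24 * (C * \<bar>\<beta>W\<bar>)\<^sup>2" by (simp add: power_mult_distrib)
    ultimately have "24 * (C * \<bar>\<beta>W\<bar>)\<^sup>2 \<le> \<sigma> ^ 4" by (simp only:)
    moreover have "24 * t \<le> u \<Longrightarrow> t \<le> u / 24" for t u :: real by simp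
    ultimately have "(C * \<bar>\<beta>W\<bar>)\<^sup>2 \<le> (C * L)\<^sup>2" unfolding CL by blast
    then have "C * \<bar>\<beta>W\<bar> \<le> C * L" by (rule power2_le_imp_le) (use C L in simp)
    then show ?thesis by (simp only: mult_le_cancel_left_pos[OF C])
  qed (use L in simp)
  obtain G where "(\<forall>x\<in>Rn d. has_gradient d W (G x) x) \<and>
      (\<forall>x\<in>Rn d. \<forall>y\<in>Rn d. vnorm d (vdiff d (G x) (G y)) \<le> \<beta>W * vnorm d (vdiff d x y))"
    using W unfolding smooth_def ..
  then have WG: "\<And>x. x \<in> Rn d \<Longrightarrow> has_gradient d W (G x) x"
    and Gb: "\<And>x y. x \<in> Rn d \<Longrightarrow> y \<in> Rn d \<Longrightarrow> vnorm d (vdiff d (G x) (G y)) \<le> \<beta>W * vnorm d (vdiff d x y)"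
    by simp_all
  have GL: "vnorm d (vdiff d (G x) (G y)) \<le> L * vnorm d (vdiff d x y)" if "x \<in> Rn d" "y \<in> Rn d" for x y
    using Gb[OF that] mult_right_mono[OF order_trans[OF abs_ge_self bL] vnorm_nonneg, of d "vdiff d x y"] by linarith
  note base = lsi_density_mean_field[OF V WG GL less_imp_le[OF L] mf pi lsi]
  interpret I: interaction d p C \<pi> W G L
    using base(1) WG GL L by (intro interaction.intro interaction_axioms.intro)
  interpret X: iid \<pi> N by (rule iid.intro[OF I.prob])
  obtain cp where cp: "cp > 0" and pf: "\<And>x. x \<in> Rn d \<Longrightarrow> p x = cp * exp (- (2 / \<sigma>\<^sup>2) * V x - (2 / \<sigma>\<^sup>2) * I.Wbar x)"
    using base(2) unfolding I.Wbar_def by auto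
  have qm: "q \<in> borel_measurable (configs d N)" and prq: "prob_space \<mu>"
    and momq: "(\<integral>\<^sup>+x. ennreal (\<Sum>i<N. (vnorm d (x i))\<^sup>2) \<partial>\<mu>) < \<infinity>"
    using ps unfolding particle_stationary_def prob_density_prop_to_def mu by auto
  define E where "E x = (\<Sum>i<N. \<Sum>j\<in>{..<N} - {i}. W (vdiff d (x i) (x j)))" for x :: "nat \<Rightarrow> nat \<Rightarrow> real"
  define a where "a = 1 / (\<sigma>\<^sup>2 * (real N - 1))"
  obtain cq where cq: "cq > 0" and qf: "\<And>x. x \<in> space (configs d N) \<Longrightarrow>
      q x = cq * exp (- (2 / \<sigma>\<^sup>2) * (\<Sum>i<N. V (x i)) - a * E x)"
    using ps unfolding particle_stationary_def prob_density_prop_to_def E_def a_def by auto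
  have setsP: "sets X.P = sets (configs d N)"
    unfolding X.P_def configs_def by (intro sets_PiM_cong) auto
  have spaceP: "space X.P = space (configs d N)" by (rule sets_eq_imp_space_eq[OF setsP])
  have coord: "x i \<in> Rn d" if "x \<in> space X.P" "i < N" for x i
    using X.coord_in_space[OF that] by simp
  define pp where "pp x = (\<Prod>i<N. p (x i))" for x
  define r where "r x = q x / pp x" for x
  have pp: "pp x > 0" if "x \<in> space X.P" for x
    unfolding pp_def using coord[OF that] I.p_pos by (intro prod_pos) auto
  define \<kappa> where "\<kappa> = 2 / (\<sigma>\<^sup>2 * (real N - 1))"
  have rf: "r x = cq / cp ^ N * exp ((2 / \<sigma>\<^sup>2) * (\<Sum>i<N. I.Wbar (x i)) - a * E x)" if x: "x \<in> space X.P" for x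
  proof -
    have "pp x = (\<Prod>i<N. cp * exp (- (2 / \<sigma>\<^sup>2) * V (x i) - (2 / \<sigma>\<^sup>2) * I.Wbar (x i)))"
      unfolding pp_def using coord[OF x] by (intro prod.cong refl pf) auto
    also have "\<dots> = cp ^ N * exp (\<Sum>i<N. - (2 / \<sigma>\<^sup>2) * V (x i) - (2 / \<sigma>\<^sup>2) * I.Wbar (x i))"
      by (simp add: prod.distrib exp_sum)
    also have "(\<Sum>i<N. - (2 / \<sigma>\<^sup>2) * V (x i) - (2 / \<sigma>\<^sup>2) * I.Wbar (x i))
      = - (2 / \<sigma>\<^sup>2) * (\<Sum>i<N. V (x i)) - (2 / \<sigma>\<^sup>2) * (\<Sum>i<N. I.Wbar (x i))"
      by (simp only: sum_subtractf sum_distrib_left)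
    finally have "pp x = cp ^ N * exp (- (2 / \<sigma>\<^sup>2) * (\<Sum>i<N. V (x i)) - (2 / \<sigma>\<^sup>2) * (\<Sum>i<N. I.Wbar (x i)))" .
    moreover have "exp (A - B) / exp (A - D) = exp (D - B)" for A B D :: real
      by (simp add: exp_diff[symmetric])
    ultimately show ?thesis
      unfolding r_def qf[OF x[unfolded spaceP]] by (simp only: times_divide_times_eq[symmetric])
  qed
  have qr: "q x = pp x * r x" if "x \<in> space X.P" for x using pp[OF that] by (simp add: r_def)
  have r_pos: "0 < r x" if "x \<in> space X.P" for x using rf[OF that] cq cp by simp
  have cc: "(\<lambda>x. x i) \<in> measurable (configs d N) (leb d)" if "i \<in> {..<N}" for i
    unfolding configs_def using that by (rule measurable_component_singleton)
  have ppm: "pp \<in> borel_measurable (configs d N)"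
    unfolding pp_def by (intro borel_measurable_prod measurable_compose[OF cc I.p_meas])
  have rm: "r \<in> borel_measurable (configs d N)" unfolding r_def using qm ppm by measurable
  have rmP: "r \<in> borel_measurable X.P" using rm setsP by (simp cong: measurable_cong_sets)
  have Pd: "X.P = density (configs d N) (\<lambda>x. ennreal (pp x))"
  proof -
    have "PiM {..<N} (\<lambda>_. density (leb d) (\<lambda>x. ennreal (p x))) = density (configs d N) (\<lambda>x. \<Prod>i<N. ennreal (p (x i)))"
      unfolding configs_def by (rule PiM_density_prob[OF sigma_finite_leb]) (use I.prob pi in simp_all)
    then have "X.P = density (configs d N) (\<lambda>x. \<Prod>i<N. ennreal (p (x i)))"
      by (simp only: X.P_def pi[symmetric])
    also have "\<dots> = density (configs d N) (\<lambda>x. ennreal (pp x))"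
    proof (rule density_cong)
      show "(\<lambda>x. \<Prod>i<N. ennreal (p (x i))) \<in> borel_measurable (configs d N)"
        by (intro borel_measurable_prod_ennreal measurable_compose[OF cc]) (use I.p_meas in simp_all)
      show "(\<lambda>x. ennreal (pp x)) \<in> borel_measurable (configs d N)" using ppm by simp
      show "AE x in configs d N. (\<Prod>i<N. ennreal (p (x i))) = ennreal (pp x)"
        unfolding pp_def using coord I.p_pos spaceP
        by (intro AE_I2 prod_ennreal) (auto intro: less_imp_le)
    qed
    finally show ?thesis .
  qed
  have muP: "\<mu> = density X.P (\<lambda>x. ennreal (r x))"
  proof -
    have "density X.P (\<lambda>x. ennreal (r x)) = density (configs d N) (\<lambda>x. ennreal (pp x) * ennreal (r x))"
      unfolding Pd using ppm rm by (intro density_density_eq) auto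
    also have "\<dots> = density (configs d N) (\<lambda>x. ennreal (q x))"
      using ppm rm qm qr pp r_pos spaceP
      by (intro density_cong AE_I2) (auto simp: ennreal_mult[symmetric] less_imp_le)
    finally show ?thesis by (simp add: mu)
  qed
  have nnr: "(\<integral>\<^sup>+x. h x \<partial>\<mu>) = (\<integral>\<^sup>+x. ennreal (r x) * h x \<partial>X.P)" if "h \<in> borel_measurable X.P" for h
    unfolding muP using that rmP by (intro nn_integral_density) auto
  have r1: "(\<integral>\<^sup>+x. ennreal (r x) \<partial>X.P) = 1"
  proof -
    have "(\<integral>\<^sup>+x. 1 \<partial>\<mu>) = (\<integral>\<^sup>+x. ennreal (r x) * 1 \<partial>X.P)" by (rule nnr) simp
    then show ?thesis using prob_space.emeasure_space_1[OF prq] by simp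
  qed
  have r_int: "integrable X.P r"
    using r1 r_pos rmP by (intro integrableI_nonneg AE_I2) (auto intro: less_imp_le)
  have r_mass: "(\<integral>x. r x \<partial>X.P) = 1"
    using r1 nn_integral_eq_integral[OF r_int] r_pos
    by (metis AE_I2 ennreal_eq_1 less_imp_le)
  interpret Y: particle_system d p C \<pi> W G L N r \<kappa>
  proof unfold_locales
    show "0 < r x" if "x \<in> space X.P" for x by (rule r_pos[OF that])
    show "integrable X.P r" "(\<integral>x. r x \<partial>X.P) = 1" by (fact r_int r_mass)+
    show "100 \<le> N" by (rule N)
    show "0 < \<kappa>" using \<sigma> N by (simp add: \<kappa>_def)
    have "C * L * \<kappa> * (real N - 1) = C * L * (2 / \<sigma>\<^sup>2)" using N by (simp add: \<kappa>_def)
    then have "(C * L * \<kappa> * (real N - 1))\<^sup>2 = (C * L)\<^sup>2 * (2 / \<sigma>\<^sup>2)\<^sup>2" by (simp only: power_mult_distrib)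
    also have "\<dots> = 1 / 6" unfolding CL using \<sigma> by (simp add: power_divide)
    finally show "6 * (C * L * \<kappa> * (real N - 1))\<^sup>2 \<le> 1" by simp
  next
    fix \<tau> :: "nat \<Rightarrow> nat" and x assume b: "bij_betw \<tau> {..<N} {..<N}" and x: "x \<in> space X.P"
    have \<tau>: "\<tau> ` {..<N} \<subseteq> {..<N}" using b by (auto simp: bij_betw_def)
    have rx: "X.reindex \<tau> x \<in> space X.P" using measurable_space[OF X.measurable_reindex[OF \<tau>] x] .
    have 1: "(\<Sum>i<N. I.Wbar (X.reindex \<tau> x i)) = (\<Sum>i<N. I.Wbar (x i))"
      using sum.reindex_bij_betw[OF b, of "\<lambda>i. I.Wbar (x i)"] by (simp add: X.reindex_def)
    have "E (X.reindex \<tau> x) = (\<Sum>i<N. \<Sum>j\<in>{..<N} - {i}. W (vdiff d (x (\<tau> i)) (x (\<tau> j))))"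
      unfolding E_def by (simp add: X.reindex_def)
    also have "\<dots> = (\<Sum>i<N. \<Sum>j\<in>{..<N} - {\<tau> i}. W (vdiff d (x (\<tau> i)) (x j)))"
    proof (rule sum.cong[OF refl])
      fix i assume i: "i \<in> {..<N}"
      have "bij_betw \<tau> ({..<N} - {i}) ({..<N} - {\<tau> i})"
        using b i \<tau> by (intro bij_betw_DiffI) auto
      from sum.reindex_bij_betw[OF this, of "\<lambda>j. W (vdiff d (x (\<tau> i)) (x j))"]
      show "(\<Sum>j\<in>{..<N} - {i}. W (vdiff d (x (\<tau> i)) (x (\<tau> j)))) = (\<Sum>j\<in>{..<N} - {\<tau> i}. W (vdiff d (x (\<tau> i)) (x j)))" .
    qed
    also have "\<dots> = E x"
      unfolding E_def by (rule sum.reindex_bij_betw[OF b, of "\<lambda>i. \<Sum>j\<in>{..<N} - {i}. W (vdiff d (x i) (x j))"])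
    finally show "r (X.reindex \<tau> x) = r x" unfolding rf[OF x] rf[OF rx] 1 by simp
  next
    fix x l assume x: "x \<in> space X.P" and l: "l < N"
    define c1 where "c1 = (2 / \<sigma>\<^sup>2) * (\<Sum>i\<in>{..<N} - {l}. I.Wbar (x i))
      - a * (\<Sum>i\<in>{..<N} - {l}. \<Sum>j\<in>{..<N} - {i} - {l}. W (vdiff d (x i) (x j)))"
    define f where "f z = (2 / \<sigma>\<^sup>2) * I.Wbar z - \<kappa> * (\<Sum>j\<in>{..<N} - {l}. W (vdiff d z (x j))) + c1" for z
    define Df where "Df z i = (2 / \<sigma>\<^sup>2) * I.Gbar z i - \<kappa> * (\<Sum>j\<in>{..<N} - {l}. G (vdiff d z (x j)) i)" for z i
    have \<kappa>a: "\<kappa> = 2 * a" by (simp add: \<kappa>_def a_def)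
    have rz: "r (x(l := z)) = cq / cp ^ N * exp (1 * f z)" if z: "z \<in> Rn d" for z
    proof -
      have u: "x(l := z) \<in> space X.P" using z by (intro X.upd_in_space[OF x _ l]) simp
      have s1: "(\<Sum>i<N. I.Wbar ((x(l := z)) i)) = I.Wbar z + (\<Sum>i\<in>{..<N} - {l}. I.Wbar (x i))"
        using l by (subst sum.remove[of _ l]) auto
      have "E (x(l := z)) = 2 * (\<Sum>j\<in>{..<N} - {l}. W (vdiff d ((x(l := z)) l) ((x(l := z)) j)))
        + (\<Sum>i\<in>{..<N} - {l}. \<Sum>j\<in>{..<N} - {i} - {l}. W (vdiff d ((x(l := z)) i) ((x(l := z)) j)))"
        unfolding E_def
      proof (rule sum_pairs_split[OF l])
        fix i assume i: "i < N"
        have "vneg d (vdiff d ((x(l := z)) l) ((x(l := z)) i)) = vdiff d ((x(l := z)) i) ((x(l := z)) l)"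
          by (auto simp: vneg_def vdiff_def fun_eq_iff)
        then show "W (vdiff d ((x(l := z)) i) ((x(l := z)) l)) = W (vdiff d ((x(l := z)) l) ((x(l := z)) i))"
          using ev unfolding even_fun_def by (metis vdiff_in_Rn)
      qed
      also have "\<dots> = 2 * (\<Sum>j\<in>{..<N} - {l}. W (vdiff d z (x j)))
        + (\<Sum>i\<in>{..<N} - {l}. \<Sum>j\<in>{..<N} - {i} - {l}. W (vdiff d (x i) (x j)))"
        by simp
      finally have s2: "E (x(l := z)) = 2 * (\<Sum>j\<in>{..<N} - {l}. W (vdiff d z (x j)))
        + (\<Sum>i\<in>{..<N} - {l}. \<Sum>j\<in>{..<N} - {i} - {l}. W (vdiff d (x i) (x j)))" .
      show ?thesis unfolding rf[OF u] s1 s2 f_def c1_def \<kappa>a by (simp add: algebra_simps)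
    qed
    have hf: "has_partials d f Df"
      unfolding has_partials_def f_def Df_def
    proof (intro ballI allI impI)
      fix z i t assume z: "z \<in> Rn d" and i: "i < d"
      have s: "((\<lambda>s. \<Sum>j\<in>{..<N} - {l}. W (vdiff d (z(i := s)) (x j))) has_real_derivative
          (\<Sum>j\<in>{..<N} - {l}. G (vdiff d (z(i := t)) (x j)) i)) (at t)"
        by (intro DERIV_sum has_partialsD[OF has_partials_vdiff[OF WG] z i])
      show "((\<lambda>s. (2 / \<sigma>\<^sup>2) * I.Wbar (z(i := s)) - \<kappa> * (\<Sum>j\<in>{..<N} - {l}. W (vdiff d (z(i := s)) (x j))) + c1) has_real_derivative
          (2 / \<sigma>\<^sup>2) * I.Gbar (z(i := t)) i - \<kappa> * (\<Sum>j\<in>{..<N} - {l}. G (vdiff d (z(i := t)) (x j)) i)) (at t)"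
        using DERIV_add[OF DERIV_diff[OF DERIV_cmult[OF has_partialsD[OF I.has_partials_Wbar z i, of t], of "2 / \<sigma>\<^sup>2"]
              DERIV_cmult[OF s, of \<kappa>]] DERIV_const[of c1]] by simp
    qed
    have e: "has_partials d (\<lambda>z. cq / cp ^ N * exp (1 * f z)) (\<lambda>z i. cq / cp ^ N * (exp (1 * f z) * (1 * Df z i)))"
      by (rule has_partials_cmult[OF has_partials_exp[OF hf]])
    have Dd: "Df z i = - \<kappa> * (\<Sum>j\<in>{..<N} - {l}. I.dev z (x j) i)" for z i
    proof -
      have "(\<Sum>j\<in>{..<N} - {l}. I.dev z (x j) i) = (\<Sum>j\<in>{..<N} - {l}. G (vdiff d z (x j)) i) - (real N - 1) * I.Gbar z i"
        using l by (simp add: I.dev_def sum_subtractf of_nat_diff)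
      moreover have "\<kappa> * (real N - 1) = 2 / \<sigma>\<^sup>2"
      proof -
        have "t \<noteq> 0 \<Longrightarrow> 2 / (u * t) * t = 2 / u" for t u :: real by simp
        moreover have "real N - 1 \<noteq> 0" using N by simp
        ultimately show ?thesis unfolding \<kappa>_def by blast
      qed
      moreover have "D = S - t * g \<Longrightarrow> \<kappa> * t = u \<Longrightarrow> u * g - \<kappa> * S = - \<kappa> * D" for D S t g u :: real
        by (auto simp: algebra_simps)
      ultimately show ?thesis unfolding Df_def by blast
    qed
    show "has_partials d (\<lambda>z. r (x(l := z))) (\<lambda>z i. r (x(l := z)) * (- \<kappa> * (\<Sum>j\<in>{..<N} - {l}. I.dev z (x j) i)))"
    proof (rule has_partials_cong[OF e])
      show "cq / cp ^ N * exp (1 * f z) = r (x(l := z))" if "z \<in> Rn d" for z using rz[OF that] by simp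
      show "cq / cp ^ N * (exp (1 * f z) * (1 * Df z i)) = r (x(l := z)) * (- \<kappa> * (\<Sum>j\<in>{..<N} - {l}. I.dev z (x j) i))"
        if "z \<in> Rn d" for z i unfolding rz[OF that] Dd by simp
    qed
  next
    fix l assume l: "l < N"
    have cm: "(\<lambda>x. x i) \<in> measurable X.P (leb d)" if "i < N" for i
      using X.measurable_coord[OF that] measurable_cong_sets[OF refl I.sets_\<pi>, of X.P] by simp
    have vm: "(\<lambda>x. vnorm d (x i)) \<in> borel_measurable X.P" if "i < N" for i
      by (rule measurable_compose[OF cm[OF that] measurable_vnorm])
    have sm: "(\<lambda>x. ennreal (\<Sum>i<N. (vnorm d (x i))\<^sup>2)) \<in> borel_measurable X.P"
      using vm by (intro measurable_compose[OF _ measurable_ennreal] borel_measurable_sum borel_measurable_power) auto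
    show "integrable X.P (\<lambda>x. (vnorm d (x l))\<^sup>2 * r x)"
    proof (rule integrableI_nonneg)
      show "(\<lambda>x. (vnorm d (x l))\<^sup>2 * r x) \<in> borel_measurable X.P"
        by (intro borel_measurable_times borel_measurable_power vm l rmP)
      show "AE x in X.P. 0 \<le> (vnorm d (x l))\<^sup>2 * r x"
        using r_pos by (intro AE_I2 mult_nonneg_nonneg) (auto intro: less_imp_le)
      have "(\<integral>\<^sup>+x. ennreal ((vnorm d (x l))\<^sup>2 * r x) \<partial>X.P)
        \<le> (\<integral>\<^sup>+x. ennreal (r x) * ennreal (\<Sum>i<N. (vnorm d (x i))\<^sup>2) \<partial>X.P)"
      proof (rule nn_integral_mono)
        fix x assume x: "x \<in> space X.P"
        have "(vnorm d (x l))\<^sup>2 \<le> (\<Sum>i<N. (vnorm d (x i))\<^sup>2)" using l by (intro member_le_sum) auto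
        then have "(vnorm d (x l))\<^sup>2 * r x \<le> r x * (\<Sum>i<N. (vnorm d (x i))\<^sup>2)"
          using r_pos[OF x] by (simp add: mult.commute)
        then have "ennreal ((vnorm d (x l))\<^sup>2 * r x) \<le> ennreal (r x * (\<Sum>i<N. (vnorm d (x i))\<^sup>2))"
          by (rule ennreal_leI)
        also have "\<dots> = ennreal (r x) * ennreal (\<Sum>i<N. (vnorm d (x i))\<^sup>2)"
          using r_pos[OF x] by (intro ennreal_mult sum_nonneg) auto
        finally show "ennreal ((vnorm d (x l))\<^sup>2 * r x) \<le> ennreal (r x) * ennreal (\<Sum>i<N. (vnorm d (x i))\<^sup>2)" .
      qed
      also have "\<dots> = (\<integral>\<^sup>+x. ennreal (\<Sum>i<N. (vnorm d (x i))\<^sup>2) \<partial>\<mu>)" by (rule nnr[OF sm, symmetric])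
      finally show "(\<integral>\<^sup>+x. ennreal ((vnorm d (x l))\<^sup>2 * r x) \<partial>X.P) < \<infinity>" using momq by simp
    qed
  qed
  have "sets (configs d k) = sets (PiM {..<k} (\<lambda>_. \<pi>))"
    unfolding configs_def by (intro sets_PiM_cong) auto
  from Y.KL_marginal_le[OF k this]
  show ?thesis unfolding marginal_def tensor_power_def muP .
qed

text \<open>
  As \<open>ln 2 \<ge> 2/3\<close>, the factor 6 gives \<open>N \<ge> 4 a\<close> for \<open>a = k sqrt d / \<epsilon>\<close>, and the claim is \<open>8 a\<^sup>2 < N\<^sup>2\<close>.
\<close>

lemma N_large_imp:
  assumes d: "d > 0" and \<epsilon>: "\<epsilon> > 0" and k: "k \<ge> 1"
    and N: "real N \<ge> max 100 (6 * (real k * sqrt (real d) / \<epsilon>) * (ln (2 + real k * sqrt (real d) / \<epsilon>)) powr 1)"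
  shows "8 * (real d * (real k)\<^sup>2 / (real N)\<^sup>2) < \<epsilon>\<^sup>2"
proof -
  define a where "a = real k * sqrt (real d) / \<epsilon>"
  have a: "a > 0" using d \<epsilon> k by (simp add: a_def)
  have N0: "real N > 0" using N by simp
  have "2 / 3 \<le> ln (2 + a)" using ln2_ge_two_thirds a by (intro order_trans[OF ln2_ge_two_thirds]) simp
  then have "6 * a * (2 / 3) \<le> 6 * a * (ln (2 + a) powr 1)"
    using a by (intro mult_left_mono) auto
  then have "4 * a \<le> real N" using N unfolding a_def[symmetric] by simp
  then have "(4 * a)\<^sup>2 \<le> (real N)\<^sup>2" using a by (intro power_mono) auto
  then have "16 * a\<^sup>2 \<le> (real N)\<^sup>2" by (simp add: power_mult_distrib)
  then have "8 * a\<^sup>2 < (real N)\<^sup>2" using zero_less_power[OF a, of 2] by linarith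
  then have "8 * a\<^sup>2 / (real N)\<^sup>2 < 1" using N0 by simp
  then have "\<epsilon>\<^sup>2 * (8 * a\<^sup>2 / (real N)\<^sup>2) < \<epsilon>\<^sup>2 * 1" using \<epsilon> by (intro mult_strict_left_mono) auto
  also have "\<epsilon>\<^sup>2 * (8 * a\<^sup>2 / (real N)\<^sup>2) = 8 * (real d * (real k)\<^sup>2 / (real N)\<^sup>2)"
    using \<epsilon> by (simp add: a_def power_divide power_mult_distrib mult_ac)
  finally show ?thesis by simp
qed

theorem theorem3:
  "\<exists>C c C' c' :: real. C > 0 \<and> c > 0 \<and> C' > 0 \<and> c' > 0 \<and>
     (\<forall>(d::nat) (N::nat) (\<sigma>::real) (\<beta>V::real) (\<beta>W::real) (CLSI::real)
        (V :: (nat \<Rightarrow> real) \<Rightarrow> real) (W :: (nat \<Rightarrow> real) \<Rightarrow> real)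
        (p :: (nat \<Rightarrow> real) \<Rightarrow> real) (q :: (nat \<Rightarrow> nat \<Rightarrow> real) \<Rightarrow> real)
        (\<pi> :: (nat \<Rightarrow> real) measure) (\<mu> :: (nat \<Rightarrow> nat \<Rightarrow> real) measure).
        \<sigma> > 0 \<longrightarrow>
        smooth d \<beta>V V \<longrightarrow>
        smooth d \<beta>W W \<longrightarrow>
        even_fun d W \<longrightarrow>
        mean_field_stationary d \<sigma> V W p \<longrightarrow>
        \<pi> = density (leb d) (\<lambda>x. ennreal (p x)) \<longrightarrow>
        LSI d \<pi> CLSI \<longrightarrow>
        \<beta>W = 0 \<or> \<sigma> ^ 4 / (8 * \<beta>W\<^sup>2 * CLSI\<^sup>2) \<ge> 3 \<longrightarrow>
        N \<ge> 100 \<longrightarrow>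
        particle_stationary d N \<sigma> V W q \<longrightarrow>
        \<mu> = density (configs d N) (\<lambda>x. ennreal (q x)) \<longrightarrow>
        (\<forall>k\<in>{1..N}.
           KL (marginal d k \<mu>) (tensor_power k \<pi>)
             \<le> ereal (C * (real d * (real k)\<^sup>2 / (real N)\<^sup>2) * (ln (real N)) powr c) \<and>
           (\<forall>\<epsilon>>0.
              real N \<ge> max 100 (C' * (real k * sqrt (real d) / \<epsilon>) *
                          (ln (2 + real k * sqrt (real d) / \<epsilon>)) powr c') \<longrightarrow>
              KL (marginal d k \<mu>) (tensor_power k \<pi>) < ereal (\<epsilon>\<^sup>2))))"
proof (rule exI[of _ 8], rule exI[of _ 1], rule exI[of _ 6], rule exI[of _ 1], intro conjI allI impI ballI)
  fix d N :: nat and \<sigma> \<beta>V \<beta>W CLSI :: real and V W p :: "(nat \<Rightarrow> real) \<Rightarrow> real"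
    and q :: "(nat \<Rightarrow> nat \<Rightarrow> real) \<Rightarrow> real" and \<pi> :: "(nat \<Rightarrow> real) measure"
    and \<mu> :: "(nat \<Rightarrow> nat \<Rightarrow> real) measure" and k :: nat
  assume h: "\<sigma> > 0" "smooth d \<beta>V V" "smooth d \<beta>W W" "even_fun d W" "mean_field_stationary d \<sigma> V W p"
    "\<pi> = density (leb d) (\<lambda>x. ennreal (p x))" "LSI d \<pi> CLSI"
    "\<beta>W = 0 \<or> \<sigma> ^ 4 / (8 * \<beta>W\<^sup>2 * CLSI\<^sup>2) \<ge> 3" "N \<ge> 100" "particle_stationary d N \<sigma> V W q"
    "\<mu> = density (configs d N) (\<lambda>x. ennreal (q x))" and k: "k \<in> {1..N}"
  have KL: "KL (marginal d k \<mu>) (tensor_power k \<pi>) \<le> ereal (8 * (real d * (real k)\<^sup>2 / (real N)\<^sup>2))"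
    by (rule particle_KL_le[OF h]) (use k in simp)
  have "exp 1 \<le> real N" using exp_le h(9) by linarith
  then have ln1: "1 \<le> ln (real N)" using h(9) by (subst ln_ge_iff) auto
  have "8 * (real d * (real k)\<^sup>2 / (real N)\<^sup>2) * 1 \<le> 8 * (real d * (real k)\<^sup>2 / (real N)\<^sup>2) * ln (real N) powr 1"
    using ln1 by (intro mult_left_mono) auto
  with KL show "KL (marginal d k \<mu>) (tensor_power k \<pi>)
      \<le> ereal (8 * (real d * (real k)\<^sup>2 / (real N)\<^sup>2) * ln (real N) powr 1)"
    by (auto intro: order_trans)
  fix \<epsilon> :: real
  assume \<epsilon>: "\<epsilon> > 0" and big: "real N \<ge> max 100 (6 * (real k * sqrt (real d) / \<epsilon>) *
                          (ln (2 + real k * sqrt (real d) / \<epsilon>)) powr 1)"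
  have "8 * (real d * (real k)\<^sup>2 / (real N)\<^sup>2) < \<epsilon>\<^sup>2"
  proof (cases "d = 0")
    case False
    then show ?thesis using k by (intro N_large_imp[OF _ \<epsilon> _ big]) auto
  qed (use \<epsilon> in simp)
  with KL show "KL (marginal d k \<mu>) (tensor_power k \<pi>) < ereal (\<epsilon>\<^sup>2)"
    by (auto intro: le_less_trans)
qed simp_all

end
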